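(* Let $\mathbb{F}$ be an algebraically closed field and $T\in\mathbb{F}^{n_1\times n_2\times n_3}$. Then \[ \dim\{(x,y): T(x,y,\cdot)=0\}=\max_i\Big(\dim\big\{x\in\mathbb{F}^{n_1}: \dim\{y\in\mathbb{F}^{n_2}: T(x,y,\cdot)=0\}=i\big\}+i\Big)=\max_i\Big(\dim\{x\in\mathbb{F}^{n_1}:\operatorname{corank}T(x,\cdot,\cdot)=i\}+i\Big), \] and therefore \[ \mathrm{GR}(T)=\operatorname{codim}\{(x,y): T(x,y,\cdot)=0\}=\min_j\Big(\operatorname{codim}\{x\in\mathbb{F}^{n_1}: \operatorname{rank}T(x,\cdot,\cdot)=j\}+j\Big). \]
   Context: For $T\in\mathbb{F}^{n_1\times n_2\times n_3}$ write $T(x,y,z)=\sum_{i,j,k}T_{i,j,k}x_iy_jz_k$, $T(x,y,\cdot)=(T(x,y,e_k))_{k}$, and $T(x,\cdot,\cdot)$ for the $n_2\times n_3$ matrix $(T(x,e_j,e_k))_{j,k}$; its corank is $n_2$ minus its rank, i.e. the dimension of $\{y: T(x,y,\cdot)=0\}$. Dimensions are algebraic-geometric dimensions of (locally closed) subsets of affine space; the codimension of a subset of $\mathbb{F}^{n_1}$ (resp. $\mathbb{F}^{n_1}\times\mathbb{F}^{n_2}$) is $n_1$ (resp. $n_1+n_2$) minus its dimension. The geometric rank is $\mathrm{GR}(T)=\operatorname{codim}\{(x,y)\in\mathbb{F}^{n_1}\times\mathbb{F}^{n_2}: T(x,y,\cdot)=0\}$. *)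

theory Defs
  imports
    "HOL-Analysis.Analysis"
    "HOL-Library.Poly_Mapping"
    "HOL-Computational_Algebra.Polynomial"
begin

section \<open>Polynomials in the coordinates of affine space\<close>

text \<open>
  The type \<open>('n \<Rightarrow>\<^sub>0 nat) \<Rightarrow>\<^sub>0 'a\<close> is the polynomial ring over \<open>'a\<close> with one variable for each
  element of the index type \<open>'n\<close>: a polynomial maps exponent vectors to coefficients.
\<close>

type_synonym ('n, 'a) mpoly = "('n \<Rightarrow>\<^sub>0 nat) \<Rightarrow>\<^sub>0 'a"

definition mon_eval :: "('n::finite \<Rightarrow>\<^sub>0 nat) \<Rightarrow> 'a::comm_semiring_1 ^ 'n \<Rightarrow> 'a" where
  "mon_eval m v = (\<Prod>i\<in>UNIV. (v $ i) ^ Poly_Mapping.lookup m i)"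

definition mpoly_eval :: "('n::finite, 'a::comm_semiring_1) mpoly \<Rightarrow> 'a ^ 'n \<Rightarrow> 'a" where
  "mpoly_eval p v = (\<Sum>m\<in>Poly_Mapping.keys p. Poly_Mapping.lookup p m * mon_eval m v)"

definition zero_locus :: "('n::finite, 'a::comm_semiring_1) mpoly set \<Rightarrow> ('a ^ 'n) set" where
  "zero_locus P = {v. \<forall>p\<in>P. mpoly_eval p v = 0}"

lemma mon_eval_0 [simp]: "mon_eval 0 v = 1"
  by (simp add: mon_eval_def)

lemma mon_eval_add: "mon_eval (m + m') v = mon_eval m v * mon_eval m' v"
  by (simp add: mon_eval_def lookup_add power_add prod.distrib)

lemma mpoly_eval_superset:
  assumes "finite A" "Poly_Mapping.keys p \<subseteq> A"
  shows "mpoly_eval p v = (\<Sum>m\<in>A. Poly_Mapping.lookup p m * mon_eval m v)"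
  unfolding mpoly_eval_def using assms
  by (intro sum.mono_neutral_left) (auto simp: in_keys_iff)

lemma mpoly_eval_0 [simp]: "mpoly_eval 0 v = 0"
  by (simp add: mpoly_eval_def)

lemma mpoly_eval_single: "mpoly_eval (Poly_Mapping.single m c) v = c * mon_eval m v"
  by (subst mpoly_eval_superset[of "{m}"]) auto

lemma mpoly_eval_1 [simp]: "mpoly_eval 1 v = 1"
  using mpoly_eval_single[of 0 1 v] by simp

lemma mpoly_eval_add: "mpoly_eval (p + q) v = mpoly_eval p v + mpoly_eval q v"
proof -
  let ?A = "Poly_Mapping.keys p \<union> Poly_Mapping.keys q"
  have "Poly_Mapping.keys (p + q) \<subseteq> ?A"
    by (rule Poly_Mapping.keys_add)
  then show ?thesis
    by (simp add: mpoly_eval_superset[of ?A] lookup_add distrib_right sum.distrib)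
qed

lemma mpoly_eval_sum: "mpoly_eval (\<Sum>x\<in>A. f x) v = (\<Sum>x\<in>A. mpoly_eval (f x) v)"
  by (induction A rule: infinite_finite_induct) (simp_all add: mpoly_eval_add)

lemma mpoly_sum_singles:
  fixes p :: "('n, 'a::comm_semiring_1) mpoly"
  shows "p = (\<Sum>m\<in>Poly_Mapping.keys p. Poly_Mapping.single m (Poly_Mapping.lookup p m))"
  by (rule poly_mapping_eqI) (auto simp: lookup_sum lookup_single when_def in_keys_iff)

lemma mpoly_eval_mult: "mpoly_eval (p * q) v = mpoly_eval p v * mpoly_eval q v"
proof -
  have "p * q = (\<Sum>m\<in>Poly_Mapping.keys p. \<Sum>m'\<in>Poly_Mapping.keys q.
      Poly_Mapping.single (m + m') (Poly_Mapping.lookup p m * Poly_Mapping.lookup q m'))"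
    by (subst mpoly_sum_singles[of p], subst mpoly_sum_singles[of q])
      (simp add: sum_product mult_single)
  then have "mpoly_eval (p * q) v = (\<Sum>m\<in>Poly_Mapping.keys p. \<Sum>m'\<in>Poly_Mapping.keys q.
      Poly_Mapping.lookup p m * Poly_Mapping.lookup q m' * (mon_eval m v * mon_eval m' v))"
    by (simp add: mpoly_eval_sum mpoly_eval_single mon_eval_add)
  also have "\<dots> = mpoly_eval p v * mpoly_eval q v"
    by (simp add: mpoly_eval_def sum_product mult_ac)
  finally show ?thesis .
qed


section \<open>Zariski topology and dimension\<close>

definition zariski :: "('a::field ^ 'n::finite) topology" where
  "zariski = topology (\<lambda>U. \<exists>P. U = - zero_locus P)"

lemma istopology_zariski:
  "istopology (\<lambda>U. \<exists>P. U = - zero_locus (P :: ('n::finite, 'a::field) mpoly set))"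
proof (unfold istopology_def, intro conjI allI impI)
  fix S T :: "('a ^ 'n) set"
  assume "\<exists>P. S = - zero_locus P" "\<exists>P. T = - zero_locus P"
  then obtain P Q where PQ: "S = - zero_locus P" "T = - zero_locus Q"
    by auto
  have "S \<inter> T = - zero_locus {p * q | p q. p \<in> P \<and> q \<in> Q}"
    unfolding PQ by (force simp: zero_locus_def mpoly_eval_mult)
  then show "\<exists>P. S \<inter> T = - zero_locus P"
    by blast
next
  fix K :: "('a ^ 'n) set set"
  assume "\<forall>S\<in>K. \<exists>P. S = - zero_locus P"
  then obtain f where f: "\<And>S. S \<in> K \<Longrightarrow> S = - zero_locus (f S)"
    by metis
  have "\<Union>K = (\<Union>S\<in>K. - zero_locus (f S))"
    using f by auto
  also have "\<dots> = - zero_locus (\<Union>(f ` K))"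
    by (auto simp: zero_locus_def)
  finally show "\<exists>P. \<Union>K = - zero_locus P"
    by blast
qed

lemma openin_zariski: "openin zariski U \<longleftrightarrow> (\<exists>P. U = - zero_locus P)"
  by (simp add: zariski_def topology_inverse'[OF istopology_zariski])

lemma topspace_zariski [simp]: "topspace zariski = UNIV"
proof -
  have "openin zariski (UNIV :: ('a::field ^ 'n::finite) set)"
    unfolding openin_zariski by (rule exI[of _ "{1}"]) (simp add: zero_locus_def)
  then show ?thesis
    using openin_subset by blast
qed

lemma closedin_zariski: "closedin zariski C \<longleftrightarrow> (\<exists>P. C = zero_locus P)"
  unfolding closedin_def openin_zariski
  by (simp add: Compl_eq_Diff_UNIV[symmetric])

definition irreducible_space :: "'a topology \<Rightarrow> bool" where
  "irreducible_space X \<longleftrightarrow> topspace X \<noteq> {} \<and>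
     (\<forall>A B. closedin X A \<and> closedin X B \<and> topspace X = A \<union> B
        \<longrightarrow> A = topspace X \<or> B = topspace X)"

text \<open>
  The supremum of the lengths \<open>n\<close> of chains \<open>Z 0 \<subset> \<dots> \<subset> Z n\<close> of irreducible closed subsets.
  It lives in \<^typ>\<open>ereal\<close>, so that the empty space has dimension \<open>-\<infinity>\<close>.
\<close>

definition krull_dim :: "'a topology \<Rightarrow> ereal" where
  "krull_dim X = (SUP n \<in> {n. \<exists>Z :: nat \<Rightarrow> 'a set.
      (\<forall>i\<le>n. closedin X (Z i) \<and> irreducible_space (subtopology X (Z i))) \<and>
      (\<forall>i<n. Z i \<subset> Z (Suc i))}. ereal (real n))"

definition zdim :: "('a::field ^ 'n::finite) set \<Rightarrow> ereal" where
  "zdim S = krull_dim (subtopology zariski S)"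

definition zcodim :: "('a::field ^ 'n::finite) set \<Rightarrow> ereal" where
  "zcodim S = ereal (real CARD('n)) - zdim S"


section \<open>Tensors\<close>

text \<open>
  A tensor of format \<open>n1 \<times> n2 \<times> n3\<close> is a \<open>T :: 'a ^ 'n3 ^ 'n2 ^ 'n1\<close> with entries
  \<open>T $ i $ j $ k\<close>; the index of the leftmost factor is the outermost one.
\<close>

definition tensor_form ::
  "'a::field ^ 'n3 ^ 'n2 ^ 'n1 \<Rightarrow> 'a ^ 'n1 \<Rightarrow> 'a ^ 'n2 \<Rightarrow> 'a ^ 'n3 \<Rightarrow> 'a" where
  "tensor_form T x y z =
     (\<Sum>i\<in>UNIV. \<Sum>j\<in>UNIV. \<Sum>k\<in>UNIV. T $ i $ j $ k * x $ i * y $ j * z $ k)"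

text \<open>The vector \<open>T(x, y, \<cdot>)\<close> and the matrix \<open>T(x, \<cdot>, \<cdot>)\<close>, whose rows are indexed by \<open>'n2\<close>.\<close>

definition tensor_vec ::
  "'a::field ^ 'n3 ^ 'n2 ^ 'n1 \<Rightarrow> 'a ^ 'n1 \<Rightarrow> 'a ^ 'n2 \<Rightarrow> 'a ^ 'n3" where
  "tensor_vec T x y = (\<chi> k. tensor_form T x y (axis k 1))"

definition tensor_mat ::
  "'a::field ^ 'n3 ^ 'n2 ^ 'n1 \<Rightarrow> 'a ^ 'n1 \<Rightarrow> 'a ^ 'n3 ^ 'n2" where
  "tensor_mat T x = (\<chi> j k. tensor_form T x (axis j 1) (axis k 1))"

definition corank :: "'a::field ^ 'n3 ^ 'n2 \<Rightarrow> nat" where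
  "corank A = CARD('n2) - rank A"

text \<open>
  The product of two affine spaces is the affine space on the disjoint union of the coordinates
  (its Zariski topology is not the product topology).
\<close>

definition join_vec :: "'a ^ 'n1 \<Rightarrow> 'a ^ 'n2 \<Rightarrow> 'a ^ ('n1 + 'n2)" where
  "join_vec x y = (\<chi> i. case i of Inl a \<Rightarrow> x $ a | Inr b \<Rightarrow> y $ b)"

definition geometric_rank :: "'a::field ^ 'n3 ^ 'n2 ^ 'n1 \<Rightarrow> ereal" where
  "geometric_rank T = zcodim {join_vec x y | x y. tensor_vec T x y = 0}"

end

theory Submission
  imports Defs "HOL-Library.Function_Algebras"
begin

text \<open>
  The Krull dimension of a locally closed set \<open>S\<close> is the largest number of coordinates that are
  algebraically independent on \<open>S\<close>.  A chain of \<open>n + 1\<close> irreducible sets yields \<open>n\<close> algebraically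
  independent polynomials on its top member, and counting the dimension of the polynomials of
  bounded degree compares these with coordinates.  Conversely, if \<open>d\<close> coordinates are independent
  on \<open>S\<close>, the projection of \<open>S\<close> to them contains a non-empty open set, so a generic hyperplane
  section leaves \<open>d - 1\<close> of them independent, which builds a chain of length \<open>d\<close> from the top.

  For the tensor, an irreducible part of the zero set over which \<open>T(x, \<cdot>, \<cdot>)\<close> has corank \<open>i\<close> is
  generically parametrised, by Cramer's rule, by \<open>x\<close> and \<open>i\<close> free coordinates of \<open>y\<close>.  Finitely
  many such parts cover an irreducible set only if one of them is dense in it, which gives the
  maximum over \<open>i\<close>.
\<close>

section \<open>Polynomial functions\<close>

text \<open>The strata of fixed corank are locally closed but in general not closed, so a lower
  bound needs chains that stay off a hypersurface \<open>h = 0\<close>; this is why prime ideals,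
  lifted points and chains all carry an \<open>h\<close>. Irreducibility, independence and density
  are defined for arbitrary sets, through the polynomials vanishing on them, so that dense parts and
  projections inherit them directly. Polynomials are functions, which over an infinite field loses
  nothing and turns substitution into composition; the variable set and a degree bound are tracked
  by the inductive predicate. In the dimension count an algebraic coordinate satisfies an equation
  whose leading coefficient is not constant. A common denominator absorbs the powers of that
  coefficient, and since only the exponent of the degree bound matters, all constants may be crude.
  One elimination statement, \<open>prime_ideal_lift\<close>, yields both the Nullstellensatz, when
  no coordinate is kept, and the generic hyperplane section, when the independent coordinates are
  kept.\<close>

inductive poly_of_degree_le :: "'v set \<Rightarrow> nat \<Rightarrow> (('v \<Rightarrow> 'a::comm_ring_1) \<Rightarrow> 'a) \<Rightarrow> bool" for U where
  const: "poly_of_degree_le U N (\<lambda>s. c)"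
| var: "v \<in> U \<Longrightarrow> 0 < N \<Longrightarrow> poly_of_degree_le U N (\<lambda>s. s v)"
| add: "poly_of_degree_le U N f \<Longrightarrow> poly_of_degree_le U N g \<Longrightarrow>
    poly_of_degree_le U N (\<lambda>s. f s + g s)"
| mult: "poly_of_degree_le U N f \<Longrightarrow> poly_of_degree_le U M g \<Longrightarrow> N + M \<le> K \<Longrightarrow>
    poly_of_degree_le U K (\<lambda>s. f s * g s)"

definition poly_le :: "'v set \<Rightarrow> nat \<Rightarrow> (('v \<Rightarrow> 'a::comm_ring_1) \<Rightarrow> 'a) set" where
  "poly_le U N = {f. poly_of_degree_le U N f}"

lemma mem_poly_le: "poly_of_degree_le U N f \<longleftrightarrow> f \<in> poly_le U N"
  by (simp add: poly_le_def)

lemmas poly_le_intros = poly_of_degree_le.intros[unfolded mem_poly_le]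
lemmas poly_le_const = poly_of_degree_le.const[unfolded mem_poly_le]
lemmas poly_le_var = poly_of_degree_le.var[unfolded mem_poly_le]
lemmas poly_le_add = poly_of_degree_le.add[unfolded mem_poly_le]
lemmas poly_le_mult = poly_of_degree_le.mult[unfolded mem_poly_le]
lemmas poly_le_induct [consumes 1, case_names const var add mult] =
  poly_of_degree_le.induct[unfolded mem_poly_le]

definition polys :: "'v set \<Rightarrow> (('v \<Rightarrow> 'a::comm_ring_1) \<Rightarrow> 'a) set" where
  "polys U = (\<Union>N. poly_le U N)"

lemma poly_le_mono:
  assumes "f \<in> poly_le U N" "N \<le> N'" "U \<subseteq> U'"
  shows "f \<in> poly_le U' N'"
  using assms
proof (induction arbitrary: N' rule: poly_le_induct)
  case (mult N f M g K)
  have "f \<in> poly_le U' N" "g \<in> poly_le U' M"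
    using mult by auto
  then show ?case
    using mult by (intro poly_le_mult[of f _ N g M]) auto
qed (auto intro: poly_le_intros)

lemma poly_le_uminus: "f \<in> poly_le U N \<Longrightarrow> (\<lambda>s. - f s) \<in> poly_le U N"
  using poly_le_mult[OF poly_le_const[where N = 0 and c = "-1"], of f U N N] by simp

lemma poly_le_sum:
  "(\<And>x. x \<in> A \<Longrightarrow> f x \<in> poly_le U N) \<Longrightarrow> (\<lambda>s. \<Sum>x\<in>A. f x s) \<in> poly_le U N"
  by (induction A rule: infinite_finite_induct) (auto intro: poly_le_intros)

lemma poly_le_power: "f \<in> poly_le U N \<Longrightarrow> k * N \<le> M \<Longrightarrow> (\<lambda>s. f s ^ k) \<in> poly_le U M"
proof (induction k arbitrary: M)
  case (Suc k)
  have "(\<lambda>s. f s ^ k) \<in> poly_le U (k * N)"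
    using Suc by auto
  then show ?case
    using poly_le_mult[of f U N "\<lambda>s. f s ^ k" "k * N" M] Suc.prems by simp
qed (auto intro: poly_le_intros)

lemma poly_le_prod:
  assumes "\<And>x. x \<in> A \<Longrightarrow> f x \<in> poly_le U (d x)" "(\<Sum>x\<in>A. d x) \<le> M"
  shows "(\<lambda>s. \<Prod>x\<in>A. f x s) \<in> poly_le U M"
  using assms
proof (induction A arbitrary: M rule: infinite_finite_induct)
  case (insert x A)
  have "(\<lambda>s. \<Prod>x\<in>A. f x s) \<in> poly_le U (\<Sum>x\<in>A. d x)"
    using insert by auto
  then show ?case
    using insert poly_le_mult[of "f x" U "d x" "\<lambda>s. \<Prod>x\<in>A. f x s" "\<Sum>x\<in>A. d x" M] by simp
qed (auto intro: poly_le_intros)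

lemma poly_le_polys: "f \<in> poly_le U N \<Longrightarrow> f \<in> polys U"
  by (auto simp: polys_def)

lemma polysE:
  assumes "f \<in> polys U"
  obtains N where "f \<in> poly_le U N"
  using assms by (auto simp: polys_def)

lemma polys_mono: "f \<in> polys U \<Longrightarrow> U \<subseteq> U' \<Longrightarrow> f \<in> polys U'"
  by (meson order_refl poly_le_mono poly_le_polys polysE)

lemma polys_const: "(\<lambda>s. c) \<in> polys U"
  by (rule poly_le_polys[OF poly_le_const[where N = 0]])

lemma polys_var: "v \<in> U \<Longrightarrow> (\<lambda>s. s v) \<in> polys U"
  by (rule poly_le_polys[OF poly_le_var[where N = 1]]) auto

lemma polys_add: "f \<in> polys U \<Longrightarrow> g \<in> polys U \<Longrightarrow> (\<lambda>s. f s + g s) \<in> polys U"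
proof (elim polysE)
  fix N M assume "f \<in> poly_le U N" "g \<in> poly_le U M"
  then have "f \<in> poly_le U (max N M)" "g \<in> poly_le U (max N M)"
    by (auto elim: poly_le_mono)
  then show ?thesis
    by (rule poly_le_polys[OF poly_le_add])
qed

lemma polys_mult: "f \<in> polys U \<Longrightarrow> g \<in> polys U \<Longrightarrow> (\<lambda>s. f s * g s) \<in> polys U"
  by (elim polysE) (rule poly_le_polys[OF poly_le_mult[OF _ _ order_refl]])

lemma polys_uminus: "f \<in> polys U \<Longrightarrow> (\<lambda>s. - f s) \<in> polys U"
  by (elim polysE) (rule poly_le_polys[OF poly_le_uminus])

lemma polys_diff: "f \<in> polys U \<Longrightarrow> g \<in> polys U \<Longrightarrow> (\<lambda>s. f s - g s) \<in> polys U"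
  using polys_add[OF _ polys_uminus, of f U g] by simp

lemma polys_sum:
  "(\<And>x. x \<in> A \<Longrightarrow> f x \<in> polys U) \<Longrightarrow> (\<lambda>s. \<Sum>x\<in>A. f x s) \<in> polys U"
  by (induction A rule: infinite_finite_induct) (auto intro: polys_const polys_add)

lemma polys_prod:
  "(\<And>x. x \<in> A \<Longrightarrow> f x \<in> polys U) \<Longrightarrow> (\<lambda>s. \<Prod>x\<in>A. f x s) \<in> polys U"
  by (induction A rule: infinite_finite_induct) (auto intro: polys_const polys_mult)

lemma polys_power: "f \<in> polys U \<Longrightarrow> (\<lambda>s. f s ^ k) \<in> polys U"
  by (induction k) (auto intro: polys_const polys_mult)

lemmas polys_intros = polys_const polys_var polys_add polys_mult polys_diff polys_sum polys_prod
  polys_power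

lemma polys_induct [consumes 1, case_names const var add mult]:
  assumes "f \<in> polys U"
    and "\<And>c. P (\<lambda>s. c)" "\<And>v. v \<in> U \<Longrightarrow> P (\<lambda>s. s v)"
    and "\<And>f g. f \<in> polys U \<Longrightarrow> g \<in> polys U \<Longrightarrow> P f \<Longrightarrow> P g \<Longrightarrow> P (\<lambda>s. f s + g s)"
    and "\<And>f g. f \<in> polys U \<Longrightarrow> g \<in> polys U \<Longrightarrow> P f \<Longrightarrow> P g \<Longrightarrow> P (\<lambda>s. f s * g s)"
  shows "P f"
proof -
  obtain N where "f \<in> poly_le U N"
    using assms(1) by (rule polysE)
  then show ?thesis
    by (induction rule: poly_le_induct) (use assms poly_le_polys in blast)+
qed

lemma polys_subst:
  assumes "f \<in> polys U" "\<And>v. v \<in> U \<Longrightarrow> \<sigma> v \<in> polys U'"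
  shows "(\<lambda>s. f (\<lambda>v. \<sigma> v s)) \<in> polys U'"
  using assms by (induction rule: polys_induct) (auto intro: polys_intros)

lemma polys_cong:
  assumes "f \<in> polys U" "\<And>v. v \<in> U \<Longrightarrow> s v = s' v"
  shows "f s = f s'"
  using assms by (induction rule: polys_induct) auto

text \<open>Powers of \<open>v\<close> are collected along the construction of \<open>f\<close>;
  products are convolved, with empty inner sums for the indices beyond the actual degree. Bounding
  every coefficient by the same \<open>N\<close> is crude but enough, since later counts use only
  the order of growth.\<close>

lemma poly_le_insert:
  assumes "f \<in> poly_le (insert v U) N"
  shows "\<exists>c. (\<forall>k. c k \<in> poly_le U N) \<and> f = (\<lambda>s. \<Sum>k\<le>N. c k s * s v ^ k)"
  using assms
proof (induction rule: poly_le_induct)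
  case (const N c)
  show ?case
  proof (intro exI[of _ "\<lambda>k s. if k = 0 then c else 0"] conjI allI)
    fix k show "(\<lambda>s. if k = 0 then c else 0) \<in> poly_le U N"
      by (rule poly_le_const)
  qed (simp add: if_distrib[of "\<lambda>x. x * _"] sum.delta cong: if_cong)
next
  case (var w N)
  show ?case
  proof (cases "w = v")
    case True
    show ?thesis
    proof (intro exI[of _ "\<lambda>k s. if k = 1 then 1 else 0"] conjI allI)
      fix k :: nat show "(\<lambda>s. if k = 1 then 1 else 0) \<in> poly_le U N"
        by (rule poly_le_const)
    qed (use True var in \<open>simp add: if_distrib[of "\<lambda>x. x * _"] sum.delta cong: if_cong\<close>)
  next
    case False
    show ?thesis
    proof (intro exI[of _ "\<lambda>k s. if k = 0 then s w else 0"] conjI allI)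
      fix k :: nat show "(\<lambda>s. if k = 0 then s w else 0) \<in> poly_le U N"
        by (cases "k = 0") (use False var in \<open>auto intro: poly_le_intros\<close>)
    qed (simp add: if_distrib[of "\<lambda>x. x * _"] sum.delta cong: if_cong)
  qed
next
  case (add N f g)
  then obtain c d where "\<And>k. c k \<in> poly_le U N" "\<And>k. d k \<in> poly_le U N"
    "f = (\<lambda>s. \<Sum>k\<le>N. c k s * s v ^ k)" "g = (\<lambda>s. \<Sum>k\<le>N. d k s * s v ^ k)"
    by blast
  then show ?case
    by (intro exI[of _ "\<lambda>k s. c k s + d k s"])
      (auto simp: algebra_simps sum.distrib intro: poly_le_add)
next
  case (mult N f M g K)
  then obtain c d where cd: "\<And>k. c k \<in> poly_le U N" "\<And>k. d k \<in> poly_le U M"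
    and fg: "f = (\<lambda>s. \<Sum>k\<le>N. c k s * s v ^ k)" "g = (\<lambda>s. \<Sum>k\<le>M. d k s * s v ^ k)"
    by blast
  let ?I = "{..N} \<times> {..M}"
  let ?e = "\<lambda>k s. \<Sum>(i, j) \<in> {p \<in> ?I. fst p + snd p = k}. c i s * d j s"
  have "f s * g s = (\<Sum>k\<le>K. ?e k s * s v ^ k)" for s
  proof -
    have "f s * g s = (\<Sum>(i, j)\<in>?I. c i s * d j s * s v ^ (i + j))"
      unfolding fg sum_product sum.cartesian_product
      by (intro sum.cong) (auto simp: power_add algebra_simps)
    also have "\<dots> = (\<Sum>k\<le>K. \<Sum>(i, j)\<in>{p \<in> ?I. fst p + snd p = k}. c i s * d j s * s v ^ (i + j))"
      by (rule sum.group[symmetric]) (use mult in auto)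
    also have "\<dots> = (\<Sum>k\<le>K. ?e k s * s v ^ k)"
      by (intro sum.cong) (auto simp: sum_distrib_right intro!: sum.cong)
    finally show ?thesis .
  qed
  moreover have "?e k \<in> poly_le U K" for k
    unfolding case_prod_beta
    by (intro poly_le_sum poly_le_mult[OF cd]) (use mult in auto)
  ultimately show ?case
    by (intro exI[of _ ?e]) auto
qed

lemma polys_insert:
  assumes "f \<in> polys (insert v U)"
  obtains N c where "\<And>k. c k \<in> polys U" "f = (\<lambda>s. \<Sum>k<N. c k s * s v ^ k)"
proof -
  obtain N where "f \<in> poly_le (insert v U) N"
    using assms by (rule polysE)
  then obtain c where "\<And>k. c k \<in> poly_le U N" "f = (\<lambda>s. \<Sum>k<Suc N. c k s * s v ^ k)"
    using poly_le_insert[of f v U N] by (auto simp: lessThan_Suc_atMost)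
  then show thesis
    using that[of c "Suc N"] poly_le_polys by blast
qed

lemma polys_on_line:
  assumes "f \<in> polys U"
  shows "\<exists>p. \<forall>t. f (\<lambda>v. s v + t * d v) = poly p t"
  using assms
proof (induction rule: polys_induct)
  case (const c)
  then show ?case by (intro exI[of _ "[:c:]"]) simp
next
  case (var v)
  then show ?case by (intro exI[of _ "[:s v, d v:]"]) simp
next
  case (add f g)
  then show ?case by (metis poly_add)
next
  case (mult f g)
  then show ?case by (metis poly_mult)
qed

text \<open>Euclid's argument: over a finite field the product of all \<open>X - a\<close>, plus 1,
  would have positive degree and no root.\<close>

lemma infinite_alg_closed: "infinite (UNIV :: 'a::alg_closed_field set)"
proof
  assume fin: "finite (UNIV :: 'a set)"
  define p :: "'a poly" where "p = (\<Prod>a\<in>UNIV. [:-a, 1:]) + 1"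
  have 1: "poly p x = 1" for x
    using fin by (auto simp: p_def poly_prod)
  have "degree (\<Prod>a\<in>(UNIV :: 'a set). [:-a, 1:]) = card (UNIV :: 'a set)"
    by (subst degree_prod_eq_sum_degree) auto
  moreover have "card (UNIV :: 'a set) > 0"
    using fin by (simp add: card_gt_0_iff)
  ultimately have "degree p > 0"
    unfolding p_def by (subst degree_add_eq_left) auto
  then show False
    using alg_closed_imp_poly_has_root[of p] 1 by auto
qed

lemma poly_eq_0_alg_closed:
  fixes p :: "'a::alg_closed_field poly"
  assumes "\<And>t. poly p t = 0"
  shows "p = 0"
  using poly_roots_finite[of p] infinite_alg_closed assms by auto

text \<open>Join a non-zero of one factor to a non-zero of the other by a line.\<close>

lemma polys_no_zero_divisors:
  fixes f g :: "('v \<Rightarrow> 'a::alg_closed_field) \<Rightarrow> 'a"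
  assumes "f \<in> polys U" "g \<in> polys U" "\<And>s. f s * g s = 0"
  shows "f = (\<lambda>s. 0) \<or> g = (\<lambda>s. 0)"
proof (rule ccontr)
  assume "\<not> ?thesis"
  then obtain s s' where s: "f s \<noteq> 0" "g s' \<noteq> 0"
    by (auto simp: fun_eq_iff)
  define l where "l t = (\<lambda>v. s v + t * (s' v - s v))" for t
  obtain p q where p: "\<And>t. f (l t) = poly p t" and q: "\<And>t. g (l t) = poly q t"
    using polys_on_line[OF assms(1), of s "\<lambda>v. s' v - s v"]
      polys_on_line[OF assms(2), of s "\<lambda>v. s' v - s v"] unfolding l_def by blast
  have "poly (p * q) t = 0" for t
    using assms(3)[of "l t"] by (simp add: p q)
  then have "p = 0 \<or> q = 0"
    using poly_eq_0_alg_closed[of "p * q"] by simp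
  moreover have "l 0 = s" "l 1 = s'"
    by (auto simp: l_def)
  ultimately show False
    using s p[of 0] q[of 1] by auto
qed

lemma power_sum_eq_0:
  fixes c :: "nat \<Rightarrow> 'a::alg_closed_field"
  assumes "\<And>t. (\<Sum>k<n. c k * t ^ k) = 0" "k < n"
  shows "c k = 0"
proof -
  define p where "p = (\<Sum>k<n. monom (c k) k)"
  have "poly p t = 0" for t
    using assms(1)[of t] by (simp add: p_def poly_sum poly_monom)
  then have "p = 0"
    by (rule poly_eq_0_alg_closed)
  moreover have "coeff p k = c k"
    using assms(2) by (simp add: p_def coeff_sum sum.delta)
  ultimately show ?thesis
    by simp
qed

section \<open>Irreducible sets and growth\<close>

text \<open>The polynomials vanishing on \<open>W\<close> form a prime ideal. Since \<open>W\<close>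
  need not be closed, the notion applies to strata and to projections.\<close>

definition irr :: "('v \<Rightarrow> 'a::field) set \<Rightarrow> bool" where
  "irr W \<longleftrightarrow> W \<noteq> {} \<and> (\<forall>f\<in>polys UNIV. \<forall>g\<in>polys UNIV.
     (\<forall>s\<in>W. f s * g s = 0) \<longrightarrow> (\<forall>s\<in>W. f s = 0) \<or> (\<forall>s\<in>W. g s = 0))"

text \<open>Equivalently, the projection of \<open>W\<close> to the coordinates in \<open>K\<close>
  is Zariski dense.\<close>

definition indep_on :: "('v \<Rightarrow> 'a::field) set \<Rightarrow> 'v set \<Rightarrow> bool" where
  "indep_on W K \<longleftrightarrow> (\<forall>w\<in>polys K. (\<forall>s\<in>W. w s = 0) \<longrightarrow> w = (\<lambda>s. 0))"

lemma irrD: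
  assumes "irr W" "f \<in> polys U" "g \<in> polys V" "\<And>s. s \<in> W \<Longrightarrow> f s * g s = 0"
  shows "(\<forall>s\<in>W. f s = 0) \<or> (\<forall>s\<in>W. g s = 0)"
proof -
  have "f \<in> polys UNIV" "g \<in> polys UNIV"
    using assms(2,3) by (auto elim: polys_mono)
  then show ?thesis
    using assms(1,4) unfolding irr_def by blast
qed

lemma irr_mult_nz:
  assumes "irr W" "f \<in> polys U" "g \<in> polys V" "\<exists>s\<in>W. f s \<noteq> 0" "\<exists>s\<in>W. g s \<noteq> 0"
  shows "\<exists>s\<in>W. f s * g s \<noteq> 0"
  using irrD[OF assms(1-3)] assms(4,5) by blast

section \<open>Linear dependence of functions and the growth of spaces of polynomials\<close>

interpretation fn: vector_space "\<lambda>(c :: 'a::field) (f :: 'x \<Rightarrow> 'a) x. c * f x"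
  by standard (auto simp: algebra_simps fun_eq_iff)

lemma fn_span_mult:
  assumes "f \<in> fn.span B" "\<And>b. b \<in> B \<Longrightarrow> (\<lambda>s. b s * m s) \<in> fn.span B'"
  shows "(\<lambda>s. f s * m s) \<in> fn.span B'"
  using assms(1)
proof (induction rule: fn.span_induct_alt)
  case base
  show ?case
    using fn.span_zero[of B'] by (simp add: zero_fun_def)
next
  case (step c b f)
  have "(\<lambda>s. c * (b s * m s)) + (\<lambda>s. f s * m s) \<in> fn.span B'"
    using step assms(2) by (intro fn.span_add fn.span_scale) auto
  then show ?case
    by (simp add: plus_fun_def algebra_simps)
qed

lemma fn_span_sum:
  "(\<And>i. i \<in> A \<Longrightarrow> f i \<in> fn.span B) \<Longrightarrow> (\<lambda>s. \<Sum>i\<in>A. f i s) \<in> fn.span B"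
proof (induction A rule: infinite_finite_induct)
  case (insert i A)
  have "f i + (\<lambda>s. \<Sum>i\<in>A. f i s) \<in> fn.span B"
    using insert by (intro fn.span_add) auto
  then show ?case
    using insert by (simp add: plus_fun_def)
qed (use fn.span_zero[of B] in \<open>simp_all add: zero_fun_def\<close>)

text \<open>\<open>fn.dependent\<close> speaks of sets and does not see repetitions in a family, so
  a family with two equal members is treated apart: the coefficients 1 and -1 give the
  relation.\<close>

lemma fn_dependent_family:
  assumes "finite B" "card B < n" "\<And>e. e < n \<Longrightarrow> F e \<in> fn.span B"
  obtains c where "\<exists>e<n. c e \<noteq> 0" "\<And>x. (\<Sum>e<n. c e * F e x) = 0"
proof (cases "inj_on F {..<n}")
  case True
  have "fn.dependent (F ` {..<n})"
  proof (rule ccontr)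
    assume "\<not> ?thesis"
    then have "card (F ` {..<n}) \<le> card B"
      using assms fn.independent_span_bound[of B "F ` {..<n}"] by auto
    then show False
      using assms(2) True by (simp add: card_image)
  qed
  then obtain c where c: "\<exists>v\<in>F ` {..<n}. c v \<noteq> 0"
    "(\<Sum>v\<in>F ` {..<n}. (\<lambda>x. c v * v x)) = 0"
    by (subst (asm) fn.dependent_finite) auto
  have "(\<Sum>e<n. c (F e) * F e x) = (\<Sum>v\<in>F ` {..<n}. (\<lambda>x. c v * v x)) x" for x
  proof -
    have "(\<Sum>v\<in>A. (\<lambda>x. c v * v x)) x = (\<Sum>v\<in>A. c v * v x)" for A
      by (induction A rule: infinite_finite_induct) auto
    from this[of "F ` {..<n}"] have "(\<Sum>v\<in>F ` {..<n}. (\<lambda>x. c v * v x)) x =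
        (\<Sum>v\<in>F ` {..<n}. c v * v x)" .
    also have "\<dots> = (\<Sum>e<n. c (F e) * F e x)"
      by (rule sum.reindex_cong[OF True]) auto
    finally show ?thesis ..
  qed
  then show thesis
    using c by (intro that[of "\<lambda>e. c (F e)"]) auto
next
  case False
  then obtain i j where ij: "i < n" "j < n" "i \<noteq> j" "F i = F j"
    by (auto simp: inj_on_def)
  define c where "c e = (if e = i then 1 else if e = j then -1 else 0 :: 'b)" for e
  have "(\<Sum>e<n. c e * F e x) = (\<Sum>e\<in>{i, j}. c e * F e x)" for x
    by (rule sum.mono_neutral_right) (use ij in \<open>auto simp: c_def\<close>)
  then show thesis
    using ij by (intro that[of c]) (auto simp: c_def)
qed

text \<open>
  \<open>growth W U d\<close> says that up to a common denominator \<open>u\<close> the polynomial functions of degree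
  at most \<open>N\<close> on \<open>W\<close> span a space of dimension \<open>O(N ^ d)\<close>.  For irreducible \<open>W\<close> multiplication
  by \<open>u\<close> is injective, so \<open>d\<close> bounds the transcendence degree.
\<close>

definition restr :: "'x set \<Rightarrow> ('x \<Rightarrow> 'a::zero) \<Rightarrow> 'x \<Rightarrow> 'a" where
  "restr W f = (\<lambda>s. if s \<in> W then f s else 0)"

definition growth :: "('v \<Rightarrow> 'a::field) set \<Rightarrow> 'v set \<Rightarrow> nat \<Rightarrow> bool" where
  "growth W U d \<longleftrightarrow> (\<exists>C. \<forall>N. \<exists>u\<in>polys UNIV. \<exists>B. (\<exists>s\<in>W. u s \<noteq> 0) \<and> finite B \<and>
     card B \<le> C * (N + 1) ^ d \<and>
     (\<forall>f\<in>poly_le U N. restr W (\<lambda>s. u s * f s) \<in> fn.span B))"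

lemma growth_empty:
  assumes "W \<noteq> {}"
  shows "growth W {} 0"
proof -
  let ?B = "{restr W (\<lambda>s. 1)}"
  have "restr W (\<lambda>s. 1 * f s) \<in> fn.span ?B" if "f \<in> poly_le {} N" for f N
  proof -
    have "f s = f (\<lambda>_. 0)" for s
      by (rule polys_cong[OF poly_le_polys[OF that]]) auto
    then obtain c where f: "\<And>s. f s = c"
      by blast
    have "(\<lambda>s. c * restr W (\<lambda>s. 1) s) \<in> fn.span ?B"
      by (intro fn.span_scale fn.span_base) simp
    moreover have "(\<lambda>s. c * restr W (\<lambda>s. 1) s) = restr W (\<lambda>s. 1 * f s)"
      by (simp add: f restr_def fun_eq_iff)
    ultimately show ?thesis
      by simp
  qed
  moreover have "\<exists>s\<in>W. (1 :: 'b) \<noteq> 0"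
    using assms by auto
  moreover have "finite ?B" "card ?B \<le> 1 * (N + 1) ^ 0" for N :: nat
    by simp_all
  ultimately have "\<exists>B. (\<exists>s\<in>W. (1 :: 'b) \<noteq> 0) \<and> finite B \<and> card B \<le> 1 * (N + 1) ^ 0 \<and>
      (\<forall>f\<in>poly_le {} N. restr W (\<lambda>s. 1 * f s) \<in> fn.span B)" for N
    by blast
  then show ?thesis
    unfolding growth_def
    by - (rule exI[of _ 1], rule allI, rule bexI[of _ "\<lambda>s. 1"], assumption, rule polys_const)
qed

text \<open>After expansion in powers of \<open>v\<close> the products of the old generators with
  \<open>v ^ k\<close>, \<open>k \<le> N\<close>, suffice. The factor \<open>N + 1\<close> in their
  number costs one in the exponent.\<close>

lemma growth_insert_free:
  assumes "growth W U d"
  shows "growth W (insert v U) (Suc d)"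
proof -
  obtain C where C: "\<And>N. \<exists>u\<in>polys UNIV. \<exists>B. (\<exists>s\<in>W. u s \<noteq> 0) \<and> finite B \<and>
     card B \<le> C * (N + 1) ^ d \<and> (\<forall>f\<in>poly_le U N. restr W (\<lambda>s. u s * f s) \<in> fn.span B)"
    using assms unfolding growth_def by blast
  show ?thesis
    unfolding growth_def
  proof (intro exI[of _ C] allI)
    fix N
    obtain u B where u: "u \<in> polys UNIV" "\<exists>s\<in>W. u s \<noteq> 0" and B: "finite B"
      "card B \<le> C * (N + 1) ^ d" "\<And>f. f \<in> poly_le U N \<Longrightarrow> restr W (\<lambda>s. u s * f s) \<in> fn.span B"
      using C[of N] by blast
    define B' where "B' = (\<lambda>(b, k) s. b s * s v ^ k) ` (B \<times> {..N})"
    have "card B' \<le> card (B \<times> {..N})"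
      unfolding B'_def using B(1) by (intro card_image_le) auto
    also have "\<dots> = card B * (N + 1)"
      by (simp add: card_cartesian_product)
    also have "\<dots> \<le> C * (N + 1) ^ d * (N + 1)"
      by (rule mult_right_mono[OF B(2)]) simp
    finally have "card B' \<le> C * (N + 1) ^ Suc d"
      by (simp add: algebra_simps)
    moreover have "restr W (\<lambda>s. u s * f s) \<in> fn.span B'" if "f \<in> poly_le (insert v U) N" for f
    proof -
      obtain c where c: "\<And>k. c k \<in> poly_le U N" "f = (\<lambda>s. \<Sum>k\<le>N. c k s * s v ^ k)"
        using poly_le_insert[OF \<open>f \<in> _\<close>] by blast
      have "(\<lambda>s. restr W (\<lambda>s. u s * c k s) s * s v ^ k) \<in> fn.span B'" if "k \<le> N" for k
        by (rule fn_span_mult[OF B(3)[OF c(1)]]) (use that in \<open>auto simp: B'_def intro!: fn.span_base\<close>)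
      then have "(\<lambda>s. \<Sum>k\<le>N. restr W (\<lambda>s. u s * c k s) s * s v ^ k) \<in> fn.span B'"
        by (intro fn_span_sum) auto
      moreover have "(\<lambda>s. \<Sum>k\<le>N. restr W (\<lambda>s. u s * c k s) s * s v ^ k) = restr W (\<lambda>s. u s * f s)"
        by (auto simp: fun_eq_iff c(2) restr_def sum_distrib_left mult.assoc)
      ultimately show ?thesis
        by simp
    qed
    ultimately show "\<exists>u\<in>polys UNIV. \<exists>B. (\<exists>s\<in>W. u s \<noteq> 0) \<and> finite B \<and>
        card B \<le> C * (N + 1) ^ Suc d \<and>
        (\<forall>f\<in>poly_le (insert v U) N. restr W (\<lambda>s. u s * f s) \<in> fn.span B)"
      using u B(1) by (intro bexI[of _ u] exI[of _ B']) (auto simp: B'_def)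
  qed
qed

text \<open>Each multiplication by \<open>a * v\<close> shifts the coefficients by one and produces
  a single term \<open>a * v ^ e\<close>, which the relation replaces. The degree of the
  coefficients therefore rises by only \<open>D\<close> per step; this linear bound in
  \<open>k\<close> is what later preserves the growth exponent.\<close>

lemma power_reduction:
  assumes a: "a \<in> poly_le U D" "\<And>k. b k \<in> poly_le U D"
    and rel: "\<And>s. s \<in> W \<Longrightarrow> a s * s v ^ e = (\<Sum>k<e. b k s * s v ^ k)"
    and e: "0 < e"
  shows "\<exists>p. (\<forall>j. p j \<in> poly_le U (D * k)) \<and>
    (\<forall>s\<in>W. a s ^ k * s v ^ k = (\<Sum>j<e. p j s * s v ^ j))"
proof (induction k)
  case 0
  show ?case
  proof (intro exI[of _ "\<lambda>j s. if j = 0 then 1 else 0"] conjI ballI allI)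
    fix j :: nat show "(\<lambda>s. if j = 0 then 1 else 0) \<in> poly_le U (D * 0)"
      by (rule poly_le_const)
  qed (use e in \<open>simp add: if_distrib[of "\<lambda>x. x * _"] sum.delta cong: if_cong\<close>)
next
  case (Suc k)
  then obtain p where p: "\<And>j. p j \<in> poly_le U (D * k)"
    "\<And>s. s \<in> W \<Longrightarrow> a s ^ k * s v ^ k = (\<Sum>j<e. p j s * s v ^ j)"
    by blast
  obtain e' where e': "e = Suc e'"
    using e by (cases e) auto
  define q where "q j = (\<lambda>s. (if j = 0 then 0 else a s * p (j - 1) s) + p e' s * b j s)" for j
  have "q j \<in> poly_le U (D * Suc k)" for j
  proof -
    have "(\<lambda>s. if j = 0 then 0 else a s * p (j - 1) s) \<in> poly_le U (D * Suc k)"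
      by (cases "j = 0") (auto intro: poly_le_const poly_le_mult[OF a(1) p(1)])
    moreover have "(\<lambda>s. p e' s * b j s) \<in> poly_le U (D * Suc k)"
      by (rule poly_le_mult[OF p(1) a(2)]) simp
    ultimately show ?thesis
      unfolding q_def by (rule poly_le_add)
  qed
  moreover have "a s ^ Suc k * s v ^ Suc k = (\<Sum>j<e. q j s * s v ^ j)" if "s \<in> W" for s
  proof -
    have "a s ^ Suc k * s v ^ Suc k = a s * s v * (a s ^ k * s v ^ k)"
      by (simp add: algebra_simps)
    also have "\<dots> = (\<Sum>j<Suc e'. a s * p j s * s v ^ Suc j)"
      unfolding p(2)[OF that] sum_distrib_left e' by (intro sum.cong) (auto simp: algebra_simps)
    also have "\<dots> = (\<Sum>j<e'. a s * p j s * s v ^ Suc j) + p e' s * (a s * s v ^ e)"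
      by (simp add: e' algebra_simps)
    also have "(\<Sum>j<e'. a s * p j s * s v ^ Suc j) =
        (\<Sum>j<e. (if j = 0 then 0 else a s * p (j - 1) s) * s v ^ j)"
      unfolding e' by (subst sum.lessThan_Suc_shift) simp
    also have "p e' s * (a s * s v ^ e) = (\<Sum>j<e. p e' s * b j s * s v ^ j)"
      by (simp add: rel[OF that] sum_distrib_left mult.assoc)
    finally show ?thesis
      by (simp add: q_def sum.distrib algebra_simps)
  qed
  ultimately show ?case
    by blast
qed

text \<open>With \<open>a ^ N\<close> put into the denominator, every \<open>v ^ k\<close> with
  \<open>k \<le> N\<close> is reduced to powers below \<open>e\<close>, whose coefficients have
  degree linear in \<open>N\<close>. The number of generators thus changes by a constant factor
  only. Irreducibility keeps the new denominator from vanishing identically.\<close>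

lemma growth_insert_alg:
  assumes growth: "growth W U d" and W: "irr W"
    and a: "a \<in> polys U" "\<exists>s\<in>W. a s \<noteq> 0" and b: "\<And>k. b k \<in> polys U"
    and rel: "\<And>s. s \<in> W \<Longrightarrow> a s * s v ^ e = (\<Sum>k<e. b k s * s v ^ k)"
  shows "growth W (insert v U) d"
proof -
  have e: "0 < e"
    using rel a(2) by (cases e) auto
  \<comment> \<open>The degrees of the \<open>b k\<close> may be unbounded as \<open>k\<close>
    varies; only those with \<open>k < e\<close> enter the relation, so the others are replaced by 0
    to obtain one bound \<open>D\<close>.\<close>
  obtain D b' where D: "a \<in> poly_le U D" "\<And>k. b' k \<in> poly_le U D"
    and b': "\<And>k. k < e \<Longrightarrow> b' k = b k"
  proof -
    obtain D0 where D0: "a \<in> poly_le U D0"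
      using a(1) by (rule polysE)
    have "\<forall>k. \<exists>D. b k \<in> poly_le U D"
      using b by (auto elim: polysE)
    then obtain f where f: "\<And>k. b k \<in> poly_le U (f k)"
      by metis
    define D where "D = D0 + (\<Sum>k<e. f k)"
    show thesis
    proof (rule that[of D "\<lambda>k. if k < e then b k else (\<lambda>s. 0)"])
      show "a \<in> poly_le U D"
        using D0 by (rule poly_le_mono) (auto simp: D_def)
      fix k
      have "b k \<in> poly_le U D" if "k < e"
        using f[of k] by (rule poly_le_mono)
          (use member_le_sum[of k "{..<e}" f] that in \<open>auto simp: D_def\<close>)
      then show "(if k < e then b k else (\<lambda>s. 0)) \<in> poly_le U D"
        by (auto intro: poly_le_const)
    qed auto
  qed
  have rel': "a s * s v ^ e = (\<Sum>k<e. b' k s * s v ^ k)" if "s \<in> W" for s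
    using rel[OF that] b' by simp
  obtain C where C: "\<And>N. \<exists>u\<in>polys UNIV. \<exists>B. (\<exists>s\<in>W. u s \<noteq> 0) \<and> finite B \<and>
     card B \<le> C * (N + 1) ^ d \<and> (\<forall>f\<in>poly_le U N. restr W (\<lambda>s. u s * f s) \<in> fn.span B)"
    using growth unfolding growth_def by blast
  show ?thesis
    unfolding growth_def
  proof (intro exI[of _ "C * (2 * D + 1) ^ d * e"] allI)
    fix N
    \<comment> \<open>The degree is at most \<open>D * N\<close> for the power of \<open>a\<close>,
      \<open>N\<close> for the coefficient of \<open>f\<close>, and \<open>D * N\<close> for the
      reduced power of \<open>v\<close>. Since \<open>M + 1 \<le> (2 * D + 1) * (N + 1)\<close>, the
      growth constant gains the factor \<open>(2 * D + 1) ^ d * e\<close>.\<close>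
    define M where "M = 2 * D * N + N"
    obtain u B where u: "u \<in> polys UNIV" "\<exists>s\<in>W. u s \<noteq> 0" and B: "finite B"
      "card B \<le> C * (M + 1) ^ d" "\<And>f. f \<in> poly_le U M \<Longrightarrow> restr W (\<lambda>s. u s * f s) \<in> fn.span B"
      using C[of M] by blast
    define B' where "B' = (\<lambda>(b, k) s. b s * s v ^ k) ` (B \<times> {..<e})"
    have "card B' \<le> card (B \<times> {..<e})"
      unfolding B'_def using B(1) by (intro card_image_le) auto
    also have "\<dots> \<le> C * (M + 1) ^ d * e"
      using B(2) by (simp add: card_cartesian_product)
    also have "\<dots> \<le> C * ((2 * D + 1) * (N + 1)) ^ d * e"
      by (intro mult_right_mono mult_left_mono power_mono) (auto simp: M_def algebra_simps)
    finally have cardB': "card B' \<le> C * (2 * D + 1) ^ d * e * (N + 1) ^ d"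
      by (simp only: power_mult_distrib mult_ac)
    have "restr W (\<lambda>s. (u s * a s ^ N) * f s) \<in> fn.span B'"
      if "f \<in> poly_le (insert v U) N" for f
    proof -
      obtain c where c: "\<And>k. c k \<in> poly_le U N" "f = (\<lambda>s. \<Sum>k\<le>N. c k s * s v ^ k)"
        using poly_le_insert[OF \<open>f \<in> _\<close>] by blast
      obtain p where p: "\<And>k j. p k j \<in> poly_le U (D * k)"
        "\<And>k s. s \<in> W \<Longrightarrow> a s ^ k * s v ^ k = (\<Sum>j<e. p k j s * s v ^ j)"
        using power_reduction[OF D rel' e] by metis
      define q where "q j = (\<lambda>s. \<Sum>k\<le>N. (a s ^ (N - k) * c k s) * p k j s)" for j
      have qdeg: "q j \<in> poly_le U M" for j
        unfolding q_def
      proof (rule poly_le_sum)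
        fix k assume "k \<in> {..N}"
        have "(\<lambda>s. a s ^ (N - k)) \<in> poly_le U (D * N)"
          by (rule poly_le_power[OF D(1)]) (simp add: mult.commute)
        then have "(\<lambda>s. a s ^ (N - k) * c k s) \<in> poly_le U (D * N + N)"
          by (rule poly_le_mult[OF _ c(1)]) simp
        moreover have "D * N + N + D * k \<le> M"
          using \<open>k \<in> {..N}\<close> by (simp add: M_def)
        ultimately show "(\<lambda>s. a s ^ (N - k) * c k s * p k j s) \<in> poly_le U M"
          by (intro poly_le_mult[OF _ p(1)])
      qed
      have eq: "a s ^ N * f s = (\<Sum>j<e. q j s * s v ^ j)" if "s \<in> W" for s
      proof -
        have "a s ^ N * f s = (\<Sum>k\<le>N. (a s ^ (N - k) * c k s) * (a s ^ k * s v ^ k))"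
          unfolding c(2) sum_distrib_left
        proof (intro sum.cong refl)
          fix k assume "k \<in> {..N}"
          then have "a s ^ N = a s ^ (N - k) * a s ^ k"
            by (simp flip: power_add)
          then show "a s ^ N * (c k s * s v ^ k) = (a s ^ (N - k) * c k s) * (a s ^ k * s v ^ k)"
            by (simp add: mult_ac)
        qed
        also have "\<dots> = (\<Sum>k\<le>N. \<Sum>j<e. (a s ^ (N - k) * c k s) * p k j s * s v ^ j)"
          by (simp add: p(2)[OF that] sum_distrib_left mult_ac)
        also have "\<dots> = (\<Sum>j<e. \<Sum>k\<le>N. (a s ^ (N - k) * c k s) * p k j s * s v ^ j)"
          by (rule sum.swap)
        finally show ?thesis
          by (simp add: q_def sum_distrib_right)
      qed
      have "(\<lambda>s. restr W (\<lambda>s. u s * q j s) s * s v ^ j) \<in> fn.span B'" if "j < e" for j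
        by (rule fn_span_mult[OF B(3)[OF qdeg]]) (use that in \<open>auto simp: B'_def intro!: fn.span_base\<close>)
      then have "(\<lambda>s. \<Sum>j<e. restr W (\<lambda>s. u s * q j s) s * s v ^ j) \<in> fn.span B'"
        by (intro fn_span_sum) auto
      moreover have "(\<lambda>s. \<Sum>j<e. restr W (\<lambda>s. u s * q j s) s * s v ^ j) =
          restr W (\<lambda>s. (u s * a s ^ N) * f s)"
        by (auto simp: fun_eq_iff restr_def mult.assoc eq sum_distrib_left)
      ultimately show ?thesis
        by simp
    qed
    moreover have "(\<lambda>s. u s * a s ^ N) \<in> polys UNIV"
      using u(1) polys_mono[OF a(1)] by (intro polys_intros) auto
    moreover have "\<exists>s\<in>W. u s * a s ^ N \<noteq> 0"
      by (rule irr_mult_nz[OF W u(1) polys_power[OF a(1)] u(2)]) (use a(2) in auto)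
    ultimately show "\<exists>u\<in>polys UNIV. \<exists>B. (\<exists>s\<in>W. u s \<noteq> 0) \<and> finite B \<and>
        card B \<le> C * (2 * D + 1) ^ d * e * (N + 1) ^ d \<and>
        (\<forall>f\<in>poly_le (insert v U) N. restr W (\<lambda>s. u s * f s) \<in> fn.span B)"
      using cardB' B(1)
      by (intro bexI[of _ "\<lambda>s. u s * a s ^ N"] exI[of _ B']) (auto simp: B'_def)
  qed
qed

text \<open>The induction splits off the top digit; the lower digits of \<open>e\<close> are those
  of \<open>e mod M ^ m\<close>.\<close>

lemma sum_base_digits:
  fixes M :: nat
  assumes "e < M ^ m"
  shows "(\<Sum>v<m. (e div M ^ v) mod M * M ^ v) = e"
  using assms
proof (induction m arbitrary: e)
  case (Suc m)
  then have "M > 0"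
    by (cases M) auto
  have "e div M ^ m < M"
    using Suc.prems by (simp add: less_mult_imp_div_less)
  moreover have "(e mod M ^ m div M ^ v) mod M = (e div M ^ v) mod M" if "v < m" for v
  proof -
    have "M ^ m = M ^ v * M ^ (m - v)"
      using that by (simp flip: power_add)
    then have "e mod M ^ m div M ^ v = (e div M ^ v) mod M ^ (m - v)"
      by (simp add: mod_mult2_eq \<open>M > 0\<close>)
    moreover have "M dvd M ^ (m - v)"
      using that by (intro dvd_power) auto
    ultimately show ?thesis
      by (simp add: mod_mod_cancel)
  qed
  moreover have "(\<Sum>v<m. (e mod M ^ m div M ^ v) mod M * M ^ v) = e mod M ^ m"
    using \<open>M > 0\<close> by (intro Suc.IH) simp
  ultimately show ?case
    using div_mult_mod_eq[of e "M ^ m"] by (simp add: add.commute)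
qed auto

definition alg_indep :: "('v \<Rightarrow> 'a::field) set \<Rightarrow> (nat \<Rightarrow> ('v \<Rightarrow> 'a) \<Rightarrow> 'a) \<Rightarrow> nat \<Rightarrow> bool" where
  "alg_indep W g m \<longleftrightarrow>
     (\<forall>P\<in>polys {..<m}. (\<forall>s\<in>W. P (\<lambda>v. g v s) = 0) \<longrightarrow> P = (\<lambda>s. 0))"

text \<open>
  Count the monomials in \<open>g\<close> with all exponents below \<open>M\<close>, encoding an exponent vector by the
  number \<open>e < M ^ m\<close> having it as digits in base \<open>M\<close> (Kronecker substitution).
\<close>

lemma alg_indep_le_growth:
  fixes W :: "('v \<Rightarrow> 'a::alg_closed_field) set"
  assumes growth: "growth W UNIV d" and W: "irr W"
    and g: "\<And>v. g v \<in> polys UNIV" "alg_indep W g m"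
  shows "m \<le> d"
proof (rule ccontr)
  assume "\<not> m \<le> d"
  have "\<forall>v. \<exists>D. g v \<in> poly_le UNIV D"
    using g(1) by (auto elim: polysE)
  then obtain dg where dg: "\<And>v. g v \<in> poly_le UNIV (dg v)"
    by metis
  define D where "D = (\<Sum>v<m. dg v)"
  have D: "g v \<in> poly_le UNIV D" if "v < m" for v
    using dg[of v] by (rule poly_le_mono)
      (use member_le_sum[of v "{..<m}" dg] that in \<open>auto simp: D_def\<close>)
  obtain C where C: "\<And>N. \<exists>u\<in>polys UNIV. \<exists>B. (\<exists>s\<in>W. u s \<noteq> 0) \<and> finite B \<and>
     card B \<le> C * (N + 1) ^ d \<and> (\<forall>f\<in>poly_le UNIV N. restr W (\<lambda>s. u s * f s) \<in> fn.span B)"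
    using growth unfolding growth_def by blast
  \<comment> \<open>\<open>N\<close> bounds the degree of a monomial in the \<open>g v\<close> with
    exponents below \<open>M\<close>, and \<open>N + 1 \<le> (m * D + 1) * M\<close>. Hence
    \<open>B\<close> has at most \<open>C * (m * D + 1) ^ d * M ^ d\<close> elements, and
    \<open>M\<close> is one more than the factor in front of \<open>M ^ d\<close>. As
    \<open>d < m\<close>, there are more monomials than generators.\<close>
  define M where "M = C * (m * D + 1) ^ d + 1"
  define N where "N = m * (M * D)"
  obtain u B where u: "u \<in> polys UNIV" "\<exists>s\<in>W. u s \<noteq> 0" and B: "finite B"
    "card B \<le> C * (N + 1) ^ d" "\<And>f. f \<in> poly_le UNIV N \<Longrightarrow> restr W (\<lambda>s. u s * f s) \<in> fn.span B"
    using C[of N] by blast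
  have "M \<ge> 1"
    by (simp add: M_def)
  have "card B \<le> C * ((m * D + 1) * M) ^ d"
    using B(2) by (rule order_trans, intro mult_left_mono power_mono)
      (use \<open>M \<ge> 1\<close> in \<open>auto simp: N_def algebra_simps\<close>)
  also have "\<dots> = (C * (m * D + 1) ^ d) * M ^ d"
    by (simp only: power_mult_distrib mult.assoc)
  also have "\<dots> < M * M ^ d"
    using \<open>M \<ge> 1\<close> by (intro mult_strict_right_mono) (auto simp: M_def)
  also have "\<dots> = M ^ Suc d"
    by simp
  also have "\<dots> \<le> M ^ m"
    using \<open>M \<ge> 1\<close> \<open>\<not> m \<le> d\<close> by (intro power_increasing) auto
  finally have card: "card B < M ^ m" .
  define mon where "mon e = (\<lambda>s :: nat \<Rightarrow> 'a. \<Prod>v<m. s v ^ ((e div M ^ v) mod M))" for e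
  have "(\<lambda>s. mon e (\<lambda>v. g v s)) \<in> poly_le UNIV N" for e
    unfolding mon_def
  proof (rule poly_le_prod)
    show "(\<lambda>s. g v s ^ ((e div M ^ v) mod M)) \<in> poly_le UNIV (M * D)" if "v \<in> {..<m}" for v
      by (rule poly_le_power[OF D]) (use that \<open>M \<ge> 1\<close> in \<open>auto intro: less_imp_le\<close>)
  qed (simp add: N_def)
  then have span: "restr W (\<lambda>s. u s * mon e (\<lambda>v. g v s)) \<in> fn.span B" for e
    by (rule B(3))
  obtain c where c: "\<exists>e<M ^ m. c e \<noteq> 0"
    "\<And>s. (\<Sum>e<M ^ m. c e * restr W (\<lambda>s. u s * mon e (\<lambda>v. g v s)) s) = 0"
  proof (rule fn_dependent_family[where F = "\<lambda>e. restr W (\<lambda>s. u s * mon e (\<lambda>v. g v s))",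
        OF B(1) card span])
  qed (rule that)
  define P where "P = (\<lambda>s. \<Sum>e<M ^ m. c e * mon e s)"
  have P: "P \<in> polys {..<m}"
    unfolding P_def mon_def by (intro polys_intros) auto
  have Pg: "(\<lambda>s. P (\<lambda>v. g v s)) \<in> polys UNIV"
    by (rule polys_subst[OF P g(1)])
  have "u s * P (\<lambda>v. g v s) = 0" if "s \<in> W" for s
    using c(2)[of s] that by (simp add: restr_def P_def sum_distrib_left mult_ac)
  then have "\<forall>s\<in>W. P (\<lambda>v. g v s) = 0"
    using irrD[OF W u(1) Pg] u(2) by blast
  then have P0: "P = (\<lambda>s. 0)"
    using g(2) P by (auto simp: alg_indep_def)
  \<comment> \<open>At the point with coordinates \<open>t ^ (M ^ v)\<close> the monomial number
    \<open>e\<close> takes the value \<open>t ^ e\<close>, so distinct monomials become distinct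
    powers of \<open>t\<close> and a vanishing \<open>P\<close> has only zero coefficients.\<close>
  have "(\<Sum>e<M ^ m. c e * t ^ e) = 0" for t
  proof -
    have "mon e (\<lambda>v. t ^ (M ^ v)) = t ^ e" if "e < M ^ m" for e
      using sum_base_digits[OF that]
      by (simp add: mon_def mult.commute flip: power_mult power_sum)
    then have "(\<Sum>e<M ^ m. c e * t ^ e) = P (\<lambda>v. t ^ (M ^ v))"
      by (simp add: P_def)
    then show ?thesis
      by (simp add: P0)
  qed
  then show False
    using power_sum_eq_0[where n = "M ^ m" and c = c] c(1) by blast
qed

section \<open>Maximal independent sets of coordinates\<close>

lemma irr_imp_indep_empty:
  assumes "irr W"
  shows "indep_on W {}"
  unfolding indep_on_def
proof (intro ballI impI ext)
  fix w s assume w: "w \<in> polys {}" "\<forall>s\<in>W. w s = 0"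
  obtain s0 where "s0 \<in> W"
    using assms by (auto simp: irr_def)
  moreover have "w s = w s0"
    by (rule polys_cong[OF w(1)]) auto
  ultimately show "w s = 0"
    using w(2) by simp
qed

lemma maximal_indep_on:
  assumes "indep_on W {}" "finite U"
  obtains I where "I \<subseteq> U" "indep_on W I" "\<And>v. v \<in> U - I \<Longrightarrow> \<not> indep_on W (insert v I)"
proof -
  have "finite {I. I \<subseteq> U \<and> indep_on W I}" "{} \<in> {I. I \<subseteq> U \<and> indep_on W I}"
    using assms by auto
  then obtain I where "I \<subseteq> U" "indep_on W I"
    and max: "\<And>I'. I' \<subseteq> U \<Longrightarrow> indep_on W I' \<Longrightarrow> I \<subseteq> I' \<Longrightarrow> I = I'"
    using finite_has_maximal2[of "{I. I \<subseteq> U \<and> indep_on W I}" "{}"] by auto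
  moreover have "\<not> indep_on W (insert v I)" if "v \<in> U - I" for v
    using max[of "insert v I"] that \<open>I \<subseteq> U\<close> by auto
  ultimately show thesis
    using that by blast
qed

text \<open>In a relation expanded in powers of \<open>v\<close>, the highest coefficient that is
  not the zero function is a non-zero polynomial in \<open>K\<close>. Independence of
  \<open>K\<close> keeps it from vanishing on all of \<open>W\<close>, so it can serve as leading
  coefficient of an equation for \<open>v\<close> on \<open>W\<close>.\<close>

lemma indep_on_insert_relation:
  assumes "indep_on W K" "\<not> indep_on W (insert v K)"
  obtains a b e where "a \<in> polys K" "\<exists>s\<in>W. a s \<noteq> 0" "\<And>k. b k \<in> polys K"
    "\<And>s. s \<in> W \<Longrightarrow> a s * s v ^ e = (\<Sum>k<e. b k s * s v ^ k)"
proof -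
  obtain w where w: "w \<in> polys (insert v K)" "\<And>s. s \<in> W \<Longrightarrow> w s = 0" "w \<noteq> (\<lambda>s. 0)"
    using assms(2) unfolding indep_on_def by blast
  obtain N c where c: "\<And>k. c k \<in> polys K" and wc: "w = (\<lambda>s. \<Sum>k<N. c k s * s v ^ k)"
    using polys_insert[OF w(1)] by metis
  define A where "A = {k. k < N \<and> c k \<noteq> (\<lambda>s. 0)}"
  define e where "e = Max A"
  have "finite A"
    by (simp add: A_def)
  moreover have "A \<noteq> {}"
    using w(3) by (auto simp: A_def wc)
  ultimately have "e \<in> A" and max: "\<And>k. k \<in> A \<Longrightarrow> k \<le> e"
    unfolding e_def by auto
  then have e: "e < N" "c e \<noteq> (\<lambda>s. 0)" and above: "\<And>k. e < k \<Longrightarrow> k < N \<Longrightarrow> c k = (\<lambda>s. 0)"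
    using max by (fastforce simp: A_def)+
  have w_eq: "w s = (\<Sum>k<e. c k s * s v ^ k) + c e s * s v ^ e" for s
  proof -
    have "w s = (\<Sum>k<Suc e. c k s * s v ^ k)"
      unfolding wc using e(1) above by (intro sum.mono_neutral_right) (auto simp: not_less)
    then show ?thesis by simp
  qed
  show thesis
  proof (rule that[of "c e" "\<lambda>k s. - c k s" e])
    show "c e s * s v ^ e = (\<Sum>k<e. - c k s * s v ^ k)" if "s \<in> W" for s
      using w(2)[OF that] unfolding w_eq by (simp add: sum_negf eq_neg_iff_add_eq_0 add.commute)
    show "\<exists>s\<in>W. c e s \<noteq> 0"
      using assms(1) c e(2) unfolding indep_on_def by blast
  qed (use c polys_uminus in auto)
qed

lemma growth_union_free:
  assumes "growth W U d" "finite F"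
  shows "growth W (U \<union> F) (d + card F)"
  using assms(2)
proof induction
  case (insert v F)
  then show ?case
    using growth_insert_free[of W "U \<union> F" "d + card F" v] by simp
qed (use assms in simp)

lemma growth_union_alg:
  assumes "irr W" "growth W U d" "finite F"
    and "\<And>v. v \<in> F \<Longrightarrow> \<exists>a b e. a \<in> polys U \<and> (\<exists>s\<in>W. a s \<noteq> 0) \<and> (\<forall>k. b k \<in> polys U) \<and>
      (\<forall>s\<in>W. a s * s v ^ e = (\<Sum>k<e. b k s * s v ^ k))"
  shows "growth W (U \<union> F) d"
  using assms(3,4)
proof induction
  case (insert v F)
  obtain a b e where ab: "a \<in> polys U" "\<exists>s\<in>W. a s \<noteq> 0" "\<And>k. b k \<in> polys U"
    "\<And>s. s \<in> W \<Longrightarrow> a s * s v ^ e = (\<Sum>k<e. b k s * s v ^ k)"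
    using insert.prems[of v] by blast
  have "growth W (insert v (U \<union> F)) d"
  proof (rule growth_insert_alg[where a = a and b = b and e = e])
    show "growth W (U \<union> F) d"
      using insert by simp
    show "a \<in> polys (U \<union> F)" "b k \<in> polys (U \<union> F)" for k
      using polys_mono[OF ab(1), of "U \<union> F"] polys_mono[OF ab(3), of "U \<union> F"] by simp_all
  qed (use assms(1) ab in auto)
  then show ?case
    by simp
qed (use assms in simp)

text \<open>The coordinates in \<open>I\<close> contribute one to the exponent each; by maximality
  every other coordinate in \<open>U\<close> satisfies an equation over them and contributes
  nothing.\<close>

lemma growth_maximal_indep:
  assumes "irr W" "finite U" "I \<subseteq> U" "indep_on W I"
    "\<And>v. v \<in> U - I \<Longrightarrow> \<not> indep_on W (insert v I)"
  shows "growth W U (card I)"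
proof -
  have I: "growth W I (card I)"
    using growth_union_free[of W "{}" 0 I] growth_empty[of W] assms finite_subset[of I U]
    by (auto simp: irr_def)
  have "growth W (I \<union> (U - I)) (card I)"
  proof (rule growth_union_alg[OF assms(1) I])
    fix v assume "v \<in> U - I"
    show "\<exists>a b e. a \<in> polys I \<and> (\<exists>s\<in>W. a s \<noteq> 0) \<and> (\<forall>k. b k \<in> polys I) \<and>
      (\<forall>s\<in>W. a s * s v ^ e = (\<Sum>k<e. b k s * s v ^ k))"
      by (rule indep_on_insert_relation[OF assms(4) assms(5)[OF \<open>v \<in> U - I\<close>]]) blast
  qed (use assms(2) in auto)
  then show ?thesis
    using assms(3) by (simp add: Un_absorb1)
qed

text \<open>Consecutive members are separated by a polynomial rather than by mere inequality: as the
  members need not be closed, this is what makes their closures strictly increasing.\<close>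

definition irr_chain :: "(nat \<Rightarrow> ('v \<Rightarrow> 'a::field) set) \<Rightarrow> nat \<Rightarrow> bool" where
  "irr_chain Z n \<longleftrightarrow> (\<forall>i\<le>n. irr (Z i)) \<and> (\<forall>i<n. Z i \<subseteq> Z (Suc i) \<and>
     (\<exists>g\<in>polys UNIV. (\<forall>s\<in>Z i. g s = 0) \<and> (\<exists>s\<in>Z (Suc i). g s \<noteq> 0)))"

text \<open>A relation is expanded in powers of the last function \<open>g m\<close>. On
  \<open>Z\<close> this function is zero, so the constant coefficient vanishes there and is zero by
  independence. On the irreducible \<open>Z'\<close> the factor \<open>g m\<close> can then be
  cancelled, and the shorter relation is treated in the same way.\<close>

lemma alg_indep_Suc:
  fixes Z Z' :: "('v \<Rightarrow> 'a::field) set"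
  assumes Z: "irr Z'" "Z \<subseteq> Z'" and g: "\<And>v. g v \<in> polys UNIV" "alg_indep Z g m"
    and gm: "\<And>s. s \<in> Z \<Longrightarrow> g m s = 0" "\<exists>s\<in>Z'. g m s \<noteq> 0"
  shows "alg_indep Z' g (Suc m)"
proof -
  have coeffs: "\<forall>k<N. c k = (\<lambda>s. 0)"
    if "\<And>k. c k \<in> polys {..<m}" "\<And>s. s \<in> Z' \<Longrightarrow> (\<Sum>k<N. c k (\<lambda>v. g v s) * g m s ^ k) = 0"
    for N and c :: "nat \<Rightarrow> (nat \<Rightarrow> 'a) \<Rightarrow> 'a"
    using that
  proof (induction N arbitrary: c)
    case (Suc N)
    define r where "r = (\<lambda>s. \<Sum>k<N. c (Suc k) (\<lambda>v. g v s) * g m s ^ k)"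
    have r: "(\<Sum>k<Suc N. c k (\<lambda>v. g v s) * g m s ^ k) = c 0 (\<lambda>v. g v s) + g m s * r s" for s
      unfolding r_def sum.lessThan_Suc_shift by (simp add: sum_distrib_left mult_ac)
    have "c 0 (\<lambda>v. g v s) = 0" if "s \<in> Z" for s
      using Suc.prems(2)[of s] r[of s] gm(1)[OF that] Z(2) that by auto
    then have c0: "c 0 = (\<lambda>s. 0)"
      using g(2) Suc.prems(1) by (simp add: alg_indep_def)
    then have "g m s * r s = 0" if "s \<in> Z'" for s
      using Suc.prems(2)[OF that] r[of s] by simp
    moreover have "r \<in> polys UNIV"
      unfolding r_def
      by (intro polys_sum polys_mult polys_power polys_subst[OF Suc.prems(1) g(1)] g(1))
    ultimately have "\<forall>s\<in>Z'. r s = 0"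
      using irrD[OF Z(1) g(1)] gm(2) by blast
    then have "\<forall>k<N. c (Suc k) = (\<lambda>s. 0)"
      using Suc.prems(1) by (intro Suc.IH[of "\<lambda>k. c (Suc k)"]) (auto simp: r_def)
    then show ?case
      using c0 by (simp add: All_less_Suc2)
  qed auto
  show ?thesis
    unfolding alg_indep_def
  proof (intro ballI impI)
    fix P :: "(nat \<Rightarrow> 'a) \<Rightarrow> 'a"
    assume P: "P \<in> polys {..<Suc m}" "\<forall>s\<in>Z'. P (\<lambda>v. g v s) = 0"
    then obtain N c where c: "\<And>k. c k \<in> polys {..<m}" "P = (\<lambda>s. \<Sum>k<N. c k s * s m ^ k)"
      using polys_insert[of P m "{..<m}"] by (metis lessThan_Suc)
    have "\<forall>k<N. c k = (\<lambda>s. 0)"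
      by (rule coeffs[OF c(1)]) (use P(2) c(2) in auto)
    then show "P = (\<lambda>s. 0)"
      by (simp add: c(2))
  qed
qed

text \<open>The functions are the separating polynomials: \<open>g i\<close> vanishes on
  \<open>Z i\<close> but not on \<open>Z (Suc i)\<close>, so each step of the chain adds one
  independent function.\<close>

lemma irr_chain_alg_indep:
  assumes "irr_chain Z n"
  obtains g where "\<And>v. g v \<in> polys UNIV" "alg_indep (Z n) g n"
proof -
  have "\<forall>i. \<exists>g\<in>polys UNIV. i < n \<longrightarrow> (\<forall>s\<in>Z i. g s = 0) \<and> (\<exists>s\<in>Z (Suc i). g s \<noteq> 0)"
    using assms polys_const unfolding irr_chain_def by blast
  then obtain g where g: "\<And>i. g i \<in> polys UNIV" "\<And>i s. i < n \<Longrightarrow> s \<in> Z i \<Longrightarrow> g i s = 0"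
    "\<And>i. i < n \<Longrightarrow> \<exists>s\<in>Z (Suc i). g i s \<noteq> 0"
    by metis
  have "alg_indep (Z m) g m" if "m \<le> n" for m
    using that
  proof (induction m)
    case 0
    have "Z 0 \<noteq> {}"
      using assms unfolding irr_chain_def irr_def by blast
    then obtain s0 where "s0 \<in> Z 0"
      by blast
    moreover have "P s = P s'" if "P \<in> polys {..<0}" for P :: "(nat \<Rightarrow> 'b) \<Rightarrow> 'b" and s s'
      by (rule polys_cong[OF that]) auto
    ultimately show ?case
      unfolding alg_indep_def by (metis ext)
  next
    case (Suc m)
    then show ?case
      using assms g by (intro alg_indep_Suc[where Z = "Z m"]) (auto simp: irr_chain_def)
  qed
  then show thesis
    using that g(1) by blast
qed

lemma irr_chain_le_growth:
  fixes Z :: "nat \<Rightarrow> ('v \<Rightarrow> 'a::alg_closed_field) set"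
  assumes "irr_chain Z n" "growth (Z n) UNIV d"
  shows "n \<le> d"
proof -
  have "irr (Z n)"
    using assms(1) by (simp add: irr_chain_def)
  moreover obtain g where "\<And>v. g v \<in> polys UNIV" "alg_indep (Z n) g n"
    by (rule irr_chain_alg_indep[OF assms(1)]) blast
  ultimately show ?thesis
    using alg_indep_le_growth assms(2) by blast
qed

text \<open>The chain only supplies independent polynomials. A maximal independent set of
  coordinates fixes the growth exponent of the top member, and this exponent bounds the number of
  independent polynomials.\<close>

lemma irr_chain_indep_on:
  fixes Z :: "nat \<Rightarrow> ('v::finite \<Rightarrow> 'a::alg_closed_field) set"
  assumes "irr_chain Z n"
  obtains I where "indep_on (Z n) I" "n \<le> card I"
proof -
  have irr: "irr (Z n)"
    using assms by (simp add: irr_chain_def)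
  obtain I where I: "indep_on (Z n) I" "\<And>v. v \<in> UNIV - I \<Longrightarrow> \<not> indep_on (Z n) (insert v I)"
    by (rule maximal_indep_on[OF irr_imp_indep_empty[OF irr], of UNIV]) auto
  have "growth (Z n) UNIV (card I)"
    by (rule growth_maximal_indep[OF irr _ _ I]) auto
  then show thesis
    using that I(1) irr_chain_le_growth[OF assms] by blast
qed

section \<open>Dense parts of irreducible sets\<close>

definition dense_in :: "('v \<Rightarrow> 'a::field) set \<Rightarrow> ('v \<Rightarrow> 'a) set \<Rightarrow> bool" where
  "dense_in Y Z \<longleftrightarrow> Y \<subseteq> Z \<and> (\<forall>f\<in>polys UNIV. (\<forall>s\<in>Y. f s = 0) \<longrightarrow> (\<forall>s\<in>Z. f s = 0))"

lemma dense_inD: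
  assumes "dense_in Y Z" "f \<in> polys UNIV" "\<And>s. s \<in> Y \<Longrightarrow> f s = 0" "s \<in> Z"
  shows "f s = 0"
  using assms unfolding dense_in_def by blast

text \<open>If no part were dense, each would be killed by a polynomial that does not vanish on
  \<open>Z\<close>; the product of these finitely many polynomials would vanish on \<open>Z\<close>,
  against irreducibility.\<close>

lemma irr_dense_part:
  assumes Z: "irr Z" "Z = (\<Union>i\<in>A. Y i)" "finite A"
  obtains i where "i \<in> A" "dense_in (Y i) Z"
proof (rule ccontr)
  assume "\<not> thesis"
  then have "\<not> dense_in (Y i) Z" if "i \<in> A" for i
    using \<open>\<And>i. i \<in> A \<Longrightarrow> dense_in (Y i) Z \<Longrightarrow> thesis\<close> that by blast
  moreover have "Y i \<subseteq> Z" if "i \<in> A" for i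
    using Z(2) that by auto
  ultimately have "\<forall>i\<in>A. \<exists>f\<in>polys UNIV. (\<forall>s\<in>Y i. f s = 0) \<and> (\<exists>s\<in>Z. f s \<noteq> 0)"
    unfolding dense_in_def by simp
  then obtain f where f: "\<And>i. i \<in> A \<Longrightarrow> f i \<in> polys UNIV"
    "\<And>i s. i \<in> A \<Longrightarrow> s \<in> Y i \<Longrightarrow> f i s = 0" "\<And>i. i \<in> A \<Longrightarrow> \<exists>s\<in>Z. f i s \<noteq> 0"
    by metis
  have "\<exists>s\<in>Z. (\<Prod>i\<in>B. f i s) \<noteq> 0" if "B \<subseteq> A" "finite B" for B
    using that(2,1)
  proof induction
    case empty
    then show ?case
      using Z(1) by (auto simp: irr_def)
  next
    case (insert i B)
    have "\<exists>s\<in>Z. f i s * (\<Prod>i\<in>B. f i s) \<noteq> 0"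
      by (rule irr_mult_nz[OF Z(1) f(1) polys_prod[of B f UNIV]]) (use insert f in auto)
    then show ?case
      using insert by simp
  qed
  then obtain s where "s \<in> Z" "(\<Prod>i\<in>A. f i s) \<noteq> 0"
    using Z(3) by blast
  then show False
    using f(2) Z(2,3) by auto
qed

lemma irr_dense_in:
  assumes "irr Z" "dense_in Y Z"
  shows "irr Y"
  unfolding irr_def
proof (intro conjI ballI impI)
  show "Y \<noteq> {}"
  proof
    assume "Y = {}"
    then have "(1 :: 'b) = 0" if "s \<in> Z" for s
      using dense_inD[OF assms(2) polys_const[of 1 UNIV] _ that] by simp
    then show False
      using assms(1) by (auto simp: irr_def)
  qed
  fix f g assume fg: "f \<in> polys UNIV" "g \<in> polys UNIV" "\<forall>s\<in>Y. f s * g s = 0"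
  have "f s * g s = 0" if "s \<in> Z" for s
    using dense_inD[OF assms(2) polys_mult[OF fg(1,2)] _ that] fg(3) by blast
  then have "(\<forall>s\<in>Z. f s = 0) \<or> (\<forall>s\<in>Z. g s = 0)"
    by (rule irrD[OF assms(1) fg(1,2)])
  then show "(\<forall>s\<in>Y. f s = 0) \<or> (\<forall>s\<in>Y. g s = 0)"
    using assms(2) by (auto simp: dense_in_def)
qed

text \<open>Passing to a dense part of the top member may destroy the chain below it, since the
  lower members need not meet that part. The independent functions extracted from the chain do
  survive, and they are all that the upper bound uses.\<close>

lemma alg_indep_dense_in:
  assumes "alg_indep Z g n" "\<And>v. g v \<in> polys UNIV" "dense_in Y Z"
  shows "alg_indep Y g n"
  unfolding alg_indep_def
proof (intro ballI impI)
  fix P assume P: "P \<in> polys {..<n}" "\<forall>s\<in>Y. P (\<lambda>v. g v s) = 0"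
  have "P (\<lambda>v. g v s) = 0" if "s \<in> Z" for s
    by (rule dense_inD[OF assms(3) polys_subst[OF P(1), where \<sigma> = g] _ that])
      (use P(2) assms(2) in auto)
  then show "P = (\<lambda>s. 0)"
    using assms(1) P(1) by (simp add: alg_indep_def)
qed

section \<open>Lifting points along prime ideals\<close>

text \<open>The variable set \<open>U\<close> is a parameter because ideals are contracted to fewer
  variables during elimination.\<close>

locale prime_ideal =
  fixes U :: "'v set" and J :: "(('v \<Rightarrow> 'a::alg_closed_field) \<Rightarrow> 'a) set"
  assumes sub: "J \<subseteq> polys U"
    and zero: "(\<lambda>s. 0) \<in> J"
    and add: "f \<in> J \<Longrightarrow> g \<in> J \<Longrightarrow> (\<lambda>s. f s + g s) \<in> J"
    and mult: "f \<in> J \<Longrightarrow> g \<in> polys U \<Longrightarrow> (\<lambda>s. g s * f s) \<in> J"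
    and one: "(\<lambda>s. 1) \<notin> J"
    and prime: "f \<in> polys U \<Longrightarrow> g \<in> polys U \<Longrightarrow> (\<lambda>s. f s * g s) \<in> J \<Longrightarrow> f \<in> J \<or> g \<in> J"
begin

lemma diff: "f \<in> J \<Longrightarrow> g \<in> J \<Longrightarrow> (\<lambda>s. f s - g s) \<in> J"
  using add[OF _ mult[OF _ polys_const[of "-1"]], of f g] by simp

lemma cancel_left: "(\<lambda>s. f s + g s) \<in> J \<Longrightarrow> g \<in> J \<Longrightarrow> f \<in> J"
  using diff[of "\<lambda>s. f s + g s" g] by simp

lemma power: "f \<in> polys U \<Longrightarrow> f \<notin> J \<Longrightarrow> (\<lambda>s. f s ^ n) \<notin> J"
proof (induction n)
  case (Suc n)
  then show ?case
    using prime[of f "\<lambda>s. f s ^ n"] by (auto intro: polys_power)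
qed (use one in simp)

lemma contract:
  assumes "U' \<subseteq> U"
  shows "prime_ideal U' (J \<inter> polys U')"
proof
  show "(\<lambda>s. f s + g s) \<in> J \<inter> polys U'" if "f \<in> J \<inter> polys U'" "g \<in> J \<inter> polys U'" for f g
    using that by (auto intro: add polys_add)
  show "(\<lambda>s. g s * f s) \<in> J \<inter> polys U'" if "f \<in> J \<inter> polys U'" "g \<in> polys U'" for f g
    using that polys_mono[OF that(2) assms] by (auto intro: mult polys_mult)
  show "f \<in> J \<inter> polys U' \<or> g \<in> J \<inter> polys U'"
    if "f \<in> polys U'" "g \<in> polys U'" "(\<lambda>s. f s * g s) \<in> J \<inter> polys U'" for f g
    using that prime polys_mono[OF _ assms] by blast
qed (use zero one polys_const[of 0 U'] in auto)

end

section \<open>Degree in one variable and pseudo-division\<close>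

primrec below :: "(('v \<Rightarrow> 'a::field) \<Rightarrow> 'a) set \<Rightarrow> 'v \<Rightarrow> nat \<Rightarrow> (('v \<Rightarrow> 'a) \<Rightarrow> 'a) set" where
  "below A v 0 = {\<lambda>s. 0}"
| "below A v (Suc n) = {\<lambda>s. g s + a s * s v ^ n | g a. g \<in> below A v n \<and> a \<in> A}"

lemma below_SucI: "g \<in> below A v n \<Longrightarrow> a \<in> A \<Longrightarrow> (\<lambda>s. g s + a s * s v ^ n) \<in> below A v (Suc n)"
  by auto

lemma below_SucE:
  assumes "f \<in> below A v (Suc n)"
  obtains g a where "g \<in> below A v n" "a \<in> A" "f = (\<lambda>s. g s + a s * s v ^ n)"
  using assms by auto

lemma below_Suc_mono: "f \<in> below (polys U) v n \<Longrightarrow> f \<in> below (polys U) v (Suc n)"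
  using below_SucI[OF _ polys_const[of 0], of f U v n] by simp

lemma below_mono: "f \<in> below (polys U) v n \<Longrightarrow> n \<le> m \<Longrightarrow> f \<in> below (polys U) v m"
  by (rotate_tac, induction m rule: dec_induct) (auto intro: below_Suc_mono simp del: below.simps)

lemma below_zero: "(\<lambda>s. 0) \<in> below (polys U) v n"
  using below_mono[of "\<lambda>s. 0" U v 0 n] by simp

lemma below_add:
  "f \<in> below (polys U) v n \<Longrightarrow> g \<in> below (polys U) v n \<Longrightarrow> (\<lambda>s. f s + g s) \<in> below (polys U) v n"
proof (induction n arbitrary: f g)
  case (Suc n)
  obtain f' a where f: "f' \<in> below (polys U) v n" "a \<in> polys U" "f = (\<lambda>s. f' s + a s * s v ^ n)"
    using Suc.prems(1) by (rule below_SucE)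
  obtain g' b where g: "g' \<in> below (polys U) v n" "b \<in> polys U" "g = (\<lambda>s. g' s + b s * s v ^ n)"
    using Suc.prems(2) by (rule below_SucE)
  have "(\<lambda>s. (f' s + g' s) + (a s + b s) * s v ^ n) \<in> below (polys U) v (Suc n)"
    by (intro below_SucI Suc.IH polys_add f g)
  then show ?case
    by (simp add: f g algebra_simps del: below.simps)
qed simp

lemma below_mult:
  "f \<in> below (polys U) v n \<Longrightarrow> a \<in> polys U \<Longrightarrow> (\<lambda>s. a s * s v ^ j * f s) \<in> below (polys U) v (n + j)"
proof (induction n arbitrary: f)
  case 0
  then show ?case
    using below_zero by simp
next
  case (Suc n)
  obtain f' b where f: "f' \<in> below (polys U) v n" "b \<in> polys U" "f = (\<lambda>s. f' s + b s * s v ^ n)"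
    using Suc.prems(1) by (rule below_SucE)
  have "(\<lambda>s. a s * s v ^ j * f' s + (a s * b s) * s v ^ (n + j)) \<in> below (polys U) v (Suc (n + j))"
    by (intro below_SucI Suc.IH polys_mult f Suc.prems)
  then show ?case
    by (simp add: f algebra_simps power_add del: below.simps)
qed

lemma below_smult: "f \<in> below (polys U) v n \<Longrightarrow> a \<in> polys U \<Longrightarrow> (\<lambda>s. a s * f s) \<in> below (polys U) v n"
  using below_mult[of f U v n a 0] by simp

lemma below_diff:
  "f \<in> below (polys U) v n \<Longrightarrow> g \<in> below (polys U) v n \<Longrightarrow> (\<lambda>s. f s - g s) \<in> below (polys U) v n"
  using below_add[OF _ below_smult[OF _ polys_const[of "-1"]], of f U v n g] by simp

lemma below_polys: "f \<in> below (polys U) v n \<Longrightarrow> f \<in> polys (insert v U)"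
proof (induction n arbitrary: f)
  case (Suc n)
  obtain f' a where f: "f' \<in> below (polys U) v n" "a \<in> polys U" "f = (\<lambda>s. f' s + a s * s v ^ n)"
    using Suc.prems by (rule below_SucE)
  have "a \<in> polys (insert v U)"
    using f(2) by (rule polys_mono) auto
  then show ?case
    unfolding f(3) by (intro polys_add polys_mult polys_power polys_var Suc.IH[OF f(1)]) auto
qed (auto intro: polys_const)

lemma polys_insert_below:
  assumes "f \<in> polys (insert v U)"
  obtains n where "f \<in> below (polys U) v n"
proof -
  obtain N c where c: "\<And>k. c k \<in> polys U" "f = (\<lambda>s. \<Sum>k<N. c k s * s v ^ k)"
    using polys_insert[OF assms] by metis
  have "(\<lambda>s. \<Sum>k<n. c k s * s v ^ k) \<in> below (polys U) v n" for n
  proof (induction n)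
    case (Suc n)
    then show ?case
      using below_SucI[OF Suc.IH c(1)] by simp
  qed simp
  then show thesis
    using that[of N] c(2) by simp
qed

lemma below_vanish:
  assumes "f \<in> below A v n" "\<And>a. a \<in> A \<Longrightarrow> a s = 0"
  shows "f s = 0"
  using assms(1)
proof (induction n arbitrary: f)
  case (Suc n)
  show ?case
    by (rule below_SucE[OF Suc.prems]) (simp add: Suc.IH assms(2))
qed simp

lemma below_on_fibre:
  assumes "v \<notin> U" "f \<in> below (polys U) v n"
  shows "\<exists>p. (\<forall>t. f (s(v := t)) = poly p t) \<and> (\<forall>k\<ge>n. coeff p k = 0)"
  using assms(2)
proof (induction n arbitrary: f)
  case (Suc n)
  obtain f' a where f: "f' \<in> below (polys U) v n" "a \<in> polys U" "f = (\<lambda>s. f' s + a s * s v ^ n)"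
    using Suc.prems by (rule below_SucE)
  obtain p where p: "\<And>t. f' (s(v := t)) = poly p t" "\<And>k. n \<le> k \<Longrightarrow> coeff p k = 0"
    using Suc.IH[OF f(1)] by blast
  have a: "a (s(v := t)) = a s" for t
    by (rule polys_cong[OF f(2)]) (use assms(1) in auto)
  have "f (s(v := t)) = poly (p + monom (a s) n) t" for t
    unfolding f(3) p(1) a by (simp add: poly_monom)
  moreover have "coeff (p + monom (a s) n) k = 0" if "Suc n \<le> k" for k
    using that p(2)[of k] by simp
  ultimately show ?case
    by blast
qed (auto intro: exI[of _ 0])

text \<open>Where the leading coefficient does not vanish, the restriction to the line in direction
  \<open>v\<close> keeps its degree. It then has a point where it is non-zero and, for positive
  \<open>n\<close>, also a root; both are used for lifting points.\<close>

lemma below_on_fibre_lead: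
  assumes "v \<notin> U" "f \<in> below (polys U) v n" "a \<in> polys U" "a s \<noteq> 0"
  shows "\<exists>p. (\<forall>t. f (s(v := t)) + a (s(v := t)) * t ^ n = poly p t) \<and> p \<noteq> 0 \<and> n \<le> degree p"
proof -
  obtain p where p: "\<And>t. f (s(v := t)) = poly p t" "\<And>k. n \<le> k \<Longrightarrow> coeff p k = 0"
    using below_on_fibre[OF assms(1,2)] by blast
  define q where "q = p + monom (a s) n"
  have "coeff q n \<noteq> 0"
    using assms(4) by (simp add: q_def p(2))
  then have "q \<noteq> 0" "n \<le> degree q"
    by (auto intro: le_degree)
  moreover have a: "a (s(v := t)) = a s" for t
    by (rule polys_cong[OF assms(3)]) (use assms(1) in auto)
  have "f (s(v := t)) + a (s(v := t)) * t ^ n = poly q t" for t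
    unfolding p(1) a by (simp add: q_def poly_monom)
  ultimately show ?thesis
    by blast
qed

lemma cancel_lead:
  assumes r: "r \<in> below (polys U) v m" "b \<in> polys U"
    and g: "g \<in> below (polys U) v n" "a \<in> polys U" "m \<le> n"
  shows "(\<lambda>s. b s * (g s + a s * s v ^ n) - (r s + b s * s v ^ m) * (a s * s v ^ (n - m)))
    \<in> below (polys U) v n"
proof -
  have "(\<lambda>s. a s * s v ^ (n - m) * r s) \<in> below (polys U) v n"
    using below_mult[OF r(1) g(2), of "n - m"] g(3) by simp
  then have "(\<lambda>s. b s * g s - a s * s v ^ (n - m) * r s) \<in> below (polys U) v n"
    by (rule below_diff[OF below_smult[OF g(1) r(2)]])
  moreover have "s v ^ n = s v ^ m * s v ^ (n - m)" for s :: "'a \<Rightarrow> 'b"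
    using g(3) by (simp flip: power_add)
  ultimately show ?thesis
    by (simp add: algebra_simps)
qed

text \<open>The leading coefficient \<open>b\<close> of the divisor need not be invertible, so the
  dividend is multiplied by a power of it, one factor for each cancelled leading term.
  \<open>below\<close> bounds degrees strictly: for \<open>n \<le> m\<close> the truncated
  difference forces the quotient to be 0.\<close>

lemma pseudo_division:
  assumes r: "r \<in> below (polys U) v m" "b \<in> polys U" and g: "g \<in> below (polys U) v n"
  shows "\<exists>N. \<exists>Q\<in>below (polys U) v (n - m).
    (\<lambda>s. b s ^ N * g s - (r s + b s * s v ^ m) * Q s) \<in> below (polys U) v m"
  using g
proof (induction n arbitrary: g)
  case 0
  then show ?case
    using below_zero[of U v m] by simp
next
  case (Suc n)
  show ?case
  proof (cases "m \<le> n")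
    case False
    then show ?thesis
      using Suc.prems below_mono[of g U v "Suc n" m]
      by (intro exI[of _ 0] bexI[of _ "\<lambda>s. 0"]) (auto simp del: below.simps intro: below_zero)
  next
    case True
    obtain g' a where g: "g' \<in> below (polys U) v n" "a \<in> polys U" "g = (\<lambda>s. g' s + a s * s v ^ n)"
      using Suc.prems by (rule below_SucE)
    obtain N Q where Q: "Q \<in> below (polys U) v (n - m)"
      "(\<lambda>s. b s ^ N * (b s * g s - (r s + b s * s v ^ m) * (a s * s v ^ (n - m)))
         - (r s + b s * s v ^ m) * Q s) \<in> below (polys U) v m"
      using Suc.IH[OF cancel_lead[OF r g(1,2) True]] unfolding g(3) by blast
    have "(\<lambda>s. Q s + (b s ^ N * a s) * s v ^ (n - m)) \<in> below (polys U) v (Suc (n - m))"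
      by (intro below_SucI Q polys_mult polys_power r g)
    moreover have "(\<lambda>s. b s ^ Suc N * g s -
        (r s + b s * s v ^ m) * (Q s + (b s ^ N * a s) * s v ^ (n - m))) \<in> below (polys U) v m"
      using Q(2) by (simp add: algebra_simps)
    ultimately show ?thesis
      unfolding Suc_diff_le[OF True] by (intro exI[of _ "Suc N"]) (rule bexI)
  qed
qed

text \<open>Here the leading term of the quotient is kept explicit, because the minimality argument
  for prime ideals has to know that its coefficient is outside the ideal.\<close>

lemma pseudo_division_lead:
  assumes r: "r \<in> below (polys U) v m" "b \<in> polys U"
    and g: "g \<in> below (polys U) v n" "a \<in> polys U" "m \<le> n"
  shows "\<exists>N. \<exists>Q\<in>below (polys U) v (n - m).
    (\<lambda>s. b s ^ Suc N * (g s + a s * s v ^ n) -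
      (r s + b s * s v ^ m) * (Q s + (b s ^ N * a s) * s v ^ (n - m))) \<in> below (polys U) v m"
proof -
  obtain N Q where Q: "Q \<in> below (polys U) v (n - m)"
    "(\<lambda>s. b s ^ N * (b s * (g s + a s * s v ^ n) - (r s + b s * s v ^ m) * (a s * s v ^ (n - m)))
       - (r s + b s * s v ^ m) * Q s) \<in> below (polys U) v m"
    using pseudo_division[OF r cancel_lead[OF r g]] by blast
  then show ?thesis
    by (intro exI[of _ N] bexI[of _ Q]) (simp_all add: algebra_simps)
qed

text \<open>By \<open>low\<close> the leading coefficient of an element of \<open>J\<close> is
  itself in \<open>J\<close>; subtracting the leading term leaves an element of \<open>J\<close> of
  smaller degree, and so all coefficients lie in \<open>J\<close>.\<close>

lemma below_in_ideal:
  assumes J: "prime_ideal (insert v U) J"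
    and low: "\<And>k a g. k < e \<Longrightarrow> a \<in> polys U \<Longrightarrow> g \<in> below (polys U) v k \<Longrightarrow>
      (\<lambda>s. g s + a s * s v ^ k) \<in> J \<Longrightarrow> a \<in> J"
    and f: "f \<in> below (polys U) v n" "n \<le> e" "f \<in> J"
  shows "f \<in> below (J \<inter> polys U) v n"
  using f
proof (induction n arbitrary: f)
  case (Suc n)
  interpret prime_ideal "insert v U" J by fact
  obtain g a where g: "g \<in> below (polys U) v n" "a \<in> polys U" "f = (\<lambda>s. g s + a s * s v ^ n)"
    using Suc.prems(1) by (rule below_SucE)
  have a: "a \<in> J"
    by (rule low[of n a g]) (use Suc.prems g in auto)
  have "(\<lambda>s. s v ^ n * a s) \<in> J"
    by (intro mult a polys_power polys_var) auto
  then have "g \<in> J"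
    using Suc.prems(3) g(3) by (intro cancel_left[of g "\<lambda>s. a s * s v ^ n"]) (auto simp: mult.commute)
  then have "g \<in> below (J \<inter> polys U) v n"
    using Suc g by auto
  then show ?case
    unfolding g(3) using a g(2) by (intro below_SucI) auto
qed simp

text \<open>Leading terms with coefficient in \<open>J\<close> are moved into the summand
  \<open>j\<close> until a leading coefficient outside \<open>J\<close> appears; this must happen
  because \<open>f\<close> is not in \<open>J\<close>.\<close>

lemma below_trim:
  assumes J: "prime_ideal (insert v U) J"
    and f: "f \<in> below (polys U) v n" "f \<notin> J"
  shows "\<exists>k. \<exists>g\<in>below (polys U) v k. \<exists>a\<in>polys U. \<exists>j\<in>J. a \<notin> J \<and>
    f = (\<lambda>s. (g s + a s * s v ^ k) + j s)"
  using f
proof (induction n arbitrary: f)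
  case 0
  then show ?case
    using prime_ideal.zero[OF J] by simp
next
  case (Suc n)
  interpret prime_ideal "insert v U" J by fact
  obtain g a where g: "g \<in> below (polys U) v n" "a \<in> polys U" "f = (\<lambda>s. g s + a s * s v ^ n)"
    using Suc.prems(1) by (rule below_SucE)
  show ?case
  proof (cases "a \<in> J")
    case False
    then show ?thesis
      using g zero by (intro exI[of _ n] bexI[of _ g] bexI[of _ a] bexI[of _ "\<lambda>s. 0"]) auto
  next
    case True
    have a: "(\<lambda>s. s v ^ n * a s) \<in> J"
      by (intro mult True polys_power polys_var) auto
    have "g \<notin> J"
      using add[OF _ a, of g] Suc.prems(2) by (auto simp: g(3) mult.commute)
    then obtain k g' a' j where g': "g' \<in> below (polys U) v k" "a' \<in> polys U" "j \<in> J" "a' \<notin> J"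
      "g = (\<lambda>s. (g' s + a' s * s v ^ k) + j s)"
      using Suc.IH[OF g(1)] by blast
    have "(\<lambda>s. j s + s v ^ n * a s) \<in> J"
      by (rule add[OF g'(3) a])
    moreover have "f = (\<lambda>s. (g' s + a' s * s v ^ k) + (j s + s v ^ n * a s))"
      unfolding g(3) g'(5) by (simp add: algebra_simps)
    ultimately show ?thesis
      using g' by (intro exI[of _ k] bexI[of _ g'] bexI[of _ a'] bexI) auto
  qed
qed

text \<open>
  Either \<open>v\<close> is transcendental modulo \<open>J\<close>, and then the fibre is a full line, or the fibre is cut
  out generically by an element \<open>f\<close> of \<open>J\<close> of least degree in \<open>v\<close>.  In the second case some
  multiple of \<open>h\<close> is congruent modulo \<open>J\<close> to a polynomial not involving \<open>v\<close>: otherwise a multiple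
  of least degree would split off a factor of \<open>f\<close>.
\<close>

lemma prime_ideal_lift_one:
  fixes J :: "(('v \<Rightarrow> 'a::alg_closed_field) \<Rightarrow> 'a) set"
  assumes J: "prime_ideal (insert v U) J" and v: "v \<notin> U"
    and h: "h \<in> polys (insert v U)" "h \<notin> J"
  shows "\<exists>q\<in>polys U. q \<notin> J \<and> (\<forall>s. q s \<noteq> 0 \<and> (\<forall>g\<in>J \<inter> polys U. g s = 0) \<longrightarrow>
    (\<exists>t. (\<forall>g\<in>J. g (s(v := t)) = 0) \<and> h (s(v := t)) \<noteq> 0))"
proof -
  interpret prime_ideal "insert v U" J by fact
  let ?P = "polys U" and ?V = "polys (insert v U)"
  have PV: "f \<in> ?V" if "f \<in> ?P" for f :: "('v \<Rightarrow> 'a) \<Rightarrow> 'a"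
    using that by (rule polys_mono) auto
  have upd: "a (s(v := t)) = a s" if "a \<in> ?P" for a :: "('v \<Rightarrow> 'a) \<Rightarrow> 'a" and s t
    by (rule polys_cong[OF that]) (use v in auto)
  \<comment> \<open>This is an element of \<open>J\<close> of degree \<open>e\<close> in
    \<open>v\<close> whose leading coefficient is not in \<open>J\<close>, that is, a genuine
    equation for \<open>v\<close> modulo \<open>J\<close>.\<close>
  define lead where "lead e a g \<longleftrightarrow> a \<in> ?P \<and> a \<notin> J \<and> g \<in> below ?P v e \<and>
    (\<lambda>s. g s + a s * s v ^ e) \<in> J" for e a g
  show ?thesis
  proof (cases "\<exists>e a g. lead e a g")
    case False
    obtain n where "h \<in> below ?P v n"
      using h(1) by (rule polys_insert_below)
    then obtain k g a j where hh: "g \<in> below ?P v k" "a \<in> ?P" "j \<in> J" "a \<notin> J"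
      "h = (\<lambda>s. (g s + a s * s v ^ k) + j s)"
      using below_trim[OF J _ h(2)] by blast
    have van: "f (s(v := t)) = 0" if "f \<in> J" "\<forall>g\<in>J \<inter> ?P. g s = 0" for f s t
    proof -
      obtain n where n: "f \<in> below ?P v n"
        by (rule polys_insert_below[OF subsetD[OF sub \<open>f \<in> J\<close>]])
      have "f \<in> below (J \<inter> ?P) v n"
        by (rule below_in_ideal[OF J _ n order_refl that(1)])
          (use False in \<open>auto simp: lead_def\<close>)
      moreover have "a (s(v := t)) = 0" if "a \<in> J \<inter> ?P" for a
        using upd[of a s t] that \<open>\<forall>g\<in>J \<inter> ?P. g s = 0\<close> by simp
      ultimately show ?thesis
        by (rule below_vanish)
    qed
    \<comment> \<open>The polynomial \<open>q\<close> is the leading coefficient \<open>a\<close> of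
      \<open>h\<close> after trimming modulo \<open>J\<close>. Where it does not vanish,
      \<open>h\<close> is a non-zero polynomial along the fibre, on which all of \<open>J\<close>
      vanishes.\<close>
    have "\<exists>t. (\<forall>g\<in>J. g (s(v := t)) = 0) \<and> h (s(v := t)) \<noteq> 0"
      if s: "a s \<noteq> 0" "\<forall>g\<in>J \<inter> ?P. g s = 0" for s
    proof -
      obtain p where p: "\<And>t. g (s(v := t)) + a (s(v := t)) * t ^ k = poly p t" "p \<noteq> 0"
        using below_on_fibre_lead[where s = s, OF v hh(1,2) s(1)] by blast
      obtain t where t: "poly p t \<noteq> 0"
        using poly_eq_0_alg_closed[of p] p(2) by blast
      have "h (s(v := t)) = (g (s(v := t)) + a (s(v := t)) * t ^ k) + j (s(v := t))"
        unfolding hh(5) by simp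
      then have "h (s(v := t)) \<noteq> 0"
        unfolding p(1) van[OF hh(3) s(2)] using t by simp
      then show ?thesis
        using van[OF _ s(2)] by blast
    qed
    then show ?thesis
      using hh(2,4) by blast
  next
    case True
    define e where "e = (LEAST e. \<exists>a g. lead e a g)"
    obtain a0 g0 where "lead e a0 g0"
      using LeastI_ex[OF True] unfolding e_def by blast
    then have a0: "a0 \<in> ?P" "a0 \<notin> J" and g0: "g0 \<in> below ?P v e"
      and f: "(\<lambda>s. g0 s + a0 s * s v ^ e) \<in> J"
      by (auto simp: lead_def)
    have least: "\<not> lead k a g" if "k < e" for k a g
      using not_less_Least[of k "\<lambda>e. \<exists>a g. lead e a g"] that unfolding e_def by blast
    \<comment> \<open>For \<open>e = 0\<close> the leading coefficient \<open>a0\<close> would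
      itself lie in \<open>J\<close>.\<close>
    have "e > 0"
      using f g0 a0(2) by (cases e) auto
    \<comment> \<open>\<open>R\<close> consists of the polynomials outside \<open>J\<close> that are
      multiples of \<open>h\<close> modulo \<open>J\<close>. If a member of \<open>R\<close> is
      non-zero at a zero of \<open>J\<close>, so is \<open>h\<close>; the aim is a member that does
      not involve \<open>v\<close>.\<close>
    define R where "R = {r \<in> ?V. r \<notin> J \<and> (\<exists>A\<in>?V. (\<lambda>s. r s - A s * h s) \<in> J)}"
    have R_cong: "r' \<in> R" if "r \<in> R" "c \<in> ?V" "r' \<in> ?V" "r' \<notin> J" "(\<lambda>s. r' s - c s * r s) \<in> J"
      for r r' c
    proof -
      obtain A where A: "A \<in> ?V" "(\<lambda>s. r s - A s * h s) \<in> J"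
        using \<open>r \<in> R\<close> by (auto simp: R_def)
      have "(\<lambda>s. (r' s - c s * r s) + c s * (r s - A s * h s)) \<in> J"
        by (intro add mult A that)
      then have "(\<lambda>s. r' s - (c s * A s) * h s) \<in> J"
        by (simp add: algebra_simps)
      moreover have "(\<lambda>s. c s * A s) \<in> ?V"
        by (intro polys_mult A that)
      ultimately show ?thesis
        using that(3,4) unfolding R_def
        by (intro CollectI conjI bexI[of _ "\<lambda>s. c s * A s"]) auto
    qed
    have "h \<in> R"
      using h zero polys_const[of 1] by (auto simp: R_def intro!: bexI[of _ "\<lambda>s. 1"])
    moreover obtain n where "h \<in> below ?P v n"
      using h(1) by (rule polys_insert_below)
    ultimately have ex: "\<exists>m. \<exists>r\<in>R. r \<in> below ?P v m"
      by blast
    define m where "m = (LEAST m. \<exists>r\<in>R. r \<in> below ?P v m)"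
    obtain r where r: "r \<in> R" "r \<in> below ?P v m"
      using LeastI_ex[OF ex] unfolding m_def by blast
    have m_least: "m \<le> k" if "r' \<in> R" "r' \<in> below ?P v k" for r' k
      unfolding m_def using that by (intro Least_le) blast
    have rV: "r \<in> ?V" and rJ: "r \<notin> J"
      using r(1) by (auto simp: R_def)
    \<comment> \<open>The pseudo-remainder of \<open>r\<close> by the equation of degree
      \<open>e\<close> has smaller degree than \<open>e\<close> in \<open>v\<close>, and modulo
      \<open>J\<close> it is \<open>r\<close> times a power of \<open>a0\<close>, hence still in
      \<open>R\<close>.\<close>
    have "m \<le> e"
    proof -
      obtain N Q where Q: "Q \<in> below ?P v (m - e)"
        "(\<lambda>s. a0 s ^ N * r s - (g0 s + a0 s * s v ^ e) * Q s) \<in> below ?P v e"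
        using pseudo_division[OF g0 a0(1) r(2)] by blast
      let ?r = "\<lambda>s. a0 s ^ N * r s - (g0 s + a0 s * s v ^ e) * Q s"
      have fQ: "(\<lambda>s. Q s * (g0 s + a0 s * s v ^ e)) \<in> J"
        by (rule mult[OF f below_polys[OF Q(1)]])
      have "?r \<notin> J"
      proof
        assume "?r \<in> J"
        then have "(\<lambda>s. ?r s + Q s * (g0 s + a0 s * s v ^ e)) \<in> J"
          using fQ by (rule add)
        then have "(\<lambda>s. a0 s ^ N * r s) \<in> J"
          by (simp add: mult.commute)
        then have "(\<lambda>s. a0 s ^ N) \<in> J \<or> r \<in> J"
          by (intro prime polys_power PV a0 rV)
        then show False
          using power[OF PV[OF a0(1)] a0(2)] rJ by blast
      qed
      moreover have "(\<lambda>s. ?r s - a0 s ^ N * r s) \<in> J"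
        using diff[OF zero fQ] by (simp add: mult.commute)
      ultimately have "?r \<in> R"
        by (intro R_cong[OF r(1) polys_power[OF PV[OF a0(1)]] below_polys[OF Q(2)]])
      then show ?thesis
        using Q(2) by (rule m_least)
    qed
    obtain m' where m': "m = Suc m'"
      using r(2) rJ zero by (cases m) auto
    obtain r0 b where r0: "r0 \<in> below ?P v m'" and b: "b \<in> ?P"
      and r_eq: "r = (\<lambda>s. r0 s + b s * s v ^ m')"
      using r(2) unfolding m' by (rule below_SucE)
    \<comment> \<open>A leading coefficient in \<open>J\<close> could be dropped, leaving a member
      of \<open>R\<close> of smaller degree.\<close>
    have "b \<notin> J"
    proof
      assume "b \<in> J"
      have bv: "(\<lambda>s. s v ^ m' * b s) \<in> J"
        by (intro mult \<open>b \<in> J\<close> polys_power polys_var) auto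
      have "r0 \<notin> J"
        using add[OF _ bv, of r0] rJ by (auto simp: r_eq mult.commute)
      moreover have "(\<lambda>s. r0 s - 1 * r s) \<in> J"
        using diff[OF zero bv] by (simp add: r_eq mult.commute)
      ultimately have "r0 \<in> R"
        by (intro R_cong[OF r(1) polys_const[of 1] below_polys[OF r0]])
      then show False
        using m_least[OF _ r0] m' by simp
    qed
    \<comment> \<open>If \<open>r\<close> involved \<open>v\<close>, the equation of degree
      \<open>e\<close> would be pseudo-divided by \<open>r\<close>. The remainder \<open>D\<close>
      is a multiple of \<open>r\<close> modulo \<open>J\<close> and of smaller degree, so by
      minimality of \<open>m\<close> it lies in \<open>J\<close>. Then \<open>r * Q'\<close> is in
      \<open>J\<close>, hence \<open>Q'\<close> is, and \<open>Q'\<close> is an equation for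
      \<open>v\<close> of degree \<open>e - m' < e\<close>.\<close>
    have "m' = 0"
    proof (rule ccontr)
      assume "m' \<noteq> 0"
      have "m' \<le> e"
        using \<open>m \<le> e\<close> m' by simp
      then obtain N Q where Q: "Q \<in> below ?P v (e - m')"
        "(\<lambda>s. b s ^ Suc N * (g0 s + a0 s * s v ^ e) -
          (r0 s + b s * s v ^ m') * (Q s + (b s ^ N * a0 s) * s v ^ (e - m'))) \<in> below ?P v m'"
        using pseudo_division_lead[OF r0 b g0 a0(1)] by blast
      define Q' where "Q' = (\<lambda>s. Q s + (b s ^ N * a0 s) * s v ^ (e - m'))"
      define D where "D = (\<lambda>s. b s ^ Suc N * (g0 s + a0 s * s v ^ e) - r s * Q' s)"
      have D: "D \<in> below ?P v m'"
        using Q(2) by (simp add: D_def Q'_def r_eq)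
      have Q': "Q' \<in> ?V"
        unfolding Q'_def
        by (intro below_polys[OF below_SucI[OF Q(1)]] polys_mult polys_power a0(1) b)
      have bf: "(\<lambda>s. b s ^ Suc N * (g0 s + a0 s * s v ^ e)) \<in> J"
        by (intro mult f polys_power PV b)
      have "D \<in> J"
      proof (rule ccontr)
        assume "D \<notin> J"
        moreover have "(\<lambda>s. D s - (0 - Q' s) * r s) \<in> J"
          using bf by (simp add: D_def mult.commute)
        ultimately have "D \<in> R"
          by (intro R_cong[OF r(1) polys_diff[OF polys_const[of 0] Q'] below_polys[OF D]])
        then show False
          using m_least[OF _ D] m' by simp
      qed
      then have "(\<lambda>s. b s ^ Suc N * (g0 s + a0 s * s v ^ e) - D s) \<in> J"
        by (rule diff[OF bf])
      then have "(\<lambda>s. r s * Q' s) \<in> J"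
        by (simp add: D_def)
      then have "Q' \<in> J"
        using prime[OF rV Q'] rJ by blast
      moreover have "(\<lambda>s. b s ^ N * a0 s) \<notin> J"
        using prime[OF polys_power[OF PV[OF b]] PV[OF a0(1)]] power[OF PV[OF b] \<open>b \<notin> J\<close>] a0(2)
        by blast
      ultimately have "lead (e - m') (\<lambda>s. b s ^ N * a0 s) Q"
        using Q(1) a0(1) b by (auto simp: lead_def Q'_def intro: polys_mult polys_power)
      then show False
        using least[of "e - m'"] \<open>m' \<noteq> 0\<close> \<open>e > 0\<close> by simp
    qed
    then have r_b: "r = b"
      using r0 r_eq by simp
    obtain A where A: "A \<in> ?V" "(\<lambda>s. b s - A s * h s) \<in> J"
      using r(1) by (auto simp: R_def r_b)
    \<comment> \<open>The polynomial \<open>q\<close> is \<open>a0 * b\<close>: the factor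
      \<open>a0\<close> keeps the degree of the equation on the fibre positive, so that it has a
      root \<open>t\<close> there, and the factor \<open>b\<close> keeps \<open>h\<close> from
      vanishing at that root.\<close>
    have "\<exists>t. (\<forall>g\<in>J. g (s(v := t)) = 0) \<and> h (s(v := t)) \<noteq> 0"
      if s: "a0 s * b s \<noteq> 0" "\<forall>g\<in>J \<inter> ?P. g s = 0" for s
    proof -
      have "a0 s \<noteq> 0" "b s \<noteq> 0"
        using s(1) by auto
      obtain p where p: "\<And>t. g0 (s(v := t)) + a0 (s(v := t)) * t ^ e = poly p t" "e \<le> degree p"
        using below_on_fibre_lead[where s = s, OF v g0 a0(1) \<open>a0 s \<noteq> 0\<close>] by blast
      obtain t where t: "poly p t = 0"
        using alg_closed_imp_poly_has_root[of p] p(2) \<open>e > 0\<close> by auto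
      define s' where "s' = s(v := t)"
      have s'_eq: "a s' = a s" if "a \<in> ?P" for a
        unfolding s'_def by (rule upd[OF that])
      have "s' v = t"
        by (simp add: s'_def)
      then have fs': "g0 s' + a0 s' * s' v ^ e = 0"
        using p(1)[of t, folded s'_def] t by simp
      \<comment> \<open>A pseudo-remainder by the equation lies in \<open>J\<close> and has degree
        below \<open>e\<close>, so its coefficients are in \<open>J\<close> and it vanishes at
        \<open>s'\<close>. The equation vanishes there too, and \<open>a0\<close> does not.\<close>
      have van: "g s' = 0" if "g \<in> J" for g
      proof -
        obtain n where n: "g \<in> below ?P v n"
          by (rule polys_insert_below[OF subsetD[OF sub \<open>g \<in> J\<close>]])
        obtain N Q where Q: "Q \<in> below ?P v (n - e)"
          "(\<lambda>s. a0 s ^ N * g s - (g0 s + a0 s * s v ^ e) * Q s) \<in> below ?P v e"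
          using pseudo_division[OF g0 a0(1) n] by blast
        have "(\<lambda>s. a0 s ^ N * g s - Q s * (g0 s + a0 s * s v ^ e)) \<in> J"
          by (intro diff mult f that below_polys[OF Q(1)] polys_power PV a0)
        then have "(\<lambda>s. a0 s ^ N * g s - (g0 s + a0 s * s v ^ e) * Q s) \<in> J"
          by (simp add: mult.commute)
        then have "(\<lambda>s. a0 s ^ N * g s - (g0 s + a0 s * s v ^ e) * Q s) \<in> below (J \<inter> ?P) v e"
          by (intro below_in_ideal[OF J _ Q(2) order_refl])
            (use least in \<open>auto simp: lead_def\<close>)
        moreover have "a s' = 0" if "a \<in> J \<inter> ?P" for a
          using s'_eq[of a] that s(2) by simp
        ultimately have "a0 s' ^ N * g s' - (g0 s' + a0 s' * s' v ^ e) * Q s' = 0"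
          by (rule below_vanish)
        then show ?thesis
          using fs' s'_eq[OF a0(1)] \<open>a0 s \<noteq> 0\<close> by simp
      qed
      have "A s' * h s' \<noteq> 0"
        using van[OF A(2)] s'_eq[OF b] \<open>b s \<noteq> 0\<close> by auto
      then show ?thesis
        using van unfolding s'_def by (intro exI[of _ t]) simp
    qed
    moreover have "(\<lambda>s. a0 s * b s) \<notin> J"
      using prime[OF PV[OF a0(1)] PV[OF b]] a0(2) \<open>b \<notin> J\<close> by blast
    ultimately show ?thesis
      using polys_mult[OF a0(1) b] by blast
  qed
qed

text \<open>Variables are eliminated one at a time. The polynomial that must be non-zero for lifting
  along one variable is the one to be kept non-zero when lifting along the remaining ones, which is
  why an arbitrary \<open>h\<close> is carried along.\<close>

lemma prime_ideal_lift:
  fixes J :: "(('v \<Rightarrow> 'a::alg_closed_field) \<Rightarrow> 'a) set"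
  assumes "finite E" "E \<inter> K = {}" "prime_ideal (K \<union> E) J" "h \<in> polys (K \<union> E)" "h \<notin> J"
  shows "\<exists>q\<in>polys K. q \<notin> J \<and> (\<forall>s. q s \<noteq> 0 \<and> (\<forall>g\<in>J \<inter> polys K. g s = 0) \<longrightarrow>
    (\<exists>s'. (\<forall>v\<in>K. s' v = s v) \<and> (\<forall>g\<in>J. g s' = 0) \<and> h s' \<noteq> 0))"
  using assms
proof (induction E arbitrary: J h)
  case empty
  interpret prime_ideal K J
    using empty by simp
  show ?case
    using empty sub by (intro bexI[of _ h]) auto
next
  case (insert v E)
  let ?U = "K \<union> E"
  have J: "prime_ideal (insert v ?U) J" and v: "v \<notin> ?U" and h: "h \<in> polys (insert v ?U)"
    using insert by auto
  obtain h' where h': "h' \<in> polys ?U" "h' \<notin> J"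
    and lift: "\<And>s. h' s \<noteq> 0 \<Longrightarrow> (\<forall>g\<in>J \<inter> polys ?U. g s = 0) \<Longrightarrow>
      \<exists>t. (\<forall>g\<in>J. g (s(v := t)) = 0) \<and> h (s(v := t)) \<noteq> 0"
    using prime_ideal_lift_one[OF J v h insert.prems(4)] by blast
  have J': "prime_ideal ?U (J \<inter> polys ?U)"
    by (rule prime_ideal.contract[OF J]) auto
  have KU: "polys K \<subseteq> (polys ?U :: (('v \<Rightarrow> 'a) \<Rightarrow> 'a) set)"
    by (auto elim: polys_mono)
  obtain q where q: "q \<in> polys K" "q \<notin> J \<inter> polys ?U"
    and liftq: "\<And>s. q s \<noteq> 0 \<Longrightarrow> (\<forall>g\<in>J \<inter> polys ?U \<inter> polys K. g s = 0) \<Longrightarrow>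
      \<exists>s'. (\<forall>v\<in>K. s' v = s v) \<and> (\<forall>g\<in>J \<inter> polys ?U. g s' = 0) \<and> h' s' \<noteq> 0"
    using insert.IH[OF _ J' h'(1)] h'(2) insert.prems(1) by blast
  show ?case
  proof (intro bexI[of _ q] conjI allI impI)
    show "q \<notin> J"
      using q KU by blast
    fix s assume s: "q s \<noteq> 0 \<and> (\<forall>g\<in>J \<inter> polys K. g s = 0)"
    then obtain s' where s': "\<forall>v\<in>K. s' v = s v" "\<forall>g\<in>J \<inter> polys ?U. g s' = 0" "h' s' \<noteq> 0"
      using liftq[of s] by blast
    obtain t where t: "\<forall>g\<in>J. g (s'(v := t)) = 0" "h (s'(v := t)) \<noteq> 0"
      using lift[OF s'(3,2)] by blast
    have "\<forall>w\<in>K. (s'(v := t)) w = s w"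
      using s'(1) v by auto
    then show "\<exists>s'. (\<forall>v\<in>K. s' v = s v) \<and> (\<forall>g\<in>J. g s' = 0) \<and> h s' \<noteq> 0"
      using t by blast
  qed (rule q(1))
qed

section \<open>Prime ideals avoiding a multiplicative set\<close>

definition is_ideal :: "'v set \<Rightarrow> (('v \<Rightarrow> 'a::field) \<Rightarrow> 'a) set \<Rightarrow> bool" where
  "is_ideal U I \<longleftrightarrow> I \<subseteq> polys U \<and> (\<lambda>s. 0) \<in> I \<and> (\<forall>f\<in>I. \<forall>g\<in>I. (\<lambda>s. f s + g s) \<in> I) \<and>
     (\<forall>f\<in>I. \<forall>g\<in>polys U. (\<lambda>s. g s * f s) \<in> I)"

lemma is_ideal_extend:
  assumes I: "is_ideal U I" and f: "f \<in> polys U"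
  defines "I' \<equiv> {\<lambda>s. j s + p s * f s | j p. j \<in> I \<and> p \<in> polys U}"
  shows "is_ideal U I'" "I \<subseteq> I'" "f \<in> I'"
proof -
  have I'I: "(\<lambda>s. j s + p s * f s) \<in> I'" if "j \<in> I" "p \<in> polys U" for j p
    using that unfolding I'_def by blast
  have I'E: thesis if "h \<in> I'" "\<And>j p. j \<in> I \<Longrightarrow> p \<in> polys U \<Longrightarrow> h = (\<lambda>s. j s + p s * f s) \<Longrightarrow> thesis"
    for h thesis
    using that unfolding I'_def by blast
  show sub: "I \<subseteq> I'"
    using I'I[OF _ polys_const[of 0]] by auto
  show "f \<in> I'"
    using I'I[OF _ polys_const[of 1], of "\<lambda>s. 0"] I by (simp add: is_ideal_def)
  have "h \<in> polys U" if "h \<in> I'" for h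
    using that by (rule I'E) (use I f in \<open>auto simp: is_ideal_def intro!: polys_add polys_mult\<close>)
  moreover have "(\<lambda>s. g s + h s) \<in> I'" if gh: "g \<in> I'" "h \<in> I'" for g h
  proof -
    obtain j p where g: "j \<in> I" "p \<in> polys U" "g = (\<lambda>s. j s + p s * f s)"
      using gh(1) by (rule I'E)
    obtain j' p' where h: "j' \<in> I" "p' \<in> polys U" "h = (\<lambda>s. j' s + p' s * f s)"
      using gh(2) by (rule I'E)
    have "(\<lambda>s. j s + j' s) \<in> I"
      using I g h by (simp add: is_ideal_def)
    from I'I[OF this polys_add[OF g(2) h(2)]] show ?thesis
      by (simp add: g(3) h(3) algebra_simps)
  qed
  moreover have "(\<lambda>s. q s * g s) \<in> I'" if gq: "g \<in> I'" "q \<in> polys U" for g q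
  proof -
    obtain j p where g: "j \<in> I" "p \<in> polys U" "g = (\<lambda>s. j s + p s * f s)"
      using gq(1) by (rule I'E)
    have "(\<lambda>s. q s * j s) \<in> I"
      using I g gq(2) by (simp add: is_ideal_def)
    from I'I[OF this polys_mult[OF gq(2) g(2)]] show ?thesis
      by (simp add: g(3) algebra_simps)
  qed
  moreover have "(\<lambda>s. 0) \<in> I'"
    using sub I by (auto simp: is_ideal_def)
  ultimately show "is_ideal U I'"
    by (auto simp: is_ideal_def)
qed

text \<open>Krull's argument: by Zorn's lemma there is an ideal maximal among those that contain
  \<open>I\<close> and avoid \<open>M\<close>, and such an ideal is prime.\<close>

lemma prime_ideal_exists:
  fixes I :: "(('v \<Rightarrow> 'a::alg_closed_field) \<Rightarrow> 'a) set"
  assumes I: "is_ideal U I" "I \<inter> M = {}"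
    and M: "(\<lambda>s. 1) \<in> M" "\<And>f g. f \<in> M \<Longrightarrow> g \<in> M \<Longrightarrow> (\<lambda>s. f s * g s) \<in> M"
  obtains J where "prime_ideal U J" "I \<subseteq> J" "J \<inter> M = {}"
proof -
  define \<A> where "\<A> = {J. is_ideal U J \<and> I \<subseteq> J \<and> J \<inter> M = {}}"
  have "\<exists>J\<in>\<A>. \<forall>X\<in>\<A>. J \<subseteq> X \<longrightarrow> X = J"
  proof (rule subset_Zorn_nonempty)
    show "\<A> \<noteq> {}"
      using I by (auto simp: \<A>_def)
    fix \<C> assume C: "\<C> \<noteq> {}" "subset.chain \<A> \<C>"
    then have mem: "is_ideal U X" "I \<subseteq> X" "X \<inter> M = {}" if "X \<in> \<C>" for X
      using that by (auto simp: subset.chain_def \<A>_def)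
    have "(\<lambda>s. f s + g s) \<in> \<Union>\<C>" if fg: "f \<in> \<Union>\<C>" "g \<in> \<Union>\<C>" for f g
    proof -
      obtain X Y where "X \<in> \<C>" "f \<in> X" "Y \<in> \<C>" "g \<in> Y"
        using fg by blast
      moreover have "X \<subseteq> Y \<or> Y \<subseteq> X"
        using C(2) \<open>X \<in> \<C>\<close> \<open>Y \<in> \<C>\<close> by (auto simp: subset.chain_def)
      ultimately obtain Z where "Z \<in> \<C>" "f \<in> Z" "g \<in> Z"
        by blast
      then show ?thesis
        using mem(1)[of Z] by (auto simp: is_ideal_def)
    qed
    moreover have "(\<lambda>s. g s * f s) \<in> \<Union>\<C>" if fg: "f \<in> \<Union>\<C>" "g \<in> polys U" for f g
    proof -
      obtain X where X: "X \<in> \<C>" "f \<in> X"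
        using fg(1) by blast
      then have "(\<lambda>s. g s * f s) \<in> X"
        using mem(1)[OF X(1)] fg(2) unfolding is_ideal_def by blast
      then show ?thesis
        using X(1) by blast
    qed
    moreover have "X \<subseteq> polys U \<and> (\<lambda>s. 0) \<in> X" if "X \<in> \<C>" for X
      using mem(1)[OF that] by (simp add: is_ideal_def)
    then have "\<Union>\<C> \<subseteq> polys U" "(\<lambda>s. 0) \<in> \<Union>\<C>"
      using C(1) by blast+
    ultimately have "is_ideal U (\<Union>\<C>)"
      by (simp add: is_ideal_def)
    then show "\<Union>\<C> \<in> \<A>"
      using C(1) mem(2,3) by (auto simp: \<A>_def)
  qed
  then obtain J where "J \<in> \<A>" and maxJ: "\<And>X. X \<in> \<A> \<Longrightarrow> J \<subseteq> X \<Longrightarrow> X = J"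
    by auto
  then have J: "is_ideal U J" "I \<subseteq> J" "J \<inter> M = {}"
    by (simp_all add: \<A>_def)
  have max: "X = J" if "is_ideal U X" "X \<inter> M = {}" "J \<subseteq> X" for X
    using maxJ[of X] that J(2) by (auto simp: \<A>_def)
  have meets: "\<exists>j\<in>J. \<exists>p\<in>polys U. (\<lambda>s. j s + p s * f s) \<in> M" if "f \<in> polys U" "f \<notin> J" for f
    using max[OF is_ideal_extend(1)[OF J(1) that(1)]] is_ideal_extend(2,3)[OF J(1) that(1)] that(2)
    by blast
  have "prime_ideal U J"
  proof
    fix f g assume fg: "f \<in> polys U" "g \<in> polys U" "(\<lambda>s. f s * g s) \<in> J"
    show "f \<in> J \<or> g \<in> J"
    proof (rule ccontr)
      assume "\<not> ?thesis"
      then obtain i p j q where ip: "i \<in> J" "p \<in> polys U" "(\<lambda>s. i s + p s * f s) \<in> M"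
        and jq: "j \<in> J" "q \<in> polys U" "(\<lambda>s. j s + q s * g s) \<in> M"
        using meets[OF fg(1)] meets[OF fg(2)] by blast
      have add: "(\<lambda>s. a s + b s) \<in> J" if "a \<in> J" "b \<in> J" for a b
        using J(1) that by (simp add: is_ideal_def)
      have mult: "(\<lambda>s. b s * a s) \<in> J" if "a \<in> J" "b \<in> polys U" for a b
        using J(1) that by (simp add: is_ideal_def)
      have "i \<in> polys U"
        using ip(1) J(1) by (auto simp: is_ideal_def)
      \<comment> \<open>This is the product of the two elements \<open>i + p * f\<close> and
        \<open>j + q * g\<close> of \<open>M\<close>, arranged so that every summand visibly lies in
        \<open>J\<close>.\<close>
      then have "(\<lambda>s. (i s + p s * f s) * j s + (q s * g s * i s + p s * q s * (f s * g s))) \<in> J"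
        by (intro add mult ip jq fg polys_mult polys_add)
      moreover have "(\<lambda>s. (i s + p s * f s) * j s + (q s * g s * i s + p s * q s * (f s * g s))) \<in> M"
        using M(2)[OF ip(3) jq(3)] by (simp add: algebra_simps)
      ultimately show False
        using J(3) by blast
    qed
  qed (use J M(1) in \<open>auto simp: is_ideal_def\<close>)
  then show thesis
    using that J by blast
qed

section \<open>Chains in locally closed sets\<close>

text \<open>
  The prime ideal is chosen disjoint from the products \<open>h ^ k * w\<close>, so that \<open>K\<close> stays
  independent on its zero set in \<open>h \<noteq> 0\<close>.
\<close>

lemma prime_ideal_of_indep:
  fixes h :: "('v::finite \<Rightarrow> 'a::alg_closed_field) \<Rightarrow> 'a"
  assumes P: "P \<subseteq> polys UNIV" and h: "h \<in> polys UNIV"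
    and indep: "indep_on {s. (\<forall>f\<in>P. f s = 0) \<and> h s \<noteq> 0} K"
  obtains J where "prime_ideal UNIV J" "P \<subseteq> J" "h \<notin> J" "\<And>w. w \<in> polys K \<Longrightarrow> w \<in> J \<Longrightarrow> w = (\<lambda>s. 0)"
proof -
  define S where "S = {s. (\<forall>f\<in>P. f s = 0) \<and> h s \<noteq> 0}"
  define I where "I = {g \<in> polys UNIV. \<forall>s\<in>S. g s = 0}"
  define M where "M = {\<lambda>s. h s ^ k * w s | k w. w \<in> polys K \<and> w \<noteq> (\<lambda>s. 0)}"
  have MI: "(\<lambda>s. h s ^ k * w s) \<in> M" if "w \<in> polys K" "w \<noteq> (\<lambda>s. 0)" for k w
    using that unfolding M_def by blast
  have "is_ideal UNIV I"
    unfolding is_ideal_def I_def by (auto intro: polys_const polys_add polys_mult)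
  moreover have "I \<inter> M = {}"
  proof -
    have "w = (\<lambda>s. 0)" if "w \<in> polys K" "\<forall>s\<in>S. h s ^ k * w s = 0" for k w
      using indep that by (auto simp: indep_on_def S_def)
    then show ?thesis
      unfolding I_def M_def by blast
  qed
  moreover have "(\<lambda>s. 1) \<in> M"
    using MI[OF polys_const[of 1], of 0] by (simp add: fun_eq_iff)
  moreover have "(\<lambda>s. f s * g s) \<in> M" if fM: "f \<in> M" and gM: "g \<in> M" for f g
  proof -
    obtain k w where f: "w \<in> polys K" "w \<noteq> (\<lambda>s. 0)" "f = (\<lambda>s. h s ^ k * w s)"
      using fM unfolding M_def by blast
    obtain l x where g: "x \<in> polys K" "x \<noteq> (\<lambda>s. 0)" "g = (\<lambda>s. h s ^ l * x s)"
      using gM unfolding M_def by blast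
    have "(\<lambda>s. w s * x s) \<noteq> (\<lambda>s. 0)"
      using polys_no_zero_divisors[OF f(1) g(1)] f(2) g(2) by (metis (full_types))
    from MI[OF polys_mult[OF f(1) g(1)] this, of "k + l"] show ?thesis
      by (simp add: f(3) g(3) power_add mult_ac)
  qed
  ultimately obtain J where J: "prime_ideal UNIV J" "I \<subseteq> J" "J \<inter> M = {}"
    by (rule prime_ideal_exists) blast
  show thesis
  proof (rule that[OF J(1)])
    show "P \<subseteq> J"
      using J(2) P by (auto simp: I_def S_def)
    have "h \<in> M"
      using MI[OF polys_const[of 1], of 1] by (simp add: fun_eq_iff)
    then show "h \<notin> J"
      using J(3) by blast
    show "w = (\<lambda>s. 0)" if "w \<in> polys K" "w \<in> J" for w
      using MI[OF that(1), of 0] J(3) that(2) by auto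
  qed
qed

text \<open>All variables are eliminated. Only constants remain, and a proper ideal contains no
  constant but 0, so every point satisfies the conditions for lifting.\<close>

lemma prime_ideal_nullstellensatz:
  fixes J :: "(('v::finite \<Rightarrow> 'a::alg_closed_field) \<Rightarrow> 'a) set"
  assumes J: "prime_ideal UNIV J" and h: "h \<in> polys UNIV" "h \<notin> J"
  shows "\<exists>s. (\<forall>g\<in>J. g s = 0) \<and> h s \<noteq> 0"
proof -
  interpret prime_ideal UNIV J by fact
  obtain q where q: "q \<in> polys {}" "q \<notin> J"
    and lift: "\<And>s. q s \<noteq> 0 \<Longrightarrow> (\<forall>g\<in>J \<inter> polys {}. g s = 0) \<Longrightarrow> \<exists>s'. (\<forall>g\<in>J. g s' = 0) \<and> h s' \<noteq> 0"
    using prime_ideal_lift[of UNIV "{}" J h] J h by auto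
  have const: "\<exists>c. f = (\<lambda>s. c)" if "f \<in> polys {}" for f :: "('v \<Rightarrow> 'a) \<Rightarrow> 'a"
  proof -
    have "f s = f (\<lambda>_. 0)" for s
      by (rule polys_cong[OF that]) auto
    then show ?thesis
      by blast
  qed
  have "c = 0" if "(\<lambda>s. c) \<in> J" for c
  proof (rule ccontr)
    assume "c \<noteq> 0"
    then show False
      using mult[OF that polys_const[of "1 / c"]] one by simp
  qed
  then have "g s = 0" if "g \<in> J \<inter> polys {}" for g s
    using const[of g] that by auto
  moreover have "q s \<noteq> 0" for s
    using const[OF q(1)] q(2) zero by auto
  ultimately show ?thesis
    using lift by blast
qed

text \<open>The Nullstellensatz applied to \<open>f * h\<close> shows that \<open>J\<close> is
  exactly the set of polynomials vanishing on \<open>Z\<close>, in spite of the removed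
  hypersurface; primeness of \<open>J\<close> is then irreducibility of \<open>Z\<close>.\<close>

lemma irr_prime_zero_set:
  fixes J :: "(('v::finite \<Rightarrow> 'a::alg_closed_field) \<Rightarrow> 'a) set"
  assumes J: "prime_ideal UNIV J" and h: "h \<in> polys UNIV" "h \<notin> J"
  defines "Z \<equiv> {s. (\<forall>g\<in>J. g s = 0) \<and> h s \<noteq> 0}"
  shows "irr Z" "\<And>f. f \<in> polys UNIV \<Longrightarrow> f \<notin> J \<Longrightarrow> \<exists>s\<in>Z. f s \<noteq> 0"
proof -
  interpret prime_ideal UNIV J by fact
  show nz: "\<exists>s\<in>Z. f s \<noteq> 0" if "f \<in> polys UNIV" "f \<notin> J" for f
  proof -
    have "(\<lambda>s. f s * h s) \<notin> J"
      using prime[OF that(1) h(1)] that(2) h(2) by blast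
    then show ?thesis
      using prime_ideal_nullstellensatz[OF J polys_mult[OF that(1) h(1)]] by (auto simp: Z_def)
  qed
  show "irr Z"
    unfolding irr_def
  proof (intro conjI ballI impI)
    show "Z \<noteq> {}"
      using nz[OF h] by blast
    fix f g :: "('v \<Rightarrow> 'a) \<Rightarrow> 'a"
    assume fg: "f \<in> polys UNIV" "g \<in> polys UNIV" "\<forall>s\<in>Z. f s * g s = 0"
    have "(\<lambda>s. f s * g s) \<in> J"
      using nz[OF polys_mult[OF fg(1,2)]] fg(3) by blast
    then have "f \<in> J \<or> g \<in> J"
      using prime[OF fg(1,2)] by blast
    then show "(\<forall>s\<in>Z. f s = 0) \<or> (\<forall>s\<in>Z. g s = 0)"
      by (auto simp: Z_def)
  qed
qed

text \<open>
  Cut by a hyperplane \<open>x\<^sub>i = c\<close>: by the lifting theorem the projection to the coordinates \<open>K\<close>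
  contains a set \<open>q \<noteq> 0\<close>, so for generic \<open>c\<close> the remaining coordinates stay independent.
\<close>

lemma irr_chain_exists:
  fixes h :: "('v::finite \<Rightarrow> 'a::alg_closed_field) \<Rightarrow> 'a"
  assumes "P \<subseteq> polys UNIV" "h \<in> polys UNIV"
    and "indep_on {s. (\<forall>f\<in>P. f s = 0) \<and> h s \<noteq> 0} K" "card K = n"
  shows "\<exists>Z Q. irr_chain Z n \<and> (\<forall>i\<le>n. P \<subseteq> Q i \<and> Q i \<subseteq> polys UNIV \<and>
    Z i = {s. (\<forall>f\<in>Q i. f s = 0) \<and> h s \<noteq> 0})"
  using assms
proof (induction n arbitrary: P K)
  case (0 P K)
  obtain J where J: "prime_ideal UNIV J" "P \<subseteq> J" "h \<notin> J"
    by (rule prime_ideal_of_indep[OF 0(1-3)]) blast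
  show ?case
    using irr_prime_zero_set(1)[OF J(1) 0(2) J(3)] J(2) prime_ideal.sub[OF J(1)]
    by (intro exI[of _ "\<lambda>_. {s. (\<forall>f\<in>J. f s = 0) \<and> h s \<noteq> 0}"] exI[of _ "\<lambda>_. J"])
      (auto simp: irr_chain_def)
next
  case (Suc n P K)
  obtain J where J: "prime_ideal UNIV J" "P \<subseteq> J" "h \<notin> J"
    and JK: "\<And>w. w \<in> polys K \<Longrightarrow> w \<in> J \<Longrightarrow> w = (\<lambda>s. 0)"
    by (rule prime_ideal_of_indep[OF Suc.prems(1-3)]) blast
  define ZJ where "ZJ = {s. (\<forall>f\<in>J. f s = 0) \<and> h s \<noteq> 0}"
  have irr: "irr ZJ" and nz: "\<And>f. f \<in> polys UNIV \<Longrightarrow> f \<notin> J \<Longrightarrow> \<exists>s\<in>ZJ. f s \<noteq> 0"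
    unfolding ZJ_def using irr_prime_zero_set[OF J(1) Suc.prems(2) J(3)] by blast+
  have Jsub: "J \<subseteq> polys UNIV"
    using prime_ideal.sub[OF J(1)] .
  obtain q where q: "q \<in> polys K" "q \<notin> J"
    and lift: "\<And>s. q s \<noteq> 0 \<Longrightarrow> (\<forall>g\<in>J \<inter> polys K. g s = 0) \<Longrightarrow>
      \<exists>s'. (\<forall>v\<in>K. s' v = s v) \<and> (\<forall>g\<in>J. g s' = 0) \<and> h s' \<noteq> 0"
  proof -
    have "finite (UNIV - K)" "(UNIV - K) \<inter> K = {}" "K \<union> (UNIV - K) = UNIV"
      by auto
    then show thesis
      using that prime_ideal_lift[of "UNIV - K" K J h] J Suc.prems(2) by metis
  qed
  have "q \<noteq> (\<lambda>s. 0)"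
    using q(2) prime_ideal.zero[OF J(1)] by auto
  then obtain s0 where s0: "q s0 \<noteq> 0"
    by auto
  obtain i where i: "i \<in> K"
    using Suc.prems(4) by (metis card.empty ex_in_conv nat.distinct(1))
  \<comment> \<open>Taking the hyperplane through a point \<open>s0\<close> with
    \<open>q s0 \<noteq> 0\<close> ensures that \<open>q\<close> does not vanish identically on
    it.\<close>
  define c where "c = s0 i"
  define l where "l = (\<lambda>s :: 'v \<Rightarrow> 'a. s i - c)"
  have l: "l \<in> polys K"
    unfolding l_def by (intro polys_diff polys_var polys_const i)
  have "l (\<lambda>_. c + 1) \<noteq> 0"
    by (simp add: l_def)
  then have "l \<notin> J"
    using JK[OF l] by auto
  have lU: "l \<in> polys UNIV"
    using l by (rule polys_mono) simp
  have "indep_on {s. (\<forall>f\<in>insert l J. f s = 0) \<and> h s \<noteq> 0} (K - {i})"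
    unfolding indep_on_def
  proof (intro ballI impI)
    fix w assume w: "w \<in> polys (K - {i})" "\<forall>s\<in>{s. (\<forall>f\<in>insert l J. f s = 0) \<and> h s \<noteq> 0}. w s = 0"
    \<comment> \<open>The point moved onto the hyperplane lifts to a zero of \<open>J\<close> with
      \<open>h \<noteq> 0\<close> wherever \<open>q\<close> is non-zero. Moving and lifting do not
      affect \<open>w\<close>, which involves only the coordinates in
      \<open>K - {i}\<close>.\<close>
    have "w s * q (s(i := c)) = 0" for s
    proof (cases "q (s(i := c)) = 0")
      case False
      have "g (s(i := c)) = 0" if "g \<in> J \<inter> polys K" for g
        using JK[of g] that by simp
      then obtain s' where s': "\<forall>v\<in>K. s' v = (s(i := c)) v" "\<forall>g\<in>J. g s' = 0" "h s' \<noteq> 0"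
        using lift[OF False] by blast
      have "l s' = 0"
        using s'(1) i by (simp add: l_def)
      then have "w s' = 0"
        using w(2) s' by auto
      moreover have "w s = w s'"
        by (rule polys_cong[OF w(1)]) (use s'(1) in auto)
      ultimately show ?thesis
        by simp
    qed simp
    moreover have "(\<lambda>s. q (s(i := c))) \<in> polys UNIV"
    proof -
      have "(\<lambda>s. q (\<lambda>v. if v = i then c else s v)) \<in> polys UNIV"
      proof (rule polys_subst[OF q(1), where \<sigma> = "\<lambda>v s. if v = i then c else s v"])
        show "(\<lambda>s. if v = i then c else s v) \<in> polys UNIV" for v
          by (cases "v = i") (auto intro: polys_const polys_var)
      qed
      then show ?thesis
        by (simp add: fun_upd_def)
    qed
    moreover have "w \<in> polys UNIV"
      using w(1) by (rule polys_mono) simp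
    ultimately have "w = (\<lambda>s. 0) \<or> (\<lambda>s. q (s(i := c))) = (\<lambda>s. 0)"
      by (intro polys_no_zero_divisors)
    moreover have "s0(i := c) = s0"
      by (simp add: c_def)
    then have "(\<lambda>s. q (s(i := c))) \<noteq> (\<lambda>s. 0)"
      using s0 by (metis (full_types))
    ultimately show "w = (\<lambda>s. 0)"
      by blast
  qed
  moreover have "card (K - {i}) = n"
    using i Suc.prems(4) by simp
  moreover have "insert l J \<subseteq> polys UNIV"
    using lU Jsub by simp
  ultimately have "\<exists>Z Q. irr_chain Z n \<and> (\<forall>i\<le>n. insert l J \<subseteq> Q i \<and> Q i \<subseteq> polys UNIV \<and>
    Z i = {s. (\<forall>f\<in>Q i. f s = 0) \<and> h s \<noteq> 0})"
    by (intro Suc.IH Suc.prems(2))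
  then obtain Z Q where Z: "irr_chain Z n" and Q: "\<forall>i\<le>n. insert l J \<subseteq> Q i \<and> Q i \<subseteq> polys UNIV \<and>
    Z i = {s. (\<forall>f\<in>Q i. f s = 0) \<and> h s \<noteq> 0}"
    by (elim exE conjE)
  define Z' where "Z' = Z(Suc n := ZJ)"
  define Q' where "Q' = Q(Suc n := J)"
  have "Z n \<subseteq> ZJ" "\<forall>s\<in>Z n. l s = 0"
    using spec[OF Q, of n] by (auto simp: ZJ_def)
  moreover have "\<exists>s\<in>ZJ. l s \<noteq> 0"
    by (rule nz[OF lU \<open>l \<notin> J\<close>])
  ultimately have last: "Z n \<subseteq> ZJ \<and> (\<exists>g\<in>polys UNIV. (\<forall>s\<in>Z n. g s = 0) \<and> (\<exists>s\<in>ZJ. g s \<noteq> 0))"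
    using lU by blast
  have "irr_chain Z' (Suc n)"
    using Z irr last unfolding irr_chain_def Z'_def by (auto simp: le_Suc_eq less_Suc_eq)
  moreover have "P \<subseteq> Q' i \<and> Q' i \<subseteq> polys UNIV \<and> Z' i = {s. (\<forall>f\<in>Q' i. f s = 0) \<and> h s \<noteq> 0}"
    if "i \<le> Suc n" for i
  proof (cases "i = Suc n")
    case True
    then show ?thesis
      using J(2) Jsub by (simp add: Z'_def Q'_def ZJ_def)
  next
    case False
    then show ?thesis
      using spec[OF Q, of i] that J(2) by (auto simp: Z'_def Q'_def le_Suc_eq)
  qed
  ultimately show ?case
    by blast
qed

section \<open>Chains of sets closed in a given set\<close>

definition has_chain :: "('v \<Rightarrow> 'a::field) set \<Rightarrow> nat \<Rightarrow> bool" where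
  "has_chain S n \<longleftrightarrow>
     (\<exists>Z. irr_chain Z n \<and> (\<forall>i\<le>n. \<exists>Q\<subseteq>polys UNIV. Z i = {s \<in> S. \<forall>f\<in>Q. f s = 0}))"

lemma has_chainI:
  assumes "irr_chain Z n" "\<And>i. i \<le> n \<Longrightarrow> Q i \<subseteq> polys UNIV"
    "\<And>i. i \<le> n \<Longrightarrow> Z i = {s \<in> S. \<forall>f\<in>Q i. f s = 0}"
  shows "has_chain S n"
  unfolding has_chain_def
proof (intro exI[of _ Z] conjI allI impI assms(1))
  show "\<exists>Q\<subseteq>polys UNIV. Z i = {s \<in> S. \<forall>f\<in>Q. f s = 0}" if "i \<le> n" for i
    using assms(2,3)[OF that] by (intro exI[of _ "Q i"] conjI)
qed

lemma has_chainE: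
  assumes "has_chain S n"
  obtains Z Q where "irr_chain Z n" "\<And>i. i \<le> n \<Longrightarrow> Q i \<subseteq> polys UNIV"
    "\<And>i. i \<le> n \<Longrightarrow> Z i = {s \<in> S. \<forall>f\<in>Q i. f s = 0}"
proof -
  obtain Z where Z: "irr_chain Z n"
    and ex: "\<forall>i\<le>n. \<exists>Q\<subseteq>polys UNIV. Z i = {s \<in> S. \<forall>f\<in>Q. f s = 0}"
    using assms[unfolded has_chain_def] by (elim exE conjE)
  have "\<forall>i. \<exists>Q. i \<le> n \<longrightarrow> Q \<subseteq> polys UNIV \<and> Z i = {s \<in> S. \<forall>f\<in>Q. f s = 0}"
    using ex by simp
  from choice[OF this] obtain Q
    where Q: "\<forall>i. i \<le> n \<longrightarrow> Q i \<subseteq> polys UNIV \<and> Z i = {s \<in> S. \<forall>f\<in>Q i. f s = 0}"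
    by (elim exE)
  show thesis
    by (rule that[OF Z]) (use Q in auto)
qed

lemma has_chain_irr_chain:
  assumes "has_chain S n"
  obtains Z where "irr_chain Z n" "Z n \<subseteq> S"
proof -
  obtain Z Q where Z: "irr_chain Z n" and "\<And>i. i \<le> n \<Longrightarrow> Q i \<subseteq> polys UNIV"
    and Q: "\<And>i. i \<le> n \<Longrightarrow> Z i = {s \<in> S. \<forall>f\<in>Q i. f s = 0}"
    using assms by (rule has_chainE) blast
  show thesis
    by (rule that[OF Z]) (use Q in auto)
qed

text \<open>Each member is replaced by its closure in \<open>S\<close>. The same polynomials vanish
  on the closure, so irreducibility and the separating polynomials carry over.\<close>

lemma has_chain_mono:
  assumes "has_chain Y n" "Y \<subseteq> S"
  shows "has_chain S n"
proof -
  obtain Z Q where Z: "irr_chain Z n" and "\<And>i. i \<le> n \<Longrightarrow> Q i \<subseteq> polys UNIV"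
    and Q: "\<And>i. i \<le> n \<Longrightarrow> Z i = {s \<in> Y. \<forall>f\<in>Q i. f s = 0}"
    using assms(1) by (rule has_chainE) blast
  define I where "I i = {f \<in> polys UNIV. \<forall>s\<in>Z i. f s = 0}" for i
  define Z' where "Z' i = {s \<in> S. \<forall>f\<in>I i. f s = 0}" for i
  have sub: "Z i \<subseteq> Z' i" if "i \<le> n" for i
    using Q[OF that] assms(2) by (auto simp: Z'_def I_def)
  have van: "f s = 0" if "f \<in> polys UNIV" "\<And>s. s \<in> Z i \<Longrightarrow> f s = 0" "s \<in> Z' i" for f s i
    using that by (auto simp: Z'_def I_def)
  have "irr (Z' i)" if "i \<le> n" for i
    unfolding irr_def
  proof (intro conjI ballI impI)
    have irr: "irr (Z i)"
      using Z that by (simp add: irr_chain_def)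
    then show "Z' i \<noteq> {}"
      using sub[OF that] by (auto simp: irr_def)
    fix f g assume fg: "f \<in> polys UNIV" "g \<in> polys UNIV" "\<forall>s\<in>Z' i. f s * g s = 0"
    have "(\<forall>s\<in>Z i. f s = 0) \<or> (\<forall>s\<in>Z i. g s = 0)"
      by (rule irrD[OF irr fg(1,2)]) (use fg(3) sub[OF that] in blast)
    then show "(\<forall>s\<in>Z' i. f s = 0) \<or> (\<forall>s\<in>Z' i. g s = 0)"
      using van fg(1,2) by blast
  qed
  moreover have "Z' i \<subseteq> Z' (Suc i) \<and>
      (\<exists>g\<in>polys UNIV. (\<forall>s\<in>Z' i. g s = 0) \<and> (\<exists>s\<in>Z' (Suc i). g s \<noteq> 0))" if "i < n" for i
  proof -
    have "Z i \<subseteq> Z (Suc i)"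
      and "\<exists>g\<in>polys UNIV. (\<forall>s\<in>Z i. g s = 0) \<and> (\<exists>s\<in>Z (Suc i). g s \<noteq> 0)"
      using Z that by (auto simp: irr_chain_def)
    then obtain g where g: "g \<in> polys UNIV" "\<forall>s\<in>Z i. g s = 0" "\<exists>s\<in>Z (Suc i). g s \<noteq> 0"
      by blast
    have "\<forall>s\<in>Z' i. g s = 0"
      using van g(1,2) by blast
    moreover have "\<exists>s\<in>Z' (Suc i). g s \<noteq> 0"
      using g(3) sub[of "Suc i"] that by auto
    moreover have "Z' i \<subseteq> Z' (Suc i)"
      using \<open>Z i \<subseteq> Z (Suc i)\<close> by (auto simp: Z'_def I_def)
    ultimately show ?thesis
      using g(1) by blast
  qed
  ultimately have "irr_chain Z' n"
    by (simp add: irr_chain_def)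
  moreover have "\<exists>Q\<subseteq>polys UNIV. Z' i = {s \<in> S. \<forall>f\<in>Q. f s = 0}" for i
    unfolding Z'_def by (rule exI[of _ "I i"]) (auto simp: I_def)
  ultimately show ?thesis
    unfolding has_chain_def by blast
qed

lemma has_chain_locally_closed:
  fixes h :: "('v::finite \<Rightarrow> 'a::alg_closed_field) \<Rightarrow> 'a"
  assumes "P \<subseteq> polys UNIV" "h \<in> polys UNIV" "{s. (\<forall>f\<in>P. f s = 0) \<and> h s \<noteq> 0} \<subseteq> S"
    and "indep_on {s. (\<forall>f\<in>P. f s = 0) \<and> h s \<noteq> 0} K"
  shows "has_chain S (card K)"
proof -
  define S' where "S' = {s. (\<forall>f\<in>P. f s = 0) \<and> h s \<noteq> 0}"
  obtain Z Q where Z: "irr_chain Z (card K)" and Q: "\<forall>i\<le>card K. P \<subseteq> Q i \<and> Q i \<subseteq> polys UNIV \<and>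
    Z i = {s. (\<forall>f\<in>Q i. f s = 0) \<and> h s \<noteq> 0}"
    using irr_chain_exists[OF assms(1,2,4) refl] by (elim exE conjE)
  have "\<exists>Q\<subseteq>polys UNIV. Z i = {s \<in> S'. \<forall>f\<in>Q. f s = 0}" if "i \<le> card K" for i
    using spec[OF Q, of i] that by (intro exI[of _ "Q i"]) (auto simp: S'_def)
  then have "has_chain S' (card K)"
    unfolding has_chain_def using Z by blast
  then show ?thesis
    by (rule has_chain_mono) (use assms(3) in \<open>simp add: S'_def\<close>)
qed

section \<open>Comparison with the Zariski topology\<close>

lemma mpoly_eval_polys:
  fixes p :: "('n::finite, 'a::comm_ring_1) mpoly"
  shows "(\<lambda>s. mpoly_eval p (vec_lambda s)) \<in> polys UNIV"
  unfolding mpoly_eval_def mon_eval_def vec_lambda_beta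
  by (intro polys_sum polys_mult polys_prod polys_power polys_const polys_var) auto

lemma polys_mpoly_eval:
  fixes f :: "('n::finite \<Rightarrow> 'a::comm_ring_1) \<Rightarrow> 'a"
  assumes "f \<in> polys UNIV"
  shows "\<exists>p. \<forall>v. f (vec_nth v) = mpoly_eval p v"
  using assms
proof (induction rule: polys_induct)
  case (const c)
  then show ?case
    by (intro exI[of _ "Poly_Mapping.single 0 c"]) (simp add: mpoly_eval_single)
next
  case (var i)
  have "mon_eval (Poly_Mapping.single i 1) v = v $ i" for v :: "'a ^ 'n"
    by (simp add: mon_eval_def lookup_single when_def if_distrib[of "\<lambda>k. _ ^ k"] cong: if_cong)
  then show ?case
    by (intro exI[of _ "Poly_Mapping.single (Poly_Mapping.single i 1) 1"])
      (simp add: mpoly_eval_single)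
next
  case (add f g)
  then show ?case by (metis mpoly_eval_add)
next
  case (mult f g)
  then show ?case by (metis mpoly_eval_mult)
qed

lemma closedin_zariski_polys:
  fixes C :: "('a::field ^ 'n::finite) set"
  shows "closedin zariski C \<longleftrightarrow> (\<exists>Q\<subseteq>polys UNIV. C = {v. \<forall>f\<in>Q. f (vec_nth v) = 0})"
  unfolding closedin_zariski
proof
  assume "\<exists>P. C = zero_locus P"
  then obtain P :: "('n, 'a) mpoly set" where "C = zero_locus P"
    by blast
  then have "C = {v. \<forall>f\<in>(\<lambda>p s. mpoly_eval p (vec_lambda s)) ` P. f (vec_nth v) = 0}"
    by (auto simp: zero_locus_def vec_nth_inverse)
  moreover have "(\<lambda>p s. mpoly_eval p (vec_lambda s)) ` P \<subseteq> polys UNIV"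
    by (intro image_subsetI mpoly_eval_polys)
  ultimately show "\<exists>Q\<subseteq>polys UNIV. C = {v. \<forall>f\<in>Q. f (vec_nth v) = 0}"
    by (intro exI conjI)
next
  assume "\<exists>Q\<subseteq>polys UNIV. C = {v. \<forall>f\<in>Q. f (vec_nth v) = 0}"
  then obtain Q where Q: "Q \<subseteq> polys UNIV" "C = {v. \<forall>f\<in>Q. f (vec_nth v) = 0}"
    by blast
  then have "\<forall>f. \<exists>p. f \<in> Q \<longrightarrow> (\<forall>v. f (vec_nth v) = mpoly_eval p v)"
    using polys_mpoly_eval by auto
  from choice[OF this] obtain m :: "(('n \<Rightarrow> 'a) \<Rightarrow> 'a) \<Rightarrow> ('n, 'a) mpoly"
    where m: "\<forall>f. f \<in> Q \<longrightarrow> (\<forall>v. f (vec_nth v) = mpoly_eval (m f) v)"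
    by (elim exE)
  have "C = zero_locus (m ` Q)"
    using m by (auto simp: zero_locus_def Q(2))
  then show "\<exists>P. C = zero_locus P"
    by blast
qed

lemma closedin_subtopology_zariski:
  fixes S :: "('a::field ^ 'n::finite) set"
  shows "closedin (subtopology zariski S) C \<longleftrightarrow>
    (\<exists>Q\<subseteq>polys UNIV. C = {v \<in> S. \<forall>f\<in>Q. f (vec_nth v) = 0})"
proof
  assume "closedin (subtopology zariski S) C"
  then obtain T where T: "closedin zariski T" "C = T \<inter> S"
    unfolding closedin_subtopology by (elim exE conjE)
  from T(1) obtain Q where "Q \<subseteq> polys UNIV" "T = {v. \<forall>f\<in>Q. f (vec_nth v) = 0}"
    unfolding closedin_zariski_polys by (elim exE conjE)
  then show "\<exists>Q\<subseteq>polys UNIV. C = {v \<in> S. \<forall>f\<in>Q. f (vec_nth v) = 0}"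
    unfolding T(2) by (intro exI[of _ Q]) auto
next
  assume "\<exists>Q\<subseteq>polys UNIV. C = {v \<in> S. \<forall>f\<in>Q. f (vec_nth v) = 0}"
  then obtain Q where Q: "Q \<subseteq> polys UNIV" "C = {v \<in> S. \<forall>f\<in>Q. f (vec_nth v) = 0}"
    by (elim exE conjE)
  have "closedin zariski {v. \<forall>f\<in>Q. f (vec_nth v) = 0}"
    unfolding closedin_zariski_polys using Q(1) by (intro exI[of _ Q]) simp
  then show "closedin (subtopology zariski S) C"
    unfolding closedin_subtopology Q(2)
    by (intro exI[of _ "{v. \<forall>f\<in>Q. f (vec_nth v) = 0}"]) auto
qed

lemma irreducible_space_zariski:
  fixes W :: "('a::field ^ 'n::finite) set"
  shows "irreducible_space (subtopology zariski W) \<longleftrightarrow> irr (vec_nth ` W)"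
proof
  assume W: "irreducible_space (subtopology zariski W)"
  show "irr (vec_nth ` W)"
    unfolding irr_def
  proof (intro conjI ballI impI)
    show "vec_nth ` W \<noteq> {}"
      using W by (simp add: irreducible_space_def)
    fix f g :: "('n \<Rightarrow> 'a) \<Rightarrow> 'a"
    assume fg: "f \<in> polys UNIV" "g \<in> polys UNIV" "\<forall>s\<in>vec_nth ` W. f s * g s = 0"
    have closed: "closedin (subtopology zariski W) {v \<in> W. h (vec_nth v) = 0}"
      if "h \<in> polys UNIV" for h
      unfolding closedin_subtopology_zariski using that by (intro exI[of _ "{h}"]) auto
    have cover: "W = {v \<in> W. f (vec_nth v) = 0} \<union> {v \<in> W. g (vec_nth v) = 0}"
      using fg(3) by auto
    have split: "A = W \<or> B = W" if "closedin (subtopology zariski W) A"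
      "closedin (subtopology zariski W) B" "W = A \<union> B" for A B
      using W that(1,2) unfolding irreducible_space_def that(3) by simp
    have "{v \<in> W. f (vec_nth v) = 0} = W \<or> {v \<in> W. g (vec_nth v) = 0} = W"
      by (rule split[OF closed[OF fg(1)] closed[OF fg(2)] cover])
    then show "(\<forall>s\<in>vec_nth ` W. f s = 0) \<or> (\<forall>s\<in>vec_nth ` W. g s = 0)"
      by blast
  qed
next
  assume W: "irr (vec_nth ` W)"
  show "irreducible_space (subtopology zariski W)"
    unfolding irreducible_space_def
  proof (intro conjI allI impI)
    show "topspace (subtopology zariski W) \<noteq> {}"
      using W by (simp add: irr_def)
    fix A B
    assume AB: "closedin (subtopology zariski W) A \<and> closedin (subtopology zariski W) B \<and>
      topspace (subtopology zariski W) = A \<union> B"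
    obtain P where P: "P \<subseteq> polys UNIV" "A = {v \<in> W. \<forall>f\<in>P. f (vec_nth v) = 0}"
      using AB unfolding closedin_subtopology_zariski by blast
    obtain Q where Q: "Q \<subseteq> polys UNIV" "B = {v \<in> W. \<forall>f\<in>Q. f (vec_nth v) = 0}"
      using AB unfolding closedin_subtopology_zariski by blast
    have "A = W \<or> B = W"
    proof (rule ccontr)
      assume "\<not> ?thesis"
      then obtain f g where f: "f \<in> P" "\<exists>v\<in>W. f (vec_nth v) \<noteq> 0"
        and g: "g \<in> Q" "\<exists>v\<in>W. g (vec_nth v) \<noteq> 0"
        unfolding P(2) Q(2) by blast
      have "f s * g s = 0" if "s \<in> vec_nth ` W" for s
        using AB that f(1) g(1) unfolding P(2) Q(2) by auto
      then have "(\<forall>s\<in>vec_nth ` W. f s = 0) \<or> (\<forall>s\<in>vec_nth ` W. g s = 0)"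
        using irrD[OF W, of f UNIV g UNIV] f(1) g(1) P(1) Q(1) by blast
      then show False
        using f(2) g(2) by auto
    qed
    then show "A = topspace (subtopology zariski W) \<or> B = topspace (subtopology zariski W)"
      by simp
  qed
qed

text \<open>For members closed in \<open>S\<close>, strict inclusion and separation by a polynomial
  amount to the same: a point of \<open>Z (Suc i)\<close> outside \<open>Z i\<close> violates one of
  the polynomials defining \<open>Z i\<close>.\<close>

lemma zdim_eq_has_chain:
  fixes S :: "('a::field ^ 'n::finite) set"
  shows "zdim S = (SUP n\<in>{n. has_chain (vec_nth ` S) n}. ereal (real n))"
proof -
  have "(\<exists>Z. (\<forall>i\<le>n. closedin (subtopology zariski S) (Z i) \<and>
      irreducible_space (subtopology (subtopology zariski S) (Z i))) \<and> (\<forall>i<n. Z i \<subset> Z (Suc i)))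
    \<longleftrightarrow> has_chain (vec_nth ` S) n" (is "?L \<longleftrightarrow> _") for n
  proof
    assume ?L
    then obtain Z where Z: "\<forall>i\<le>n. closedin (subtopology zariski S) (Z i) \<and>
      irreducible_space (subtopology (subtopology zariski S) (Z i))" "\<forall>i<n. Z i \<subset> Z (Suc i)"
      by (elim exE conjE)
    have "\<forall>i. \<exists>Q. i \<le> n \<longrightarrow> Q \<subseteq> polys UNIV \<and> Z i = {v \<in> S. \<forall>f\<in>Q. f (vec_nth v) = 0}"
      using Z(1) by (simp add: closedin_subtopology_zariski)
    from choice[OF this] obtain Q
      where "\<forall>i. i \<le> n \<longrightarrow> Q i \<subseteq> polys UNIV \<and> Z i = {v \<in> S. \<forall>f\<in>Q i. f (vec_nth v) = 0}"
      by (elim exE)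
    then have Q: "Q i \<subseteq> polys UNIV" "Z i = {v \<in> S. \<forall>f\<in>Q i. f (vec_nth v) = 0}" if "i \<le> n" for i
      using that by simp_all
    have "irr (vec_nth ` Z i)" if "i \<le> n" for i
    proof -
      have "S \<inter> Z i = Z i"
        using Q(2)[OF that] by auto
      moreover have "irreducible_space (subtopology (subtopology zariski S) (Z i))"
        using Z(1) that by simp
      ultimately show ?thesis
        by (simp only: subtopology_subtopology irreducible_space_zariski)
    qed
    moreover have "vec_nth ` Z i \<subseteq> vec_nth ` Z (Suc i) \<and> (\<exists>g\<in>polys UNIV.
        (\<forall>s\<in>vec_nth ` Z i. g s = 0) \<and> (\<exists>s\<in>vec_nth ` Z (Suc i). g s \<noteq> 0))" if "i < n" for i
    proof -
      have Zi: "Z i \<subset> Z (Suc i)"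
        using Z(2) that by simp
      then obtain v where v: "v \<in> Z (Suc i)" "v \<notin> Z i"
        by blast
      then have "v \<in> S"
        using Q(2)[of "Suc i"] that by simp
      then obtain g where "g \<in> Q i" "g (vec_nth v) \<noteq> 0"
        using v(2) Q(2)[OF less_imp_le[OF \<open>i < n\<close>]] by auto
      then show ?thesis
        using Zi v(1) Q[of i] that by (intro conjI bexI[of _ g]) auto
    qed
    ultimately have "irr_chain (\<lambda>i. vec_nth ` Z i) n"
      by (simp add: irr_chain_def)
    then show "has_chain (vec_nth ` S) n"
    proof (rule has_chainI)
      show "Q i \<subseteq> polys UNIV" if "i \<le> n" for i
        by (rule Q(1)[OF that])
      show "vec_nth ` Z i = {s \<in> vec_nth ` S. \<forall>f\<in>Q i. f s = 0}" if "i \<le> n" for i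
        using Q(2)[OF that] by auto
    qed
  next
    assume "has_chain (vec_nth ` S) n"
    obtain Z Q where Z: "irr_chain Z n" and Q: "\<And>i. i \<le> n \<Longrightarrow> Q i \<subseteq> polys UNIV"
      "\<And>i. i \<le> n \<Longrightarrow> Z i = {s \<in> vec_nth ` S. \<forall>f\<in>Q i. f s = 0}"
      using \<open>has_chain (vec_nth ` S) n\<close> by (rule has_chainE) blast
    define Z' where "Z' i = {v \<in> S. vec_nth v \<in> Z i}" for i
    have img: "vec_nth ` Z' i = Z i" if "i \<le> n" for i
      using Q(2)[OF that] by (auto simp: Z'_def)
    have "closedin (subtopology zariski S) (Z' i)" if "i \<le> n" for i
      unfolding closedin_subtopology_zariski using Q(1)[OF that]
      by (intro exI[of _ "Q i"]) (auto simp: Z'_def Q(2)[OF that])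
    moreover have "irreducible_space (subtopology (subtopology zariski S) (Z' i))" if "i \<le> n" for i
    proof -
      have "S \<inter> Z' i = Z' i"
        by (auto simp: Z'_def)
      moreover have "irr (vec_nth ` Z' i)"
        using Z that by (simp add: img irr_chain_def)
      ultimately show ?thesis
        by (simp only: subtopology_subtopology irreducible_space_zariski)
    qed
    moreover have "Z' i \<subset> Z' (Suc i)" if "i < n" for i
    proof -
      have "Z i \<subset> Z (Suc i)"
        using Z that unfolding irr_chain_def by blast
      moreover have "vec_nth ` Z' i = Z i" "vec_nth ` Z' (Suc i) = Z (Suc i)"
        using img that by simp_all
      ultimately have "Z' i \<noteq> Z' (Suc i)"
        by force
      moreover have "Z' i \<subseteq> Z' (Suc i)"
        using \<open>Z i \<subset> Z (Suc i)\<close> unfolding Z'_def by blast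
      ultimately show ?thesis
        by blast
    qed
    ultimately show ?L
      by (intro exI[of _ Z'] conjI allI impI)
  qed
  then show ?thesis
    by (simp add: zdim_def krull_dim_def)
qed

section \<open>Kernels of matrices with polynomial entries\<close>

text \<open>
  The left kernel of \<open>M\<close> is the set of all \<open>y\<close> with \<open>(\<Sum>j. y $ j *s M $ j) = 0\<close>.  The square
  matrix \<open>bordered G R M\<close> maps \<open>y\<close> to the \<open>R\<close>-coordinates of \<open>G\<close> applied to this sum and
  to the coordinates of \<open>y\<close> outside \<open>R\<close>.
\<close>

definition bordered :: "'a::field ^ 'c ^ 'b \<Rightarrow> 'b set \<Rightarrow> 'a ^ 'c ^ 'b \<Rightarrow> 'a ^ 'b ^ 'b" where
  "bordered G R M = (\<chi> l j. if l \<in> R then (G *v (M $ j)) $ l else if l = j then 1 else 0)"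

lemma bordered_mult:
  "(bordered G R M *v y) $ l = (if l \<in> R then (G *v (\<Sum>j\<in>UNIV. y $ j *s M $ j)) $ l else y $ l)"
proof (cases "l \<in> R")
  case True
  then show ?thesis
    by (simp add: bordered_def matrix_vector_mult_def[of "\<chi> l j. _ l j"] vec.sum vec.scale mult.commute)
next
  case False
  then show ?thesis
    by (simp add: bordered_def matrix_vector_mult_def if_distrib[of "\<lambda>x. x * _"] cong: if_cong)
qed

lemma det_nonzero_iff_ker: "det (A :: 'a::field ^ 'b ^ 'b) \<noteq> 0 \<longleftrightarrow> (\<forall>y. A *v y = 0 \<longrightarrow> y = 0)"
  using invertible_det_nz[of A] invertible_left_inverse[of A] matrix_left_invertible_ker[of A] by simp

text \<open>\<open>R\<close> indexes a basis of the row space and \<open>G\<close> sends the basis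
  row with index \<open>j\<close> to the unit vector \<open>axis j 1\<close>, so \<open>G\<close>
  reads off the coefficients of a combination of basis rows. Filling up with unit rows makes the
  matrix square over \<open>'b\<close>, so that determinants apply without forming
  submatrices.\<close>

lemma bordered_exists:
  fixes M :: "'a::field ^ 'c ^ 'b"
  obtains G R where "card R = rank M" "det (bordered G R M) \<noteq> 0"
proof -
  have rows: "rows M = range (\<lambda>j. M $ j)"
    by (auto simp: rows_def row_def vec_eq_iff)
  obtain B where B: "B \<subseteq> rows M" "vec.independent B" "card B = vec.dim (rows M)"
    using vec.basis_exists[of "rows M"] by metis
  define r where "r b = (SOME j. M $ j = b)" for b
  have Mr: "M $ r b = b" if "b \<in> B" for b
    unfolding r_def by (rule someI_ex) (use that B(1) rows in auto)
  have inj: "inj_on r B"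
    by (rule inj_onI) (metis Mr)
  define R where "R = r ` B"
  obtain g where g: "Vector_Spaces.linear (*s) (*s) g" "\<And>b. b \<in> B \<Longrightarrow> g b = (axis (r b) 1 :: 'a ^ 'b)"
    using vec.linear_independent_extend[OF B(2), of "\<lambda>b. axis (r b) 1"] by blast
  define G where "G = matrix g"
  have G: "G *v (M $ j) = axis j 1" if "j \<in> R" for j
    using that g(2) Mr unfolding G_def matrix_works[OF g(1)] R_def by auto
  have "y = 0" if y: "bordered G R M *v y = 0" for y
  proof -
    have y0: "y $ l = 0" if "l \<notin> R" for l
      using bordered_mult[of G R M y l] that y by simp
    have "(\<Sum>j\<in>UNIV. y $ j *s M $ j) = (\<Sum>j\<in>R. y $ j *s M $ j)"
      by (rule sum.mono_neutral_right) (auto simp: y0)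
    then have "G *v (\<Sum>j\<in>UNIV. y $ j *s M $ j) = (\<Sum>j\<in>R. y $ j *s axis j 1)"
      by (simp add: vec.sum vec.scale G)
    then have "y $ l = 0" if "l \<in> R" for l
      using bordered_mult[of G R M y l] that y
      by (simp add: axis_def if_distrib[of "\<lambda>x. _ * x"] cong: if_cong)
    with y0 show "y = 0"
      by (auto simp: vec_eq_iff)
  qed
  then have "det (bordered G R M) \<noteq> 0"
    by (simp add: det_nonzero_iff_ker)
  moreover have "card R = rank M"
    using card_image[OF inj] B(3) by (simp add: R_def row_rank_def_gen)
  ultimately show thesis
    using that by blast
qed

lemma bordered_rows_combination:
  fixes M :: "'a::field ^ 'c ^ 'b"
  assumes det: "det (bordered G R M) \<noteq> 0"
    and c: "\<And>l. l \<in> R \<Longrightarrow> (G *v (\<Sum>j\<in>R. c j *s M $ j)) $ l = 0" and j: "j \<in> R"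
  shows "c j = 0"
proof -
  define y where "y = (\<chi> j. if j \<in> R then c j else 0)"
  have "(\<Sum>j\<in>UNIV. y $ j *s M $ j) = (\<Sum>j\<in>R. c j *s M $ j)"
    by (rule sum.mono_neutral_cong_right) (auto simp: y_def)
  then have "(bordered G R M *v y) $ l = 0" for l
    unfolding bordered_mult using c by (simp add: y_def)
  then have "y = 0"
    using det by (simp add: det_nonzero_iff_ker vec_eq_iff)
  then have "y $ j = 0"
    by simp
  then show ?thesis
    using j by (simp add: y_def)
qed

lemma bordered_rows_independent:
  fixes M :: "'a::field ^ 'c ^ 'b"
  assumes det: "det (bordered G R M) \<noteq> 0"
  shows "inj_on (\<lambda>j. M $ j) R" "vec.independent ((\<lambda>j. M $ j) ` R)"
proof -
  have comb: "\<forall>j\<in>R. c j = 0" if "(\<Sum>j\<in>R. c j *s M $ j) = 0" for c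
    using bordered_rows_combination[OF det, of c] that by simp
  show inj: "inj_on (\<lambda>j. M $ j) R"
  proof (rule inj_onI, rule ccontr)
    fix i j assume ij: "i \<in> R" "j \<in> R" "M $ i = M $ j" "i \<noteq> j"
    define c where "c k = (if k = i then 1 else if k = j then -1 else 0 :: 'a)" for k
    have "(\<Sum>k\<in>R. c k *s M $ k) = (\<Sum>k\<in>{i, j}. c k *s M $ k)"
      by (rule sum.mono_neutral_right) (use ij in \<open>auto simp: c_def\<close>)
    also have "\<dots> = 0"
      using ij by (simp add: c_def)
    finally show False
      using comb[of c] ij(1) by (auto simp: c_def)
  qed
  show "vec.independent ((\<lambda>j. M $ j) ` R)"
  proof (rule vec.independent_if_scalars_zero)
    fix f x assume f: "(\<Sum>x\<in>(\<lambda>j. M $ j) ` R. f x *s x) = 0" "x \<in> (\<lambda>j. M $ j) ` R"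
    then have "(\<Sum>j\<in>R. f (M $ j) *s M $ j) = 0"
      by (simp add: sum.reindex[OF inj])
    then show "f x = 0"
      using comb[of "\<lambda>j. f (M $ j)"] f(2) by auto
  qed simp
qed

text \<open>Together with \<open>bordered_exists\<close> this lets the bordered determinants play
  the role of minors: the rank exceeds \<open>r\<close> exactly if one of them with
  \<open>card R > r\<close> is non-zero.\<close>

lemma bordered_rank:
  fixes M :: "'a::field ^ 'c ^ 'b"
  assumes "det (bordered G R M) \<noteq> 0"
  shows "card R \<le> rank M"
proof -
  have "(\<lambda>j. M $ j) ` R \<subseteq> rows M"
    by (auto simp: rows_def row_def)
  then have "card ((\<lambda>j. M $ j) ` R) \<le> rank M"
    unfolding row_rank_def_gen
    by (rule vec.independent_card_le_dim) (rule bordered_rows_independent[OF assms])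
  then show ?thesis
    by (simp add: card_image bordered_rows_independent[OF assms])
qed

text \<open>The bordered system is solved with 0 on \<open>R\<close> and the prescribed values
  elsewhere. As the rank is \<open>card R\<close>, the resulting combination of rows lies in the
  span of the rows in \<open>R\<close>; its \<open>R\<close>-coordinates under \<open>G\<close> are
  zero, and so it is zero.\<close>

lemma bordered_kernel_lift:
  fixes M :: "'a::field ^ 'c ^ 'b"
  assumes det: "det (bordered G R M) \<noteq> 0" and rank: "rank M = card R"
  shows "\<exists>y. (\<Sum>j\<in>UNIV. y $ j *s M $ j) = 0 \<and> (\<forall>l. l \<notin> R \<longrightarrow> y $ l = z l)"
proof -
  define b where "b = (\<chi> l. if l \<in> R then 0 else z l)"
  obtain B where "bordered G R M ** B = mat 1"
    using det invertible_det_nz[of "bordered G R M"] invertible_right_inverse by blast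
  then have Bb: "bordered G R M *v (B *v b) = b"
    by (simp add: matrix_vector_mul_assoc)
  define y where "y = B *v b"
  define m where "m = (\<Sum>j\<in>UNIV. y $ j *s M $ j)"
  have Gm: "(G *v m) $ l = 0" if "l \<in> R" for l
    using bordered_mult[of G R M y l] Bb that by (simp add: y_def m_def b_def)
  note indep = bordered_rows_independent[OF det]
  have "rows M \<subseteq> vec.span ((\<lambda>j. M $ j) ` R)"
  proof (rule vec.card_ge_dim_independent)
    show "vec.dim (rows M) \<le> card ((\<lambda>j. M $ j) ` R)"
      using rank by (simp add: card_image indep(1) row_rank_def_gen)
  qed (use indep in \<open>auto simp: rows_def row_def\<close>)
  moreover have "M $ j \<in> rows M" for j
    by (auto simp: rows_def row_def)
  ultimately have "m \<in> vec.span ((\<lambda>j. M $ j) ` R)"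
    unfolding m_def by (intro vec.span_sum vec.span_scale) auto
  then obtain u where "m = (\<Sum>v\<in>(\<lambda>j. M $ j) ` R. u v *s v)"
    by (auto simp: vec.span_finite)
  then have u: "m = (\<Sum>j\<in>R. u (M $ j) *s M $ j)"
    by (simp add: sum.reindex[OF indep(1)])
  have "u (M $ j) = 0" if "j \<in> R" for j
    using bordered_rows_combination[OF det, of "\<lambda>j. u (M $ j)" j] Gm that by (simp flip: u)
  then have "m = 0"
    by (simp add: u)
  moreover have "y $ l = z l" if "l \<notin> R" for l
    using bordered_mult[of G R M y l] Bb that by (simp add: y_def b_def)
  ultimately show ?thesis
    unfolding m_def by blast
qed

text \<open>A kernel vector solves the bordered system whose right-hand side contains only its
  coordinates outside \<open>R\<close>, so all of its coordinates are rational in these.\<close>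

lemma bordered_cramer:
  fixes M :: "'a::field ^ 'c ^ 'b"
  assumes "(\<Sum>j\<in>UNIV. y $ j *s M $ j) = 0"
  shows "det (bordered G R M) * y $ k =
    det (\<chi> l j. if j = k then (if l \<in> R then 0 else y $ l) else bordered G R M $ l $ j)"
proof -
  have "(bordered G R M *v y) $ l = (if l \<in> R then 0 else y $ l)" for l
    unfolding bordered_mult assms by simp
  then show ?thesis
    using cramer_lemma[of k "bordered G R M" y] by (simp add: mult.commute cong: if_cong)
qed

section \<open>Polynomial families of matrices\<close>

lemma polys_det:
  assumes "\<And>i j. (\<lambda>s. A s $ i $ j) \<in> polys U"
  shows "(\<lambda>s. det (A s)) \<in> polys U"
  unfolding det_def by (intro polys_sum polys_mult polys_const polys_prod assms)

lemma polys_bordered: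
  fixes M :: "('v \<Rightarrow> 'a::field) \<Rightarrow> 'a ^ 'c ^ 'b"
  assumes "\<And>j k. (\<lambda>s. M s $ j $ k) \<in> polys U"
  shows "(\<lambda>s. bordered G R (M s) $ l $ j) \<in> polys U"
proof (cases "l \<in> R")
  case True
  then show ?thesis
    by (simp add: bordered_def matrix_vector_mult_def polys_sum polys_mult polys_const assms)
next
  case False
  then show ?thesis
    by (simp add: bordered_def polys_const)
qed

text \<open>The coordinates \<open>Y l\<close> with \<open>l\<close> outside \<open>R\<close> are
  adjoined as free ones. By Cramer's rule every \<open>Y k\<close> satisfies an equation of degree
  one over them, with the bordered determinant as leading coefficient.\<close>

lemma growth_kernel:
  fixes M :: "('v \<Rightarrow> 'a::field) \<Rightarrow> 'a ^ 'c ^ 'b" and Y :: "'b \<Rightarrow> 'v"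
  assumes W: "irr W" "growth W X d" and Y: "inj Y"
    and M: "\<And>j k. (\<lambda>s. M s $ j $ k) \<in> polys X"
    and ker: "\<And>s. s \<in> W \<Longrightarrow> (\<Sum>j\<in>UNIV. s (Y j) *s M s $ j) = 0"
    and det: "\<exists>s\<in>W. det (bordered G R (M s)) \<noteq> 0"
  shows "growth W (X \<union> range Y) (d + card (- R))"
proof -
  let ?U = "X \<union> Y ` (- R)"
  have free: "growth W ?U (d + card (- R))"
    using growth_union_free[OF W(2), of "Y ` (- R)"] card_image[of Y "- R"] Y
    by (simp add: inj_on_subset)
  have MU: "(\<lambda>s. M s $ j $ k) \<in> polys ?U" for j k
    by (rule polys_mono[OF M]) simp
  have "growth W (?U \<union> range Y) (d + card (- R))"
  proof (rule growth_union_alg[OF W(1) free])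
    fix v assume "v \<in> range Y"
    then obtain k where k: "v = Y k"
      by blast
    define a where "a = (\<lambda>s. det (bordered G R (M s)))"
    define b where "b = (\<lambda>s :: 'v \<Rightarrow> 'a. det (\<chi> l j. if j = k then (if l \<in> R then 0 else s (Y l))
      else bordered G R (M s) $ l $ j))"
    have "a \<in> polys ?U"
      unfolding a_def by (intro polys_det polys_bordered MU)
    moreover have "b \<in> polys ?U"
      unfolding b_def
    proof (rule polys_det)
      fix l j
      show "(\<lambda>s. (\<chi> l j. if j = k then (if l \<in> R then 0 else s (Y l))
          else bordered G R (M s) $ l $ j) $ l $ j) \<in> polys ?U"
        using polys_bordered[where M = M, OF MU]
        by (cases "j = k"; cases "l \<in> R") (simp_all add: polys_const polys_var)
    qed
    moreover have "a s * s v ^ 1 = (\<Sum>i<1. b s * s v ^ i)" if "s \<in> W" for s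
      using bordered_cramer[of "\<chi> j. s (Y j)" "M s" G R k] ker[OF that]
      by (simp add: a_def b_def k cong: if_cong)
    ultimately show "\<exists>a b e. a \<in> polys ?U \<and> (\<exists>s\<in>W. a s \<noteq> 0) \<and> (\<forall>k. b k \<in> polys ?U) \<and>
        (\<forall>s\<in>W. a s * s v ^ e = (\<Sum>k<e. b k s * s v ^ k))"
      using det unfolding a_def[symmetric]
      by (intro exI[of _ a] exI[of _ "\<lambda>_. b"] exI[of _ 1] conjI ballI allI) (simp_all add: a_def)
  qed simp
  moreover have "?U \<union> range Y = X \<union> range Y"
    by auto
  ultimately show ?thesis
    by simp
qed

text \<open>The stratum contains the locally closed set where \<open>P\<close> vanishes, forcing
  rank at most \<open>r\<close>, and \<open>h\<close> does not, forcing rank at least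
  \<open>r\<close>. This set contains the part of \<open>W\<close> with \<open>h \<noteq> 0\<close>,
  which is dense in \<open>W\<close>, so \<open>I\<close> stays independent on it.\<close>

lemma has_chain_rank_stratum:
  fixes M :: "('v::finite \<Rightarrow> 'a::alg_closed_field) \<Rightarrow> 'a ^ 'c ^ 'b"
  assumes M: "\<And>j k. (\<lambda>s. M s $ j $ k) \<in> polys UNIV"
    and W: "irr W" "W \<subseteq> {s. rank (M s) = r}" "indep_on W I"
  shows "has_chain {s. rank (M s) = r} (card I)"
proof -
  obtain s0 where s0: "s0 \<in> W"
    using W(1) by (auto simp: irr_def)
  obtain G R where R: "card R = rank (M s0)" "det (bordered G R (M s0)) \<noteq> 0"
    by (rule bordered_exists)
  define h where "h = (\<lambda>s. det (bordered G R (M s)))"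
  have h: "h \<in> polys UNIV"
    unfolding h_def by (intro polys_det polys_bordered M)
  have cardR: "card R = r"
    using R(1) s0 W(2) by auto
  define P where "P = {f \<in> polys UNIV. \<forall>s. rank (M s) \<le> r \<longrightarrow> f s = 0}"
  have rank_le: "rank (M s) \<le> r" if s: "\<forall>f\<in>P. f s = 0" for s
  proof (rule ccontr)
    assume less: "\<not> rank (M s) \<le> r"
    obtain G' R' where R': "card R' = rank (M s)" "det (bordered G' R' (M s)) \<noteq> 0"
      by (rule bordered_exists)
    have "det (bordered G' R' (M t)) = 0" if "rank (M t) \<le> r" for t
      using bordered_rank[of G' R' "M t"] R'(1) less that by linarith
    moreover have "(\<lambda>s. det (bordered G' R' (M s))) \<in> polys UNIV"
      by (intro polys_det polys_bordered M)
    ultimately have "(\<lambda>s. det (bordered G' R' (M s))) \<in> P"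
      by (simp add: P_def)
    from bspec[OF s this] show False
      using R'(2) by simp
  qed
  show ?thesis
  proof (rule has_chain_locally_closed[OF _ h])
    show "P \<subseteq> polys UNIV"
      by (auto simp: P_def)
    show "{s. (\<forall>f\<in>P. f s = 0) \<and> h s \<noteq> 0} \<subseteq> {s. rank (M s) = r}"
    proof clarify
      fix s assume s: "\<forall>f\<in>P. f s = 0" "h s \<noteq> 0"
      show "rank (M s) = r"
        using rank_le[OF s(1)] bordered_rank[of G R "M s"] s(2) cardR by (simp add: h_def)
    qed
    show "indep_on {s. (\<forall>f\<in>P. f s = 0) \<and> h s \<noteq> 0} I"
      unfolding indep_on_def
    proof (intro ballI impI)
      fix w assume w: "w \<in> polys I" "\<forall>s\<in>{s. (\<forall>f\<in>P. f s = 0) \<and> h s \<noteq> 0}. w s = 0"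
      have "w s * h s = 0" if "s \<in> W" for s
        using w(2) that W(2) by (auto simp: P_def)
      then have "\<forall>s\<in>W. w s = 0"
        using irrD[OF W(1) w(1) h] s0 R(2) by (auto simp: h_def)
      then show "w = (\<lambda>s. 0)"
        using W(3) w(1) by (simp add: indep_on_def)
    qed
  qed
qed

lemma rank_le_rows: "rank (M :: 'a::field ^ 'c ^ 'b) \<le> CARD('b)"
proof -
  obtain G :: "'a ^ 'c ^ 'b" and R where "card R = rank M" "det (bordered G R M) \<noteq> 0"
    by (rule bordered_exists)
  then show ?thesis
    using card_mono[of UNIV R] by simp
qed

lemma card_Compl_finite:
  fixes R :: "'b::finite set"
  shows "card (- R) = CARD('b) - card R"
  by (simp add: Compl_eq_Diff_UNIV card_Diff_subset)

section \<open>Dimension of kernels and of families of kernels\<close>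

definition left_kernel :: "'a::field ^ 'c ^ 'b \<Rightarrow> ('b \<Rightarrow> 'a) set" where
  "left_kernel A = {y. (\<Sum>j\<in>UNIV. y j *s A $ j) = 0}"

text \<open>A constant matrix is a family without base variables: the growth exponent starts at 0
  and only the coordinates outside \<open>R\<close> add to it.\<close>

lemma has_chain_left_kernel_le:
  fixes A :: "'a::alg_closed_field ^ 'c ^ 'b"
  assumes "has_chain (left_kernel A) n"
  shows "n \<le> CARD('b) - rank A"
proof -
  obtain Z where Z: "irr_chain Z n" "Z n \<subseteq> left_kernel A"
    using assms by (rule has_chain_irr_chain)
  have irr: "irr (Z n)"
    using Z(1) by (simp add: irr_chain_def)
  obtain G R where R: "card R = rank A" "det (bordered G R A) \<noteq> 0"
    by (rule bordered_exists)
  have "growth (Z n) ({} \<union> range id) (0 + card (- R))"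
  proof (rule growth_kernel[where M = "\<lambda>_. A" and G = G])
    show "growth (Z n) {} 0"
      by (rule growth_empty) (use irr in \<open>simp add: irr_def\<close>)
    show "(\<Sum>j\<in>UNIV. s (id j) *s A $ j) = 0" if "s \<in> Z n" for s
      using Z(2) that by (auto simp: left_kernel_def)
    show "\<exists>s\<in>Z n. det (bordered G R A) \<noteq> 0"
      using irr R(2) by (auto simp: irr_def)
  qed (use irr polys_const in auto)
  then have "growth (Z n) UNIV (card (- R))"
    by simp
  then show ?thesis
    using irr_chain_le_growth[OF Z(1)] by (simp add: card_Compl_finite R(1))
qed

text \<open>The coordinates outside \<open>R\<close> can be prescribed arbitrarily on the kernel, so
  a polynomial in them that vanishes on the kernel is zero.\<close>

lemma has_chain_left_kernel:
  fixes A :: "'a::alg_closed_field ^ 'c ^ 'b"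
  shows "has_chain (left_kernel A) (CARD('b) - rank A)"
proof -
  obtain G R where R: "card R = rank A" "det (bordered G R A) \<noteq> 0"
    by (rule bordered_exists)
  define P where "P = range (\<lambda>k (s :: 'b \<Rightarrow> 'a). \<Sum>j\<in>UNIV. s j * A $ j $ k)"
  have zero: "{s. (\<forall>f\<in>P. f s = 0) \<and> (1 :: 'a) \<noteq> 0} = left_kernel A"
    by (auto simp: P_def left_kernel_def vec_eq_iff)
  have "has_chain (left_kernel A) (card (- R))"
  proof (rule has_chain_locally_closed[of P "\<lambda>_. 1"])
    show "P \<subseteq> polys UNIV"
      unfolding P_def by (intro image_subsetI polys_sum polys_mult polys_var polys_const) simp
    show "indep_on {s. (\<forall>f\<in>P. f s = 0) \<and> (1 :: 'a) \<noteq> 0} (- R)"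
      unfolding zero indep_on_def
    proof (intro ballI impI ext)
      fix w z assume w: "w \<in> polys (- R)" "\<forall>s\<in>left_kernel A. w s = 0"
      obtain y where y: "(\<Sum>j\<in>UNIV. y $ j *s A $ j) = 0" "\<forall>l. l \<notin> R \<longrightarrow> y $ l = z l"
        using bordered_kernel_lift[OF R(2) R(1)[symmetric]] by blast
      have "w z = w (vec_nth y)"
        by (rule polys_cong[OF w(1)]) (use y(2) in auto)
      then show "w z = 0"
        using w(2) y(1) by (simp add: left_kernel_def)
    qed
  qed (use zero polys_const in auto)
  then show ?thesis
    by (simp add: card_Compl_finite R(1))
qed

text \<open>This is the zero set of the tensor with \<open>T(x, \<cdot>, \<cdot>)\<close>
  generalised to any matrix depending on \<open>x\<close>; the coordinates of \<open>x\<close> and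
  \<open>y\<close> are the \<open>Inl\<close> and \<open>Inr\<close> parts.\<close>

definition kernel_family ::
    "(('n1 \<Rightarrow> 'a::field) \<Rightarrow> 'a ^ 'c ^ 'b) \<Rightarrow> ('n1 + 'b \<Rightarrow> 'a) set" where
  "kernel_family M = {s. (\<lambda>j. s (Inr j)) \<in> left_kernel (M (\<lambda>i. s (Inl i)))}"

lemma polys_Inl:
  assumes "w \<in> polys I"
  shows "(\<lambda>s. w (\<lambda>i. s (Inl i))) \<in> polys (Inl ` I)"
  by (rule polys_subst[OF assms, where \<sigma> = "\<lambda>i s. s (Inl i)"]) (auto intro: polys_var)

lemma polys_case_sum:
  fixes w :: "('n1 + 'b \<Rightarrow> 'a::field) \<Rightarrow> 'a"
  assumes "w \<in> polys (Inl ` I \<union> Inr ` UNIV)"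
  shows "(\<lambda>x. w (case_sum x z)) \<in> polys I"
proof -
  have "(\<lambda>x. w (\<lambda>v. case_sum x z v)) \<in> polys I"
    by (rule polys_subst[OF assms, where \<sigma> = "\<lambda>v x. case_sum x z v"])
      (auto intro: polys_var polys_const)
  then show ?thesis
    by simp
qed

text \<open>On a dense rank stratum \<open>W\<close> of the top member the growth exponent is the
  number of independent \<open>x\<close>-coordinates plus the corank. The independent functions of
  the chain restrict to \<open>W\<close> and give the bound on \<open>n\<close>; the independent
  \<open>x\<close>-coordinates stay independent on the projection of \<open>W\<close>, which lies in
  the stratum of rank \<open>r\<close>.\<close>

lemma has_chain_kernel_family_le:
  fixes M :: "('n1::finite \<Rightarrow> 'a::alg_closed_field) \<Rightarrow> 'a ^ 'c ^ 'b"
  assumes M: "\<And>j k. (\<lambda>x. M x $ j $ k) \<in> polys UNIV" and chain: "has_chain (kernel_family M) n"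
  shows "\<exists>r\<le>CARD('b). \<exists>m. has_chain {x. rank (M x) = r} m \<and> n \<le> m + (CARD('b) - r)"
proof -
  let ?p = "\<lambda>(s :: 'n1 + 'b \<Rightarrow> 'a) i. s (Inl i)"
  obtain Z where Z: "irr_chain Z n" "Z n \<subseteq> kernel_family M"
    using chain by (rule has_chain_irr_chain)
  have irrZ: "irr (Z n)"
    using Z(1) by (simp add: irr_chain_def)
  have cover: "Z n = (\<Union>r\<in>{..CARD('b)}. {s \<in> Z n. rank (M (?p s)) = r})"
    using rank_le_rows by auto
  obtain r where r: "r \<le> CARD('b)" and dense: "dense_in {s \<in> Z n. rank (M (?p s)) = r} (Z n)"
    using irr_dense_part[OF irrZ cover] by auto
  define W where "W = {s \<in> Z n. rank (M (?p s)) = r}"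
  have W: "irr W" "dense_in W (Z n)"
    using irr_dense_in[OF irrZ dense] dense by (simp_all add: W_def)
  \<comment> \<open>Maximality is asked for among the coordinates of \<open>x\<close> only; those of
    \<open>y\<close> are accounted for by the kernel.\<close>
  obtain I where I: "I \<subseteq> range Inl" "indep_on W I"
    "\<And>v. v \<in> range Inl - I \<Longrightarrow> \<not> indep_on W (insert v I)"
    by (rule maximal_indep_on[OF irr_imp_indep_empty[OF W(1)], of "range Inl"]) auto
  define I' where "I' = {i. Inl i \<in> I}"
  have I': "I = Inl ` I'"
    using I(1) by (auto simp: I'_def)
  obtain s0 where s0: "s0 \<in> W"
    using W(1) by (auto simp: irr_def)
  obtain G R where R: "card R = rank (M (?p s0))" "det (bordered G R (M (?p s0))) \<noteq> 0"
    by (rule bordered_exists)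
  have "growth W (range Inl \<union> range Inr) (card I + card (- R))"
  proof (rule growth_kernel[where M = "\<lambda>s. M (?p s)" and G = G])
    show "growth W (range Inl) (card I)"
      by (rule growth_maximal_indep[OF W(1) _ I]) auto
    show "(\<Sum>j\<in>UNIV. s (Inr j) *s M (?p s) $ j) = 0" if "s \<in> W" for s
      using Z(2) that by (auto simp: W_def kernel_family_def left_kernel_def)
    show "(\<lambda>s. M (?p s) $ j $ k) \<in> polys (range Inl)" for j k
      by (rule polys_Inl[OF M])
    show "\<exists>s\<in>W. det (bordered G R (M (?p s))) \<noteq> 0"
      using s0 R(2) by blast
  qed (use W in auto)
  then have growth: "growth W UNIV (card I + card (- R))"
    by (simp add: UNIV_sum)
  obtain g where g: "\<And>v. g v \<in> polys UNIV" "alg_indep (Z n) g n"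
    using Z(1) by (rule irr_chain_alg_indep) blast
  have "n \<le> card I + card (- R)"
    by (rule alg_indep_le_growth[OF growth W(1) g(1) alg_indep_dense_in[OF g(2,1) W(2)]])
  moreover have "card R = r"
    using R(1) s0 by (simp add: W_def)
  moreover have "card I = card I'"
    unfolding I' by (rule card_image) simp
  ultimately have "n \<le> card I' + (CARD('b) - r)"
    by (simp add: card_Compl_finite)
  moreover have "has_chain {x. rank (M x) = r} (card I')"
  proof (rule has_chain_rank_stratum[OF M, of "?p ` W"])
    show "irr (?p ` W)"
      unfolding irr_def
    proof (intro conjI ballI impI)
      show "?p ` W \<noteq> {}"
        using s0 by auto
      fix f g assume fg: "f \<in> polys UNIV" "g \<in> polys UNIV" "\<forall>x\<in>?p ` W. f x * g x = 0"
      have "(\<forall>s\<in>W. f (?p s) = 0) \<or> (\<forall>s\<in>W. g (?p s) = 0)"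
        by (rule irrD[OF W(1) polys_Inl[OF fg(1)] polys_Inl[OF fg(2)]]) (use fg(3) in auto)
      then show "(\<forall>x\<in>?p ` W. f x = 0) \<or> (\<forall>x\<in>?p ` W. g x = 0)"
        by auto
    qed
    show "?p ` W \<subseteq> {x. rank (M x) = r}"
      by (auto simp: W_def)
    show "indep_on (?p ` W) I'"
      unfolding indep_on_def
    proof (intro ballI impI ext)
      fix w x assume w: "w \<in> polys I'" "\<forall>x\<in>?p ` W. w x = 0"
      have "(\<lambda>s. w (?p s)) \<in> polys I"
        using polys_Inl[OF w(1)] by (simp add: I')
      then have "(\<lambda>s. w (?p s)) = (\<lambda>s. 0)"
        using I(2) w(2) by (auto simp: indep_on_def)
      from fun_cong[OF this, of "case_sum x (\<lambda>_. 0)"] show "w x = 0"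
        by simp
    qed
  qed
  ultimately show ?thesis
    using r by blast
qed

text \<open>The independent coordinates of \<open>x\<close> on \<open>Z m\<close> together with the
  coordinates of \<open>y\<close> outside \<open>R\<close> are independent on the whole family,
  because over a point with \<open>h \<noteq> 0\<close> the latter can be prescribed. The length is
  only bounded below since \<open>I\<close> may have more than \<open>m\<close> elements.\<close>

lemma has_chain_kernel_family:
  fixes M :: "('n1::finite \<Rightarrow> 'a::alg_closed_field) \<Rightarrow> 'a ^ 'c ^ 'b"
  assumes M: "\<And>j k. (\<lambda>x. M x $ j $ k) \<in> polys UNIV" and chain: "has_chain {x. rank (M x) = r} m"
  shows "\<exists>n\<ge>m + (CARD('b) - r). has_chain (kernel_family M) n"
proof -
  let ?p = "\<lambda>(s :: 'n1 + 'b \<Rightarrow> 'a) i. s (Inl i)"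
  obtain Z where Z: "irr_chain Z m" "Z m \<subseteq> {x. rank (M x) = r}"
    using chain by (rule has_chain_irr_chain)
  have irr: "irr (Z m)"
    using Z(1) by (simp add: irr_chain_def)
  obtain I where I: "indep_on (Z m) I" "m \<le> card I"
    using Z(1) by (rule irr_chain_indep_on)
  obtain x0 where x0: "x0 \<in> Z m"
    using irr by (auto simp: irr_def)
  obtain G R where R: "card R = rank (M x0)" "det (bordered G R (M x0)) \<noteq> 0"
    by (rule bordered_exists)
  define h where "h = (\<lambda>x. det (bordered G R (M x)))"
  have h: "h \<in> polys UNIV"
    unfolding h_def by (intro polys_det polys_bordered M)
  have cardR: "card R = r"
    using R(1) x0 Z(2) by auto
  define K where "K = Inl ` I \<union> Inr ` (- R)"
  define P where "P = range (\<lambda>k (s :: 'n1 + 'b \<Rightarrow> 'a). \<Sum>j\<in>UNIV. s (Inr j) * M (?p s) $ j $ k)"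
  have zero: "{s. (\<forall>f\<in>P. f s = 0) \<and> (1 :: 'a) \<noteq> 0} = kernel_family M"
    by (auto simp: P_def kernel_family_def left_kernel_def vec_eq_iff)
  have "has_chain (kernel_family M) (card K)"
  proof (rule has_chain_locally_closed[of P "\<lambda>_. 1"])
    have "(\<lambda>s. M (?p s) $ j $ k) \<in> polys UNIV" for j k
      by (rule polys_mono[OF polys_Inl[OF M]]) simp
    then show "P \<subseteq> polys UNIV"
      unfolding P_def by (intro image_subsetI polys_sum polys_mult polys_var) auto
    show "indep_on {s. (\<forall>f\<in>P. f s = 0) \<and> (1 :: 'a) \<noteq> 0} K"
      unfolding zero indep_on_def
    proof (intro ballI impI ext)
      fix w and s :: "'n1 + 'b \<Rightarrow> 'a"
      assume w: "w \<in> polys K" "\<forall>s\<in>kernel_family M. w s = 0"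
      \<comment> \<open>The \<open>y\<close>-values are frozen, which leaves a polynomial in the
        coordinates \<open>I\<close> of \<open>x\<close>. It vanishes on \<open>Z m\<close> where
        \<open>h\<close> does not, hence on all of \<open>Z m\<close> by irreducibility.\<close>
      define z where "z = (\<lambda>j. s (Inr j))"
      have wI: "(\<lambda>x. w (case_sum x z)) \<in> polys I"
        by (rule polys_case_sum, rule polys_mono[OF w(1)]) (auto simp: K_def)
      have "w (case_sum x z) * h x = 0" if x: "x \<in> Z m" for x
      proof (cases "h x = 0")
        case False
        have "rank (M x) = card R"
          using x Z(2) cardR by auto
        then obtain y where y: "(\<Sum>j\<in>UNIV. y $ j *s M x $ j) = 0" "\<forall>l. l \<notin> R \<longrightarrow> y $ l = z l"
          using bordered_kernel_lift[of G R "M x"] False unfolding h_def by blast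
        have "w (case_sum x z) = w (case_sum x (vec_nth y))"
          by (rule polys_cong[OF w(1)]) (use y(2) in \<open>auto simp: K_def\<close>)
        moreover have "case_sum x (vec_nth y) \<in> kernel_family M"
          using y(1) by (simp add: kernel_family_def left_kernel_def)
        ultimately show ?thesis
          using w(2) by simp
      qed simp
      then have "\<forall>x\<in>Z m. w (case_sum x z) = 0"
        using irrD[OF irr wI h] x0 R(2) by (auto simp: h_def)
      then have "(\<lambda>x. w (case_sum x z)) = (\<lambda>x. 0)"
        using I(1) wI by (simp add: indep_on_def)
      from fun_cong[OF this, of "?p s"] have "w (case_sum (?p s) z) = 0" .
      moreover have "case_sum (?p s) z = s"
        by (auto simp: z_def fun_eq_iff split: sum.split)
      ultimately show "w s = 0"
        by simp
    qed
  qed (use zero polys_const in auto)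
  moreover have "card K = card I + (CARD('b) - r)"
  proof -
    have "card K = card (Inl ` I :: ('n1 + 'b) set) + card (Inr ` (- R) :: ('n1 + 'b) set)"
      unfolding K_def by (intro card_Un_disjoint) auto
    then show ?thesis
      by (simp add: card_image card_Compl_finite cardR)
  qed
  ultimately show ?thesis
    using I(2) by (intro exI[of _ "card K"]) simp
qed

section \<open>Dimensions for the tensor\<close>

lemma tensor_mat_nth: "tensor_mat T x $ j $ k = (\<Sum>i\<in>UNIV. T $ i $ j $ k * x $ i)"
  by (simp add: tensor_mat_def tensor_form_def axis_def if_distrib[of "\<lambda>x. _ * x"] cong: if_cong)

lemma tensor_vec_eq: "tensor_vec T x y = (\<Sum>j\<in>UNIV. y $ j *s tensor_mat T x $ j)"
proof -
  have "tensor_form T x y (axis k 1) = (\<Sum>j\<in>UNIV. y $ j * tensor_mat T x $ j $ k)" for k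
  proof -
    have "tensor_form T x y (axis k 1) = (\<Sum>i\<in>UNIV. \<Sum>j\<in>UNIV. T $ i $ j $ k * x $ i * y $ j)"
      by (simp add: tensor_form_def axis_def if_distrib[of "\<lambda>x. _ * x"] cong: if_cong)
    also have "\<dots> = (\<Sum>j\<in>UNIV. \<Sum>i\<in>UNIV. T $ i $ j $ k * x $ i * y $ j)"
      by (rule sum.swap)
    finally show ?thesis
      by (simp add: tensor_mat_nth sum_distrib_left mult_ac)
  qed
  then show ?thesis
    by (simp add: vec_eq_iff tensor_vec_def)
qed

lemma image_vec_nth: "vec_nth ` {x. P (vec_nth x)} = {s. P s}"
proof (intro subset_antisym subsetI)
  fix s assume "s \<in> {s. P s}"
  then show "s \<in> vec_nth ` {x. P (vec_nth x)}"
    by (intro image_eqI[of _ _ "vec_lambda s"]) (simp_all add: vec_lambda_inverse)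
qed auto

lemma zdim_kernel:
  fixes T :: "'a::alg_closed_field ^ 'n3::finite ^ 'n2::finite ^ 'n1::finite"
  shows "zdim {y. tensor_vec T x y = 0} = ereal (real (corank (tensor_mat T x)))"
proof -
  let ?A = "tensor_mat T x"
  have "vec_nth ` {y. tensor_vec T x y = 0} = left_kernel ?A"
    using image_vec_nth[of "\<lambda>y. (\<Sum>j\<in>UNIV. y j *s ?A $ j) = 0"]
    by (simp add: tensor_vec_eq left_kernel_def)
  then have "zdim {y. tensor_vec T x y = 0} =
      (SUP n\<in>{n. has_chain (left_kernel ?A) n}. ereal (real n))"
    by (simp add: zdim_eq_has_chain)
  also have "\<dots> = ereal (real (corank ?A))"
    unfolding corank_def
    by (intro antisym SUP_least SUP_upper) (auto intro: has_chain_left_kernel dest: has_chain_left_kernel_le)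
  finally show ?thesis .
qed

lemma zdim_zero_set:
  fixes T :: "'a::alg_closed_field ^ 'n3::finite ^ 'n2::finite ^ 'n1::finite"
  shows "zdim {join_vec x y | x y. tensor_vec T x y = 0} =
    (MAX i\<in>{..CARD('n2)}. zdim {x. corank (tensor_mat T x) = i} + ereal (real i))"
    (is "zdim ?V = Max (?f ` _)")
proof -
  define M where "M x = tensor_mat T (vec_lambda x)" for x
  have M: "(\<lambda>x. M x $ j $ k) \<in> polys UNIV" for j k
    unfolding M_def tensor_mat_nth vec_lambda_beta
    by (intro polys_sum polys_mult polys_const polys_var) auto
  have V: "vec_nth ` ?V = kernel_family M"
  proof (intro subset_antisym subsetI)
    fix s assume "s \<in> vec_nth ` ?V"
    then obtain x y where s: "s = vec_nth (join_vec x y)" "tensor_vec T x y = 0"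
      by blast
    then show "s \<in> kernel_family M"
      by (simp add: kernel_family_def left_kernel_def M_def join_vec_def tensor_vec_eq vec_nth_inverse)
  next
    fix s assume s: "s \<in> kernel_family M"
    define x y where "x = (\<chi> i. s (Inl i))" and "y = (\<chi> j. s (Inr j))"
    have "tensor_vec T x y = 0"
      using s by (simp add: kernel_family_def left_kernel_def M_def x_def y_def tensor_vec_eq)
    moreover have "s = vec_nth (join_vec x y)"
      by (auto simp: join_vec_def x_def y_def fun_eq_iff split: sum.split)
    ultimately show "s \<in> vec_nth ` ?V"
      by blast
  qed
  \<comment> \<open>Corank and rank determine each other because the rank never exceeds the number
    of rows, so the truncated subtraction in \<open>corank\<close> is a true difference.\<close>
  have X: "vec_nth ` {x. corank (tensor_mat T x) = CARD('n2) - r} = {x. rank (M x) = r}"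
    if "r \<le> CARD('n2)" for r
  proof -
    have "corank (tensor_mat T x) = CARD('n2) - r \<longleftrightarrow> rank (M (vec_nth x)) = r" for x
      using rank_le_rows[of "tensor_mat T x"] that by (auto simp: corank_def M_def vec_nth_inverse)
    then show ?thesis
      using image_vec_nth[of "\<lambda>x. rank (M x) = r"] by simp
  qed
  show ?thesis
  proof (rule antisym)
    show "zdim ?V \<le> Max (?f ` {..CARD('n2)})"
      unfolding zdim_eq_has_chain[of ?V] V
    proof (rule SUP_least)
      fix n assume "n \<in> {n. has_chain (kernel_family M) n}"
      then obtain r m where r: "r \<le> CARD('n2)" and m: "has_chain {x. rank (M x) = r} m"
        and n: "n \<le> m + (CARD('n2) - r)"
        using has_chain_kernel_family_le[OF M, of n] by auto
      let ?i = "CARD('n2) - r"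
      have "ereal (real m) \<le> zdim {x. corank (tensor_mat T x) = ?i}"
        unfolding zdim_eq_has_chain X[OF r] using m by (intro SUP_upper) simp
      have "ereal (real n) \<le> ereal (real m) + ereal (real ?i)"
        using n by simp
      also have "\<dots> \<le> ?f ?i"
        by (intro add_right_mono) fact
      also have "\<dots> \<le> Max (?f ` {..CARD('n2)})"
        by (intro Max_ge) auto
      finally show "ereal (real n) \<le> Max (?f ` {..CARD('n2)})" .
    qed
    have "?f i \<le> zdim ?V" if i: "i \<le> CARD('n2)" for i
    proof -
      define r where "r = CARD('n2) - i"
      have r: "r \<le> CARD('n2)" "CARD('n2) - r = i"
        using i by (auto simp: r_def)
      \<comment> \<open>Moving \<open>i\<close> to the other side leaves a bare supremum on the
        left, so chains can be compared one by one; an empty stratum, with supremum over no chains,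
        needs no separate case.\<close>
      have "zdim {x. corank (tensor_mat T x) = i} \<le> zdim ?V - ereal (real i)"
        unfolding zdim_eq_has_chain[of "{x. corank (tensor_mat T x) = i}"] X[OF r(1), unfolded r(2)]
      proof (rule SUP_least)
        fix m assume "m \<in> {m. has_chain {x. rank (M x) = r} m}"
        then obtain n where n: "m + i \<le> n" "has_chain (kernel_family M) n"
          using has_chain_kernel_family[OF M, of r m] r(2) by auto
        have "ereal (real m) + ereal (real i) \<le> ereal (real n)"
          using n(1) by simp
        also have "\<dots> \<le> zdim ?V"
          unfolding zdim_eq_has_chain V using n(2) by (intro SUP_upper) simp
        finally show "ereal (real m) \<le> zdim ?V - ereal (real i)"
          by (simp add: ereal_le_minus)
      qed
      then show ?thesis
        by (simp add: ereal_le_minus)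
    qed
    then show "Max (?f ` {..CARD('n2)}) \<le> zdim ?V"
      by (subst Max_le_iff) auto
  qed
qed

theorem theorem3p1:
  fixes T :: "'a::alg_closed_field ^ 'n3::finite ^ 'n2::finite ^ 'n1::finite"
  shows "zdim {join_vec x y | x y. tensor_vec T x y = 0} =
           (MAX i\<in>{..CARD('n2)}.
              zdim {x. zdim {y. tensor_vec T x y = 0} = ereal (real i)} + ereal (real i))
       \<and> (MAX i\<in>{..CARD('n2)}.
              zdim {x. zdim {y. tensor_vec T x y = 0} = ereal (real i)} + ereal (real i)) =
           (MAX i\<in>{..CARD('n2)}.
              zdim {x. corank (tensor_mat T x) = i} + ereal (real i))
       \<and> geometric_rank T = zcodim {join_vec x y | x y. tensor_vec T x y = 0}
       \<and> zcodim {join_vec x y | x y. tensor_vec T x y = 0} =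
           (MIN j\<in>{..CARD('n2)}.
              zcodim {x. rank (tensor_mat T x) = j} + ereal (real j))"
proof -
  let ?V = "{join_vec x y | x y. tensor_vec T x y = 0}"
  let ?f = "\<lambda>i. zdim {x. corank (tensor_mat T x) = i} + ereal (real i)"
  let ?g = "\<lambda>j. zcodim {x. rank (tensor_mat T x) = j} + ereal (real j)"
  let ?c = "\<lambda>d :: ereal. ereal (real CARD('n1 + 'n2)) - d"
  \<comment> \<open>With \<open>i = CARD('n2) - j\<close>, subtracting \<open>zdim + i\<close> from
    the dimension of the product space gives \<open>zcodim + j\<close>. The case split covers
    infinite values; for an empty stratum both sides are infinite.\<close>
  have g: "?g j = ?c (?f (CARD('n2) - j))" if "j \<le> CARD('n2)" for j
  proof -
    have "corank (tensor_mat T x) = CARD('n2) - j \<longleftrightarrow> rank (tensor_mat T x) = j" for x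
      using rank_le_rows[of "tensor_mat T x"] that by (auto simp: corank_def)
    then show ?thesis
      using that unfolding zcodim_def
      by (cases "zdim {x. rank (tensor_mat T x) = j}") (simp_all add: of_nat_diff)
  qed
  have "(MIN j\<in>{..CARD('n2)}. ?g j) = ?c (MAX i\<in>{..CARD('n2)}. ?f i)"
  proof (rule Min_eqI)
    show "?c (MAX i\<in>{..CARD('n2)}. ?f i) \<le> b" if b: "b \<in> ?g ` {..CARD('n2)}" for b
    proof -
      obtain j where j: "j \<le> CARD('n2)" "b = ?g j"
        using b by auto
      have "?f (CARD('n2) - j) \<le> (MAX i\<in>{..CARD('n2)}. ?f i)"
        by (intro Max_ge) auto
      then show ?thesis
        unfolding j(2) g[OF j(1)] by (intro ereal_minus_mono order_refl)
    qed
    have "(MAX i\<in>{..CARD('n2)}. ?f i) \<in> ?f ` {..CARD('n2)}"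
      by (intro Max_in) auto
    then obtain i where i: "i \<in> {..CARD('n2)}" "(MAX i\<in>{..CARD('n2)}. ?f i) = ?f i"
      by (elim imageE)
    have "?c (?f i) = ?g (CARD('n2) - i)"
      using g[of "CARD('n2) - i"] i(1) by simp
    then show "?c (MAX i\<in>{..CARD('n2)}. ?f i) \<in> ?g ` {..CARD('n2)}"
      unfolding i(2) by auto
  qed simp
  then have "zcodim ?V = (MIN j\<in>{..CARD('n2)}. ?g j)"
    unfolding zcodim_def[of ?V] zdim_zero_set by simp
  moreover have "{x. zdim {y. tensor_vec T x y = 0} = ereal (real i)} =
      {x. corank (tensor_mat T x) = i}" for i
    by (simp add: zdim_kernel)
  ultimately show ?thesis
    by (simp add: zdim_zero_set geometric_rank_def)
qed

end
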